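(* Let $\alpha>1$ be a constant, let $(M^{m},g)$ and $(N^{n},h)$ be compact Riemannian manifolds of dimensions $m$ and $n$, and let $\psi:(M,g)\to(N,h)$ be a harmonic map. If $m>2\alpha$, then there exists a smooth Riemannian metric $\bar g$ on $M$, conformally equivalent to $g$, such that $\psi:(M,\bar g)\to(N,h)$ is $\alpha$-harmonic.
   Context: For a smooth map $\psi:(M,g)\to(N,h)$ between Riemannian manifolds, $\nabla$ denotes the connection on $\psi^{-1}TN$ induced from the Levi-Civita connection of $N$, and $|d\psi|$ is the Hilbert–Schmidt norm of $d\psi$ with respect to $g$ and $h$. The tension field is $\tau(\psi)=\mathrm{Tr}_g\nabla d\psi$, and $\psi$ is harmonic if $\tau(\psi)=0$. For a constant $\alpha>1$, $\psi$ is $\alpha$-harmonic if it is a critical point (with respect to smooth variations) of $E_\alpha(\psi)=\int_M(1+|d\psi|^2)^\alpha\,dV_g$; the Euler–Lagrange equation is $\tau_\alpha(\psi)=2\alpha(1+|d\psi|^2)^{\alpha-1}\tau(\psi)+d\psi\big(\mathrm{grad}(2\alpha(1+|d\psi|^2)^{\alpha-1})\big)=0$. When the domain metric is $\bar g$, all of these (norm, volume, trace, gradient, Levi-Civita connection of $M$) are taken with respect to $\bar g$. Two metrics $g,\bar g$ are conformally equivalent if $\bar g=f g$ for some smooth positive function $f$ on $M$. *)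

theory Defs
  imports "HOL-Analysis.Analysis"
begin

text \<open>Meant for open S: then this says that all iterated directional derivatives up to
  order k exist and are continuous.\<close>

primrec times_cont_diff_on ::
  "nat \<Rightarrow> ('a::real_normed_vector \<Rightarrow> 'b::real_normed_vector) \<Rightarrow> 'a set \<Rightarrow> bool" where
  "times_cont_diff_on 0 f S \<longleftrightarrow> continuous_on S f"
| "times_cont_diff_on (Suc k) f S \<longleftrightarrow>
     (\<forall>x\<in>S. f differentiable (at x)) \<and>
     (\<forall>v. times_cont_diff_on k (\<lambda>x. frechet_derivative f (at x) v) S)"

definition smooth_on ::
  "('a::real_normed_vector \<Rightarrow> 'b::real_normed_vector) \<Rightarrow> 'a set \<Rightarrow> bool" where
  "smooth_on f S \<longleftrightarrow> (\<forall>k. times_cont_diff_on k f S)"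

definition partial_deriv ::
  "'m::finite \<Rightarrow> (real^'m \<Rightarrow> 'b::real_normed_vector) \<Rightarrow> real^'m \<Rightarrow> 'b" where
  "partial_deriv i f x = frechet_derivative f (at x) (axis i 1)"

text \<open>A chart is a domain together with a coordinate map; only the values of the coordinate
  map on the domain matter. Manifolds have no boundary and need not be connected.\<close>

type_synonym ('a, 'm) chart = "'a set \<times> ('a \<Rightarrow> real^'m)"

record ('a, 'm) manifold =
  mtop :: "'a topology"
  atlas :: "('a, 'm) chart set"

definition chart_dom :: "('a, 'm::finite) chart \<Rightarrow> 'a set" where
  "chart_dom c = fst c"

definition chart_map :: "('a, 'm::finite) chart \<Rightarrow> 'a \<Rightarrow> real^'m" where
  "chart_map c = snd c"

definition chart_img :: "('a, 'm::finite) chart \<Rightarrow> (real^'m) set" where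
  "chart_img c = chart_map c ` chart_dom c"

definition chart_inv :: "('a, 'm::finite) chart \<Rightarrow> real^'m \<Rightarrow> 'a" where
  "chart_inv c = inv_into (chart_dom c) (chart_map c)"

definition topological_chart :: "'a topology \<Rightarrow> ('a, 'm::finite) chart \<Rightarrow> bool" where
  "topological_chart T c \<longleftrightarrow>
     openin T (chart_dom c) \<and> open (chart_img c) \<and>
     homeomorphic_map (subtopology T (chart_dom c)) (top_of_set (chart_img c)) (chart_map c)"

definition smooth_manifold :: "('a, 'm::finite) manifold \<Rightarrow> bool" where
  "smooth_manifold M \<longleftrightarrow>
     Hausdorff_space (mtop M) \<and> second_countable (mtop M) \<and>
     (\<forall>c\<in>atlas M. topological_chart (mtop M) c) \<and>
     (\<Union>c\<in>atlas M. chart_dom c) = topspace (mtop M) \<and>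
     (\<forall>c\<in>atlas M. \<forall>d\<in>atlas M.
        smooth_on (chart_map d \<circ> chart_inv c) (chart_map c ` (chart_dom c \<inter> chart_dom d)))"

definition smooth_function :: "('a, 'm::finite) manifold \<Rightarrow> ('a \<Rightarrow> real) \<Rightarrow> bool" where
  "smooth_function M f \<longleftrightarrow> (\<forall>c\<in>atlas M. smooth_on (f \<circ> chart_inv c) (chart_img c))"

definition map_rep ::
  "('a, 'm::finite) chart \<Rightarrow> ('b, 'n::finite) chart \<Rightarrow> ('a \<Rightarrow> 'b) \<Rightarrow> real^'m \<Rightarrow> real^'n" where
  "map_rep c d \<psi> x = chart_map d (\<psi> (chart_inv c x))"

definition smooth_map ::
  "('a, 'm::finite) manifold \<Rightarrow> ('b, 'n::finite) manifold \<Rightarrow> ('a \<Rightarrow> 'b) \<Rightarrow> bool" where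
  "smooth_map M N \<psi> \<longleftrightarrow>
     continuous_map (mtop M) (mtop N) \<psi> \<and>
     (\<forall>c\<in>atlas M. \<forall>d\<in>atlas N.
        smooth_on (map_rep c d \<psi>) (chart_map c ` {p \<in> chart_dom c. \<psi> p \<in> chart_dom d}))"

text \<open>A (0,2)-tensor field is given by its component matrices in the charts of the atlas:
  g c p is the matrix of components, at the point p, with respect to the coordinate frame
  of c. The third clause below is the tensor transformation law.\<close>

type_synonym ('a, 'm) metric = "('a, 'm) chart \<Rightarrow> 'a \<Rightarrow> real^'m^'m"

definition metric_rep ::
  "('a, 'm::finite) metric \<Rightarrow> ('a, 'm) chart \<Rightarrow> real^'m \<Rightarrow> real^'m^'m" where
  "metric_rep g c x = g c (chart_inv c x)"

definition riemannian_metric :: "('a, 'm::finite) manifold \<Rightarrow> ('a, 'm) metric \<Rightarrow> bool" where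
  "riemannian_metric M g \<longleftrightarrow>
     (\<forall>c\<in>atlas M. smooth_on (metric_rep g c) (chart_img c)) \<and>
     (\<forall>c\<in>atlas M. \<forall>p\<in>chart_dom c.
        transpose (g c p) = g c p \<and> (\<forall>v. v \<noteq> 0 \<longrightarrow> v \<bullet> (g c p *v v) > 0)) \<and>
     (\<forall>c\<in>atlas M. \<forall>d\<in>atlas M. \<forall>p\<in>chart_dom c \<inter> chart_dom d.
        let J = jacobian (chart_map d \<circ> chart_inv c) (at (chart_map c p))
        in g c p = transpose J ** g d p ** J)"

definition riemannian_manifold :: "('a, 'm::finite) manifold \<Rightarrow> ('a, 'm) metric \<Rightarrow> bool" where
  "riemannian_manifold M g \<longleftrightarrow> smooth_manifold M \<and> riemannian_metric M g"

definition conformally_equivalent ::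
  "('a, 'm::finite) manifold \<Rightarrow> ('a, 'm) metric \<Rightarrow> ('a, 'm) metric \<Rightarrow> bool" where
  "conformally_equivalent M g g' \<longleftrightarrow>
     (\<exists>f. smooth_function M f \<and> (\<forall>p\<in>topspace (mtop M). f p > 0) \<and>
          (\<forall>c\<in>atlas M. \<forall>p\<in>chart_dom c. g' c p = f p *\<^sub>R g c p))"

text \<open>The Riemannian volume measure is the unique Borel measure that in every chart has
  density sqrt (det g) with respect to Lebesgue measure.\<close>

definition volume_measure :: "('a, 'm::finite) manifold \<Rightarrow> ('a, 'm) metric \<Rightarrow> 'a measure" where
  "volume_measure M g = (THE \<mu>.
     sets \<mu> = sets (sigma (topspace (mtop M)) {U. openin (mtop M) U}) \<and>
     (\<forall>c\<in>atlas M. \<forall>B\<in>sets \<mu>. B \<subseteq> chart_dom c \<longrightarrow>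
        emeasure \<mu> B =
          (\<integral>\<^sup>+x. ennreal (sqrt (det (metric_rep g c x))) * indicator (chart_map c ` B) x \<partial>lborel)))"

text \<open>Christoffel symbols of the Levi-Civita connection: upper index k, lower indices i, j.\<close>

definition christoffel ::
  "('a, 'm::finite) metric \<Rightarrow> ('a, 'm) chart \<Rightarrow> 'm \<Rightarrow> 'm \<Rightarrow> 'm \<Rightarrow> real^'m \<Rightarrow> real" where
  "christoffel g c k i j x =
     (1/2) * (\<Sum>l\<in>UNIV. matrix_inv (metric_rep g c x) $ k $ l *
        (partial_deriv i (\<lambda>y. metric_rep g c y $ j $ l) x
         + partial_deriv j (\<lambda>y. metric_rep g c y $ i $ l) x
         - partial_deriv l (\<lambda>y. metric_rep g c y $ i $ j) x))"

text \<open>Component a of \<open>(\<nabla>d\<psi>)(\<partial>\<^sub>i, \<partial>\<^sub>j)\<close>, where \<open>\<nabla>\<close> is induced from the Levi-Civita connection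
  of g on the cotangent bundle of M and the pull-back to M of the Levi-Civita connection of h.\<close>

definition second_fundamental_form ::
  "('a, 'm::finite) metric \<Rightarrow> ('b, 'n::finite) metric \<Rightarrow> ('a, 'm) chart \<Rightarrow> ('b, 'n) chart \<Rightarrow>
   ('a \<Rightarrow> 'b) \<Rightarrow> 'm \<Rightarrow> 'm \<Rightarrow> 'n \<Rightarrow> real^'m \<Rightarrow> real" where
  "second_fundamental_form g h c d \<psi> i j a x =
     (let u = map_rep c d \<psi> in
        partial_deriv i (\<lambda>y. partial_deriv j u y $ a) x
        - (\<Sum>k\<in>UNIV. christoffel g c k i j x * partial_deriv k u x $ a)
        + (\<Sum>b\<in>UNIV. \<Sum>e\<in>UNIV. christoffel h d a b e (u x)
             * partial_deriv i u x $ b * partial_deriv j u x $ e))"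

text \<open>Components, in the chart d, of the trace of \<open>\<nabla>d\<psi>\<close> at the point with coordinates x in c.\<close>

definition tension_field ::
  "('a, 'm::finite) metric \<Rightarrow> ('b, 'n::finite) metric \<Rightarrow> ('a, 'm) chart \<Rightarrow> ('b, 'n) chart \<Rightarrow>
   ('a \<Rightarrow> 'b) \<Rightarrow> real^'m \<Rightarrow> real^'n" where
  "tension_field g h c d \<psi> x =
     (\<chi> a. \<Sum>i\<in>UNIV. \<Sum>j\<in>UNIV.
        matrix_inv (metric_rep g c x) $ i $ j * second_fundamental_form g h c d \<psi> i j a x)"

definition harmonic_map ::
  "('a, 'm::finite) manifold \<Rightarrow> ('a, 'm) metric \<Rightarrow> ('b, 'n::finite) manifold \<Rightarrow> ('b, 'n) metric \<Rightarrow>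
   ('a \<Rightarrow> 'b) \<Rightarrow> bool" where
  "harmonic_map M g N h \<psi> \<longleftrightarrow>
     smooth_map M N \<psi> \<and>
     (\<forall>c\<in>atlas M. \<forall>d\<in>atlas N. \<forall>p\<in>chart_dom c. \<psi> p \<in> chart_dom d \<longrightarrow>
        tension_field g h c d \<psi> (chart_map c p) = 0)"

text \<open>Squared Hilbert-Schmidt norm of \<open>d\<psi>\<close>. By the transformation laws the value does not
  depend on the chosen charts.\<close>

definition differential_norm_sq_rep ::
  "('a, 'm::finite) metric \<Rightarrow> ('b, 'n::finite) metric \<Rightarrow> ('a, 'm) chart \<Rightarrow> ('b, 'n) chart \<Rightarrow>
   ('a \<Rightarrow> 'b) \<Rightarrow> real^'m \<Rightarrow> real" where
  "differential_norm_sq_rep g h c d \<psi> x =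
     (let u = map_rep c d \<psi> in
        \<Sum>i\<in>UNIV. \<Sum>j\<in>UNIV. matrix_inv (metric_rep g c x) $ i $ j *
          (partial_deriv i u x \<bullet> (metric_rep h d (u x) *v partial_deriv j u x)))"

definition chart_at :: "('a, 'm::finite) manifold \<Rightarrow> 'a \<Rightarrow> ('a, 'm) chart" where
  "chart_at M p = (SOME c. c \<in> atlas M \<and> p \<in> chart_dom c)"

definition differential_norm_sq ::
  "('a, 'm::finite) manifold \<Rightarrow> ('a, 'm) metric \<Rightarrow> ('b, 'n::finite) manifold \<Rightarrow> ('b, 'n) metric \<Rightarrow>
   ('a \<Rightarrow> 'b) \<Rightarrow> 'a \<Rightarrow> real" where
  "differential_norm_sq M g N h \<psi> p =
     differential_norm_sq_rep g h (chart_at M p) (chart_at N (\<psi> p)) \<psi>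
       (chart_map (chart_at M p) p)"

definition alpha_energy ::
  "real \<Rightarrow> ('a, 'm::finite) manifold \<Rightarrow> ('a, 'm) metric \<Rightarrow> ('b, 'n::finite) manifold \<Rightarrow>
   ('b, 'n) metric \<Rightarrow> ('a \<Rightarrow> 'b) \<Rightarrow> real" where
  "alpha_energy \<alpha> M g N h \<psi> =
     (LINT p|volume_measure M g. (1 + differential_norm_sq M g N h \<psi> p) powr \<alpha>)"

definition smooth_variation ::
  "('a, 'm::finite) manifold \<Rightarrow> ('b, 'n::finite) manifold \<Rightarrow> ('a \<Rightarrow> 'b) \<Rightarrow>
   real \<Rightarrow> (real \<Rightarrow> 'a \<Rightarrow> 'b) \<Rightarrow> bool" where
  "smooth_variation M N \<psi> \<epsilon> \<Psi> \<longleftrightarrow>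
     \<epsilon> > 0 \<and>
     (\<forall>p\<in>topspace (mtop M). \<Psi> 0 p = \<psi> p) \<and>
     continuous_map (prod_topology (top_of_set {-\<epsilon><..<\<epsilon>}) (mtop M)) (mtop N) (\<lambda>(t, p). \<Psi> t p) \<and>
     (\<forall>c\<in>atlas M. \<forall>d\<in>atlas N.
        smooth_on (\<lambda>(t, x). map_rep c d (\<Psi> t) x)
          {(t, chart_map c p) |t p. t \<in> {-\<epsilon><..<\<epsilon>} \<and> p \<in> chart_dom c \<and> \<Psi> t p \<in> chart_dom d})"

text \<open>Intended for compact M, so that the energy is finite and variations need no
  support condition.\<close>

definition alpha_harmonic_map ::
  "real \<Rightarrow> ('a, 'm::finite) manifold \<Rightarrow> ('a, 'm) metric \<Rightarrow> ('b, 'n::finite) manifold \<Rightarrow>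
   ('b, 'n) metric \<Rightarrow> ('a \<Rightarrow> 'b) \<Rightarrow> bool" where
  "alpha_harmonic_map \<alpha> M g N h \<psi> \<longleftrightarrow>
     smooth_map M N \<psi> \<and>
     (\<forall>\<epsilon> \<Psi>. smooth_variation M N \<psi> \<epsilon> \<Psi> \<longrightarrow>
        ((\<lambda>t. alpha_energy \<alpha> M g N h (\<Psi> t)) has_real_derivative 0) (at 0))"

end

theory Submission
  imports Defs
begin

text \<open>Write \<open>e = |d\<psi>|\<^sup>2\<close> and \<open>m = dim M\<close>. For \<open>\<Psi>\<^sub>t\<close> a variation of \<open>\<psi>\<close> and the metric \<open>f g\<close>, the derivative of
  \<open>(1 + |d\<Psi>\<^sub>t|\<^sup>2/f)\<^bsup>\<alpha>\<^esup> f\<^bsup>m/2\<^esup>\<close> at \<open>t = 0\<close> is \<open>\<alpha> (1 + e/f)\<^bsup>\<alpha>-1\<^esup> f\<^bsup>m/2-1\<^esup>\<close> times that of \<open>|d\<Psi>\<^sub>t|\<^sup>2\<close>. If f is chosen such that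
  \<open>(1 + e/f)\<^bsup>\<alpha>-1\<^esup> f\<^bsup>m/2-1\<^esup> = 1\<close>, then the first variation of the \<open>\<alpha>\<close>-energy for \<open>f g\<close> is \<open>\<alpha>\<close> times the first
  variation of the Dirichlet energy for g, which vanishes because \<open>\<psi>\<close> is harmonic. Putting \<open>s = e/f\<close> and
  \<open>\<beta> = 2(\<alpha>-1)/(m-2)\<close>, the equation for f becomes \<open>f = (1+s)\<^bsup>-\<beta>\<^esup>\<close> and \<open>s (1+s)\<^bsup>-\<beta>\<^esup> = e\<close>. The hypothesis
  \<open>m > 2\<alpha>\<close> says \<open>\<beta> < 1\<close>, which makes the left-hand side a diffeomorphism near \<open>{0..}\<close>, so that f is smooth.

  For the Dirichlet energy, the derivative of the energy density is twice the divergence of the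
  vector field dual to the 1-form \<open>h(V, d\<psi>)\<close>, where V is the variation field. The divergence theorem
  is proved with a \<open>C\<^sup>1\<close> partition of unity and integration by parts in charts.\<close>

section \<open>Calculus of continuously differentiable functions\<close>

text \<open>Criticality is tested on the energy itself, so of the metric f g only the norm and the
  volume density have to be computed, and both are powers of f times those of g; the connection of f
  g never enters. The map may have points with d\<psi> = 0, where a power of e would fail to be
  smooth. Hence f is taken as a smooth function of e on an open set that contains 0. Norm and flux
  are read off in charts picked by choice. They become usable only after invariance under changes of
  both charts, and both are values of one bilinear pairing, \<open>hs_inner\<close>. The volume is a
  definite description, so its existence and uniqueness have to be proved, through the change of
  variables between charts. Joint smoothness in (t, x) is what allows the t- and x-derivatives to be
  interchanged. One integration by parts costs one derivative of the partition functions, which is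
  why C^1 is enough and a squared positive part serves as bump.\<close>

lemma tcd_cong:
  assumes "open S" "\<And>x. x \<in> S \<Longrightarrow> f x = g x" "times_cont_diff_on k f S"
  shows "times_cont_diff_on k g S"
  using assms(2,3)
proof (induction k arbitrary: f g)
  case 0
  then show ?case using continuous_on_cong[of S S f g] by simp
next
  case (Suc k)
  \<comment> \<open>A derivative at a point of S sees a neighbourhood; S is open, so agreement on S
    carries it over.\<close>
  have d: "(g has_derivative frechet_derivative f (at x)) (at x)" if "x \<in> S" for x
  proof (rule has_derivative_transform_within_open[OF _ assms(1) that])
    show "(f has_derivative frechet_derivative f (at x)) (at x)"
      using that Suc.prems(2) by (simp add: frechet_derivative_works[symmetric])
  qed (use Suc.prems(1) in blast)
  then have "frechet_derivative g (at x) = frechet_derivative f (at x)" if "x \<in> S" for x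
    using that frechet_derivative_at by metis
  moreover have "g differentiable at x" if "x \<in> S" for x
    using d that by (auto simp: differentiable_def)
  moreover have "times_cont_diff_on k (\<lambda>x. frechet_derivative g (at x) v) S" for v
    by (rule Suc.IH[of "\<lambda>x. frechet_derivative f (at x) v"]) (use Suc.prems(2) calculation in auto)
  ultimately show ?case
    by simp
qed

lemma tcd_subset:
  assumes "times_cont_diff_on k f S" "T \<subseteq> S"
  shows "times_cont_diff_on k f T"
  using assms by (induction k arbitrary: f) (auto intro: continuous_on_subset)

lemma tcd_has_derivative:
  assumes "times_cont_diff_on (Suc k) f S" "x \<in> S"
  shows "(f has_derivative frechet_derivative f (at x)) (at x)"
  using assms by (simp add: frechet_derivative_works[symmetric])

lemma tcd_SucD: "times_cont_diff_on (Suc k) f S \<Longrightarrow> times_cont_diff_on k f S"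
proof (induction k arbitrary: f)
  case 0
  then show ?case
    by (auto intro!: continuous_at_imp_continuous_on differentiable_imp_continuous_within)
next
  case (Suc k)
  from Suc.prems have "\<forall>x\<in>S. f differentiable (at x)"
    "\<And>v. times_cont_diff_on k (\<lambda>x. frechet_derivative f (at x) v) S"
    using Suc.IH by auto
  then show ?case by simp
qed

lemma tcd_continuous_on: "times_cont_diff_on k f S \<Longrightarrow> continuous_on S f"
  by (induction k) (auto dest!: tcd_SucD simp del: times_cont_diff_on.simps(2))

text \<open>Allows an explicit formula for the derivative in place of the one selected by
  \<open>frechet_derivative\<close>; the closure rules below are inductions through this
  rule.\<close>

lemma tcd_SucI:
  assumes "open S" "\<And>x. x \<in> S \<Longrightarrow> (f has_derivative f' x) (at x)"
    "\<And>v. times_cont_diff_on k (\<lambda>x. f' x v) S"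
  shows "times_cont_diff_on (Suc k) f S"
proof -
  have "f' x v = frechet_derivative f (at x) v" if "x \<in> S" for x v
    using frechet_derivative_at[OF assms(2)[OF that]] by simp
  then have "times_cont_diff_on k (\<lambda>x. frechet_derivative f (at x) v) S" for v
    by (rule tcd_cong[OF assms(1) _ assms(3)])
  then show ?thesis
    using assms(2) by (auto simp: differentiable_def)
qed

text \<open>Serves functions whose convenient formula depends on a chart that must be chosen anew
  near each point.\<close>

lemma tcd_local:
  assumes "\<And>x. x \<in> S \<Longrightarrow> \<exists>T. open T \<and> x \<in> T \<and> times_cont_diff_on k f T"
  shows "times_cont_diff_on k f S"
  using assms
proof (induction k arbitrary: f)
  case 0
  then show ?case
    by (auto intro!: continuous_at_imp_continuous_on simp: continuous_on_eq_continuous_at)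
      (metis continuous_on_eq_continuous_at)
next
  case (Suc k)
  then show ?case by simp meson
qed

lemma tcd_const: "times_cont_diff_on k (\<lambda>x. c) S"
proof (induction k arbitrary: c)
  case (Suc k)
  then show ?case by (simp add: frechet_derivative_const)
qed simp

lemma tcd_bounded_linear_compose:
  assumes "bounded_linear L" "open S" "times_cont_diff_on k f S"
  shows "times_cont_diff_on k (\<lambda>x. L (f x)) S"
  using assms(3)
proof (induction k arbitrary: f)
  case 0
  then show ?case
    using bounded_linear.continuous_on[OF assms(1)] by auto
next
  case (Suc k)
  show ?case
  proof (rule tcd_SucI[OF assms(2)])
    show "((\<lambda>x. L (f x)) has_derivative (\<lambda>v. L (frechet_derivative f (at x) v))) (at x)"
      if "x \<in> S" for x
      using bounded_linear.has_derivative[OF assms(1) tcd_has_derivative[OF Suc.prems that]] .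
  qed (use Suc in auto)
qed

lemma tcd_ident: "open S \<Longrightarrow> times_cont_diff_on k (\<lambda>x. x) S"
proof (cases k)
  case (Suc n)
  then show ?thesis
    using tcd_SucI[of S "\<lambda>x. x" "\<lambda>x v. v" n] tcd_const by (auto simp: has_derivative_ident)
qed (simp add: continuous_on_id)

lemma tcd_bounded_linear: "bounded_linear L \<Longrightarrow> open S \<Longrightarrow> times_cont_diff_on k L S"
  using tcd_bounded_linear_compose[OF _ _ tcd_ident] .

lemma tcd_add:
  assumes "open S" "times_cont_diff_on k f S" "times_cont_diff_on k g S"
  shows "times_cont_diff_on k (\<lambda>x. f x + g x) S"
  using assms(2,3)
proof (induction k arbitrary: f g)
  case (Suc k)
  show ?case
    by (rule tcd_SucI[OF assms(1), where f' = "\<lambda>x v. frechet_derivative f (at x) v + frechet_derivative g (at x) v"])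
      (use Suc in \<open>auto intro!: has_derivative_add simp: frechet_derivative_works[symmetric]\<close>)
qed (auto intro: continuous_intros)

lemma tcd_sum:
  assumes "open S" "\<And>i. i \<in> I \<Longrightarrow> times_cont_diff_on k (f i) S"
  shows "times_cont_diff_on k (\<lambda>x. \<Sum>i\<in>I. f i x) S"
  using assms(2)
  by (induction I rule: infinite_finite_induct) (auto intro!: tcd_const tcd_add assms(1))

lemma tcd_bilinear:
  assumes "bounded_bilinear P" "open S" "times_cont_diff_on k f S" "times_cont_diff_on k g S"
  shows "times_cont_diff_on k (\<lambda>x. P (f x) (g x)) S"
  using assms(3,4)
proof (induction k arbitrary: f g)
  case 0
  then show ?case using bounded_bilinear.continuous_on[OF assms(1)] by auto
next
  case (Suc k)
  show ?case
  proof (rule tcd_SucI[OF assms(2)])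
    show "((\<lambda>x. P (f x) (g x)) has_derivative
        (\<lambda>v. P (f x) (frechet_derivative g (at x) v) + P (frechet_derivative f (at x) v) (g x))) (at x)"
      if "x \<in> S" for x
      using bounded_bilinear.FDERIV[OF assms(1) tcd_has_derivative[OF Suc.prems(1) that]
          tcd_has_derivative[OF Suc.prems(2) that]] .
    show "times_cont_diff_on k (\<lambda>x. P (f x) (frechet_derivative g (at x) v)
        + P (frechet_derivative f (at x) v) (g x)) S" for v
      using Suc.prems tcd_SucD[OF Suc.prems(1)] tcd_SucD[OF Suc.prems(2)]
      by (intro tcd_add assms(2) Suc.IH) auto
  qed
qed

lemmas tcd_mult = tcd_bilinear[OF bounded_bilinear_mult]
lemmas tcd_scaleR = tcd_bilinear[OF bounded_bilinear_scaleR]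
lemmas tcd_inner = tcd_bilinear[OF bounded_bilinear_inner]

lemma tcd_minus: "open S \<Longrightarrow> times_cont_diff_on k f S \<Longrightarrow> times_cont_diff_on k (\<lambda>x. - f x) S"
  by (rule tcd_bounded_linear_compose[OF bounded_linear_minus[OF bounded_linear_ident]])

lemma tcd_diff:
  assumes "open S" "times_cont_diff_on k f S" "times_cont_diff_on k g S"
  shows "times_cont_diff_on k (\<lambda>x. f x - g x) S"
  using tcd_add[OF assms(1,2) tcd_minus[OF assms(1,3)]] by simp

lemma tcd_prod:
  fixes f :: "'i \<Rightarrow> 'a::real_normed_vector \<Rightarrow> real"
  assumes "open S" "\<And>i. i \<in> I \<Longrightarrow> times_cont_diff_on k (f i) S"
  shows "times_cont_diff_on k (\<lambda>x. \<Prod>i\<in>I. f i x) S"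
  using assms(2)
  by (induction I rule: infinite_finite_induct) (auto intro!: tcd_const tcd_mult assms(1))

text \<open>\<open>times_cont_diff_on\<close> controls directional derivatives in fixed directions
  only, whereas the chain rule produces the derivative of f in the moving direction g'(x) v.
  Expanding this direction in the finite basis of the middle space gives a sum of products, to which
  the induction hypothesis applies.\<close>

lemma tcd_compose:
  fixes g :: "'a::real_normed_vector \<Rightarrow> 'b::euclidean_space"
  assumes "open S" "open T" "g ` S \<subseteq> T" "times_cont_diff_on k f T" "times_cont_diff_on k g S"
  shows "times_cont_diff_on k (\<lambda>x. f (g x)) S"
  using assms(4,5)
proof (induction k arbitrary: f)
  case 0
  then show ?case
    using continuous_on_compose2 assms(3) by fastforce
next
  case (Suc k)
  let ?D = "\<lambda>x v. \<Sum>b\<in>Basis. (frechet_derivative g (at x) v \<bullet> b) *\<^sub>R frechet_derivative f (at (g x)) b"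
  show ?case
  proof (rule tcd_SucI[OF assms(1), where f' = ?D])
    fix x assume x: "x \<in> S"
    then have gx: "g x \<in> T" using assms(3) by auto
    have df: "(f has_derivative frechet_derivative f (at (g x))) (at (g x))"
      using tcd_has_derivative[OF Suc.prems(1) gx] .
    have "((\<lambda>x. f (g x)) has_derivative
        (\<lambda>v. frechet_derivative f (at (g x)) (frechet_derivative g (at x) v))) (at x)"
      using has_derivative_compose[OF tcd_has_derivative[OF Suc.prems(2) x] df] .
    moreover have "frechet_derivative f (at (g x)) (frechet_derivative g (at x) v) = ?D x v" for v
    proof -
      have "frechet_derivative f (at (g x)) (frechet_derivative g (at x) v)
        = frechet_derivative f (at (g x)) (\<Sum>b\<in>Basis. (frechet_derivative g (at x) v \<bullet> b) *\<^sub>R b)"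
        by (simp add: euclidean_representation)
      also have "\<dots> = ?D x v"
        using has_derivative_linear[OF df] by (simp add: linear_sum linear_scale)
      finally show ?thesis .
    qed
    ultimately show "((\<lambda>x. f (g x)) has_derivative ?D x) (at x)"
      by simp
  next
    fix v
    show "times_cont_diff_on k (\<lambda>x. ?D x v) S"
      using Suc.prems tcd_SucD[OF Suc.prems(2)]
      by (intro tcd_sum tcd_scaleR tcd_inner tcd_const Suc.IH assms(1)) auto
  qed
qed

lemma bounded_linear_axis: "bounded_linear (axis i :: 'a::euclidean_space \<Rightarrow> 'a^'n::finite)"
proof -
  have "linear (axis i :: 'a \<Rightarrow> 'a^'n)"
    by (rule linearI) (auto simp: axis_def vec_eq_iff)
  then show ?thesis
    by (simp add: linear_conv_bounded_linear)
qed

lemma tcd_vec_nth: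
  "open S \<Longrightarrow> times_cont_diff_on k f S \<Longrightarrow> times_cont_diff_on k (\<lambda>x. f x $ i) S"
  by (rule tcd_bounded_linear_compose[OF bounded_linear_vec_nth])

lemma tcd_vec_lambda:
  fixes f :: "'a::real_normed_vector \<Rightarrow> 'n::finite \<Rightarrow> 'b::euclidean_space"
  assumes "open S" "\<And>i. times_cont_diff_on k (\<lambda>x. f x i) S"
  shows "times_cont_diff_on k (\<lambda>x. \<chi> i. f x i) S"
proof -
  have "times_cont_diff_on k (\<lambda>x. \<Sum>i\<in>UNIV. axis i (f x i)) S"
    by (intro tcd_sum tcd_bounded_linear_compose[OF bounded_linear_axis] assms)
  moreover have "(\<Sum>i\<in>UNIV. axis i (f x i)) = (\<chi> i. f x i)" for x
    by (simp add: vec_eq_iff axis_def if_distrib cong: if_cong)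
  ultimately show ?thesis by simp
qed

lemma tcd_matrix_vector_mult:
  fixes A :: "'a::real_normed_vector \<Rightarrow> real^'m^'n"
  assumes "open S" "times_cont_diff_on k A S" "times_cont_diff_on k w S"
  shows "times_cont_diff_on k (\<lambda>x. A x *v w x) S"
  unfolding matrix_vector_mult_def
  by (intro tcd_vec_lambda tcd_sum tcd_mult tcd_vec_nth assms)

lemma tcd_det:
  fixes A :: "'a::real_normed_vector \<Rightarrow> real^'n^'n"
  assumes "open S" "\<And>i j. times_cont_diff_on k (\<lambda>x. A x $ i $ j) S"
  shows "times_cont_diff_on k (\<lambda>x. det (A x)) S"
  unfolding det_def by (intro tcd_sum tcd_mult tcd_prod tcd_const assms)

lemma tcd_Pair:
  assumes "open S" "times_cont_diff_on k f S" "times_cont_diff_on k g S"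
  shows "times_cont_diff_on k (\<lambda>x. (f x, g x)) S"
proof -
  have "times_cont_diff_on k (\<lambda>x. (f x, 0) + (0, g x)) S"
    by (intro tcd_add assms tcd_bounded_linear_compose[of "\<lambda>y. (y, 0)"]
        tcd_bounded_linear_compose[of "\<lambda>y. (0, y)"] bounded_linear_Pair
        bounded_linear_ident bounded_linear_zero)
  then show ?thesis by simp
qed

lemma tcd_real_SucI:
  fixes f :: "real \<Rightarrow> real"
  assumes "open S" "\<And>x. x \<in> S \<Longrightarrow> (f has_real_derivative f' x) (at x)" "times_cont_diff_on k f' S"
  shows "times_cont_diff_on (Suc k) f S"
  by (rule tcd_SucI[OF assms(1), where f' = "\<lambda>x v. f' x * v"])
    (use assms in \<open>auto intro!: tcd_mult tcd_const simp: has_field_derivative_def\<close>)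

lemma tcd_powr: "times_cont_diff_on k (\<lambda>x::real. x powr a) {0<..}"
proof (induction k arbitrary: a)
  case 0
  then show ?case by (auto intro!: continuous_intros)
next
  case (Suc k)
  show ?case
    by (rule tcd_real_SucI[where f' = "\<lambda>x. a * x powr (a - 1)"])
      (auto intro!: tcd_mult tcd_const Suc has_real_derivative_powr)
qed

lemma tcd_powr_compose:
  fixes f :: "'a::real_normed_vector \<Rightarrow> real"
  assumes "open S" "times_cont_diff_on k f S" "\<And>x. x \<in> S \<Longrightarrow> f x > 0"
  shows "times_cont_diff_on k (\<lambda>x. f x powr a) S"
  using assms by (intro tcd_compose[OF _ _ _ tcd_powr, where g = f]) auto

lemma tcd_inverse_compose:
  fixes f :: "'a::real_normed_vector \<Rightarrow> real"
  assumes "open S" "times_cont_diff_on k f S" "\<And>x. x \<in> S \<Longrightarrow> f x > 0"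
  shows "times_cont_diff_on k (\<lambda>x. inverse (f x)) S"
  by (rule tcd_cong[OF assms(1) _ tcd_powr_compose[OF assms, of "-1"]])
    (simp add: powr_minus assms(3) less_imp_le)

lemma tcd_divide:
  fixes f :: "'a::real_normed_vector \<Rightarrow> real"
  assumes "open S" "times_cont_diff_on k f S" "times_cont_diff_on k g S" "\<And>x. x \<in> S \<Longrightarrow> g x > 0"
  shows "times_cont_diff_on k (\<lambda>x. f x / g x) S"
  unfolding divide_inverse by (intro tcd_mult tcd_inverse_compose assms)

lemma tcd_sqrt_compose:
  fixes f :: "'a::real_normed_vector \<Rightarrow> real"
  assumes "open S" "times_cont_diff_on k f S" "\<And>x. x \<in> S \<Longrightarrow> f x > 0"
  shows "times_cont_diff_on k (\<lambda>x. sqrt (f x)) S"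
  by (rule tcd_cong[OF assms(1) _ tcd_powr_compose[OF assms, of "1/2"]])
    (simp add: powr_half_sqrt assms(3) less_imp_le)

section \<open>Smoothness of the matrix inverse and of the bump profile\<close>

lemma matrix_inv_left_right:
  fixes A :: "real^'n^'n"
  assumes "invertible A"
  shows "A ** matrix_inv A = mat 1" "matrix_inv A ** A = mat 1"
proof -
  have "\<exists>A'. A ** A' = mat 1 \<and> A' ** A = mat 1"
    using assms unfolding invertible_def .
  then have "A ** matrix_inv A = mat 1 \<and> matrix_inv A ** A = mat 1"
    unfolding matrix_inv_def by (rule someI_ex)
  then show "A ** matrix_inv A = mat 1" "matrix_inv A ** A = mat 1" by auto
qed

lemma matrix_inv_eqI:
  fixes A :: "real^'n^'n"
  assumes "A ** B = mat 1"
  shows "matrix_inv A = B"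
proof -
  have inv: "invertible A"
    using assms invertible_right_inverse by blast
  have "matrix_inv A = matrix_inv A ** (A ** B)"
    using assms by simp
  also have "\<dots> = (matrix_inv A ** A) ** B"
    by (rule matrix_mul_assoc)
  finally show ?thesis
    using matrix_inv_left_right(2)[OF inv] by simp
qed

text \<open>Cramer's rule for the column equation A x = e_j. It exhibits the entries of the inverse
  as quotients of polynomials in the entries of A, which makes their smoothness a matter of closure
  rules.\<close>

lemma matrix_inv_nth_det:
  fixes A :: "real^'n^'n"
  assumes "det A \<noteq> 0"
  shows "matrix_inv A $ k $ j = det (\<chi> i l. if l = k then axis j 1 $ i else A $ i $ l) / det A"
proof -
  have "invertible A" using assms by (simp add: invertible_det_nz)
  have "column j (matrix_inv A) = matrix_inv A *v axis j 1"
    by (simp add: matrix_vector_mult_basis)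
  then have "A *v column j (matrix_inv A) = axis j 1"
    by (simp only: matrix_vector_mul_assoc matrix_inv_left_right(1)[OF \<open>invertible A\<close>]
        matrix_vector_mul_lid)
  then have *: "column j (matrix_inv A) =
      (\<chi> k. det (\<chi> i l. if l = k then axis j 1 $ i else A $ i $ l) / det A)"
    unfolding cramer[OF assms] .
  have "matrix_inv A $ k $ j = column j (matrix_inv A) $ k"
    by (simp only: column_def vec_lambda_beta)
  also have "\<dots> = det (\<chi> i l. if l = k then axis j 1 $ i else A $ i $ l) / det A"
    by (simp only: * vec_lambda_beta)
  finally show ?thesis .
qed

lemma tcd_matrix_inv:
  fixes A :: "'a::real_normed_vector \<Rightarrow> real^'n^'n"
  assumes "open S" "times_cont_diff_on k A S" "\<And>x. x \<in> S \<Longrightarrow> det (A x) > 0"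
  shows "times_cont_diff_on k (\<lambda>x. matrix_inv (A x)) S"
proof -
  have "times_cont_diff_on k (\<lambda>x. \<chi> a b. det (\<chi> i l. if l = a then axis b 1 $ i else A x $ i $ l) / det (A x)) S"
  proof (intro tcd_vec_lambda tcd_divide tcd_det assms)
    fix a b i l
    show "times_cont_diff_on k (\<lambda>x. (\<chi> i l. if l = a then axis b 1 $ i else A x $ i $ l) $ i $ l) S"
      by (cases "l = a") (auto intro!: tcd_const tcd_vec_nth assms)
  qed (intro tcd_vec_nth assms)
  moreover have "(\<chi> a b. det (\<chi> i l. if l = a then axis b 1 $ i else A x $ i $ l) / det (A x))
      = matrix_inv (A x)" (is "?L x = _") if "x \<in> S" for x
    by (simp only: vec_eq_iff vec_lambda_beta
        matrix_inv_nth_det[OF assms(3)[OF that, THEN less_imp_neq, THEN not_sym]] simp_thms)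
  ultimately show ?thesis
    by (rule tcd_cong[OF assms(1), rotated])
qed

text \<open>Squaring the positive part makes the one-sided derivatives at 0 agree.\<close>

lemma tcd_max_power2: "times_cont_diff_on 1 (\<lambda>y::real. (max 0 y)\<^sup>2) UNIV"
  unfolding One_nat_def
proof (rule tcd_real_SucI[where f' = "\<lambda>y. 2 * max 0 y"])
  show "((\<lambda>y. (max 0 y)\<^sup>2) has_real_derivative 2 * max 0 x) (at x)" for x :: real
  proof -
    consider "x < 0" | "x = 0" | "x > 0" by linarith
    then show ?thesis
    proof cases
      case 1
      have "((\<lambda>y::real. 0) has_real_derivative 2 * max 0 x) (at x)"
        using 1 by simp
      then show ?thesis
        by (rule has_field_derivative_transform_within_open[where S = "{..<0}"]) (use 1 in auto)
    next
      case 3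
      have "((\<lambda>y::real. y\<^sup>2) has_real_derivative 2 * max 0 x) (at x)"
        using 3 by (auto intro!: derivative_eq_intros)
      then show ?thesis
        by (rule has_field_derivative_transform_within_open[where S = "{0<..}"]) (use 3 in auto)
    next
      case 2
      have "((\<lambda>y::real. (max 0 y)\<^sup>2 / y) \<longlongrightarrow> 0) (at 0)"
      proof (rule Lim_null_comparison)
        show "\<forall>\<^sub>F y::real in at 0. norm ((max 0 y)\<^sup>2 / y) \<le> norm y"
          by (auto simp: max_def power2_eq_square)
      qed (auto intro!: tendsto_eq_intros)
      then show ?thesis using 2 by (simp add: has_field_derivative_iff)
    qed
  qed
qed (auto intro!: continuous_intros)

section \<open>Differentiation under the integral and integrals of derivatives\<close>

text \<open>On a compact set f' is bounded by some B. By the mean value inequality the difference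
  quotients are dominated by B times the indicator of K, so dominated convergence applies.\<close>

lemma has_real_derivative_integral_compact:
  fixes f f' :: "real \<Rightarrow> 'a::euclidean_space \<Rightarrow> real"
  assumes "0 < \<delta>" and K: "compact K"
    and der: "\<And>t x. t \<in> {-\<delta>..\<delta>} \<Longrightarrow> x \<in> K \<Longrightarrow> ((\<lambda>s. f s x) has_real_derivative f' t x) (at t)"
    and cont': "continuous_on ({-\<delta>..\<delta>} \<times> K) (\<lambda>(t, x). f' t x)"
    and cont: "\<And>t. t \<in> {-\<delta>..\<delta>} \<Longrightarrow> continuous_on K (f t)"
  shows "((\<lambda>t. LINT x|lborel. indicator K x * f t x) has_real_derivative
    (LINT x|lborel. indicator K x * f' 0 x)) (at 0)"
proof -
  have "compact ((\<lambda>(t, x). f' t x) ` ({-\<delta>..\<delta>} \<times> K))"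
    by (intro compact_continuous_image cont' compact_Times K) simp
  then obtain B where B: "\<And>t x. t \<in> {-\<delta>..\<delta>} \<Longrightarrow> x \<in> K \<Longrightarrow> \<bar>f' t x\<bar> \<le> B"
    using compact_imp_bounded bounded_iff by (force simp: bounded_iff)
  have meas: "(\<lambda>x. indicator K x * f t x) \<in> borel_measurable lborel" if "t \<in> {-\<delta>..\<delta>}" for t
    using borel_measurable_continuous_on_indicator[OF borel_compact[OF K] cont[OF that]] by simp
  have int: "integrable lborel (\<lambda>x. indicator K x * f t x)" if "t \<in> {-\<delta>..\<delta>}" for t
    using borel_integrable_compact[OF K cont[OF that]]
    by (simp add: indicator_def if_distrib cong: if_cong)
  have "continuous_on K (f' 0)"
    using continuous_on_compose2[OF cont' continuous_on_Pair[OF continuous_on_const continuous_on_id], of 0 K]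
      \<open>0 < \<delta>\<close> by (simp add: image_subset_iff)
  then have meas': "(\<lambda>x. indicator K x * f' 0 x) \<in> borel_measurable lborel"
    using borel_measurable_continuous_on_indicator[OF borel_compact[OF K], of "f' 0"] by simp
  have bnd: "\<bar>f t x - f 0 x\<bar> \<le> B * \<bar>t\<bar>" if "t \<in> {-\<delta>..\<delta>}" "x \<in> K" for t x
    using field_differentiable_bound[of "{-\<delta>..\<delta>}" "\<lambda>s. f s x" "\<lambda>s. f' s x" B t 0]
      der[OF _ that(2)] B[OF _ that(2)] that(1) \<open>0 < \<delta>\<close>
    by (auto intro: has_field_derivative_at_within)
  let ?I = "\<lambda>t. LINT x|lborel. indicator K x * f t x"
  \<comment> \<open>Restricting the filter keeps all terms of a test sequence in the range covered
    by the hypotheses; the interval is open, so the limit at 0 is unaffected.\<close>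
  have "((\<lambda>h. (?I h - ?I 0) / h) \<longlongrightarrow> (LINT x|lborel. indicator K x * f' 0 x)) (at 0 within {-\<delta><..<\<delta>})"
    unfolding tendsto_at_iff_sequentially
  proof (intro allI impI)
    fix X :: "nat \<Rightarrow> real" assume X: "\<forall>i. X i \<in> {-\<delta><..<\<delta>} - {0}" "X \<longlonglongrightarrow> 0"
    have Xi: "X i \<in> {-\<delta>..\<delta>}" "X i \<noteq> 0" for i
      using X(1)[rule_format, of i] by auto
    have "(\<lambda>i. LINT x|lborel. (indicator K x * f (X i) x - indicator K x * f 0 x) / X i)
      \<longlonglongrightarrow> (LINT x|lborel. indicator K x * f' 0 x)"
    proof (rule integral_dominated_convergence[where w = "\<lambda>x. indicator K x * B"])
      show "integrable lborel (\<lambda>x. indicator K x * B)"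
        using borel_integrable_compact[OF K continuous_on_const, of B]
        by (simp add: indicator_def if_distrib cong: if_cong)
      show "(\<lambda>x. (indicator K x * f (X i) x - indicator K x * f 0 x) / X i) \<in> borel_measurable lborel" for i
        using \<open>0 < \<delta>\<close> by (intro borel_measurable_divide borel_measurable_diff meas Xi(1) borel_measurable_const) simp
      show "AE x in lborel. norm ((indicator K x * f (X i) x - indicator K x * f 0 x) / X i) \<le> indicator K x * B" for i
        using bnd[OF Xi(1)] Xi(2)[of i] by (auto simp: indicator_def divide_simps)
      show "AE x in lborel. (\<lambda>i. (indicator K x * f (X i) x - indicator K x * f 0 x) / X i)
          \<longlonglongrightarrow> indicator K x * f' 0 x"
      proof (rule AE_I2)
        fix x
        show "(\<lambda>i. (indicator K x * f (X i) x - indicator K x * f 0 x) / X i) \<longlonglongrightarrow> indicator K x * f' 0 x"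
        proof (cases "x \<in> K")
          case True
          have "((\<lambda>h. (f h x - f 0 x) / h) \<longlongrightarrow> f' 0 x) (at 0)"
            using der[OF _ True, of 0] \<open>0 < \<delta>\<close> by (simp add: has_field_derivative_iff)
          then have "((\<lambda>h. (f h x - f 0 x) / h) \<circ> X) \<longlonglongrightarrow> f' 0 x"
            using X(2) Xi(2) unfolding tendsto_at_iff_sequentially by blast
          then show ?thesis using True by (simp add: o_def)
        qed simp
      qed
    qed (use meas' in auto)
    moreover have "(LINT x|lborel. (indicator K x * f (X i) x - indicator K x * f 0 x) / X i)
      = (?I (X i) - ?I 0) / X i" for i
      using int[OF Xi(1), of i] int[of 0] \<open>0 < \<delta>\<close> by simp
    ultimately show "((\<lambda>h. (?I h - ?I 0) / h) \<circ> X) \<longlonglongrightarrow> (LINT x|lborel. indicator K x * f' 0 x)"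
      by (simp only: o_def)
  qed
  then have "((\<lambda>h. (?I h - ?I 0) / h) \<longlongrightarrow> (LINT x|lborel. indicator K x * f' 0 x)) (at 0)"
    using \<open>0 < \<delta>\<close> by (subst (asm) at_within_open) auto
  then show ?thesis by (simp add: has_field_derivative_iff)
qed

text \<open>The integrals of the translates of F do not depend on the translation vector.\<close>

lemma integral_frechet_derivative_eq_0:
  fixes F :: "'a::euclidean_space \<Rightarrow> real"
  assumes F: "times_cont_diff_on 1 F UNIV" and K: "compact K" and supp: "\<And>x. x \<notin> K \<Longrightarrow> F x = 0"
  shows "(LINT x|lborel. frechet_derivative F (at x) v) = 0"
proof -
  \<comment> \<open>K' is swept out by K under the shifts by -t v, so it contains the support of x
    -> F (x + t v) for every t in [-1, 1]; differentiation under the integral can then use one fixed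
    compact set.\<close>
  define K' where "K' = (\<lambda>(t, x). x - t *\<^sub>R v) ` ({-1..1::real} \<times> K)"
  have "compact K'"
    unfolding K'_def case_prod_beta
    by (intro compact_continuous_image compact_Times K continuous_intros) simp
  have K': "x \<in> K'" if "t \<in> {-1..1}" "x + t *\<^sub>R v \<in> K" for x t
    unfolding K'_def using that by (intro image_eqI[of _ _ "(t, x + t *\<^sub>R v)"]) auto
  have dF: "(F has_derivative frechet_derivative F (at x)) (at x)" for x
    using F tcd_has_derivative[of 0 F UNIV x] by simp
  have cF: "continuous_on UNIV (\<lambda>x. frechet_derivative F (at x) v)"
    using F by simp
  have dF0: "frechet_derivative F (at x) v = 0" if "x \<notin> K" for x
  proof -
    have "(F has_derivative (\<lambda>_. 0)) (at x)"
      by (rule has_derivative_transform_within_open[of "\<lambda>_. 0" _ _ _ "- K"])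
        (use that supp compact_imp_closed[OF K] in auto)
    then show ?thesis using frechet_derivative_at by metis
  qed
  have shift: "(LINT x|lborel. indicator K' x * F (x + t *\<^sub>R v)) = (LINT x|lborel. F x)" if "t \<in> {-1..1}" for t
  proof -
    have "(LINT x|lborel. indicator K' x * F (x + t *\<^sub>R v)) = (LINT x|lborel. F (t *\<^sub>R v + x))"
      using K'[OF that] supp by (intro Bochner_Integration.integral_cong) (auto simp: indicator_def add.commute)
    also have "\<dots> = (LINT x|distr lborel borel ((+) (t *\<^sub>R v)). F x)"
      using tcd_continuous_on[OF F]
      by (subst integral_distr) (auto intro: borel_measurable_continuous_onI)
    also have "\<dots> = (LINT x|lborel. F x)"
      using lborel_distr_plus[of "t *\<^sub>R v"] by simp
    finally show ?thesis .
  qed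
  have "((\<lambda>t. LINT x|lborel. indicator K' x * F (x + t *\<^sub>R v)) has_real_derivative
      (LINT x|lborel. indicator K' x * frechet_derivative F (at (x + 0 *\<^sub>R v)) v)) (at 0)"
  proof (rule has_real_derivative_integral_compact[where \<delta> = 1])
    show "((\<lambda>s. F (x + s *\<^sub>R v)) has_real_derivative frechet_derivative F (at (x + t *\<^sub>R v)) v) (at t)" for t x
    proof -
      have "((\<lambda>s. x + s *\<^sub>R v) has_derivative (\<lambda>h. h *\<^sub>R v)) (at t)"
        by (auto intro!: derivative_eq_intros)
      from has_derivative_compose[OF this dF] show ?thesis
        using linear_scale[OF has_derivative_linear[OF dF]]
        by (simp add: has_field_derivative_def mult_commute_abs)
    qed
    show "continuous_on ({- 1..1} \<times> K') (\<lambda>(t, x). frechet_derivative F (at (x + t *\<^sub>R v)) v)"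
      unfolding case_prod_beta by (intro continuous_on_compose2[OF cF] continuous_intros) auto
    show "continuous_on K' (\<lambda>x. F (x + t *\<^sub>R v))" for t
      by (intro continuous_on_compose2[OF tcd_continuous_on[OF F]] continuous_intros) auto
  qed (use \<open>compact K'\<close> in auto)
  moreover have "((\<lambda>t. LINT x|lborel. indicator K' x * F (x + t *\<^sub>R v)) has_real_derivative 0) (at 0)"
    by (rule has_field_derivative_transform_within_open[of "\<lambda>_. LINT x|lborel. F x" _ _ "{-1<..<1}"])
      (auto simp: shift)
  ultimately have "(LINT x|lborel. indicator K' x * frechet_derivative F (at x) v) = 0"
    using DERIV_unique by fastforce
  moreover have "indicator K' x * frechet_derivative F (at x) v = frechet_derivative F (at x) v" for x
    using K'[of 0 x] dF0[of x] by (auto simp: indicator_def)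
  ultimately show ?thesis by simp
qed

section \<open>Symmetry of second derivatives\<close>

text \<open>The mean value theorem twice: in the direction v for s -> f (x + s v + h w) - f (x + s
  v), then in the direction w for the resulting difference of derivatives. The second difference is
  symmetric in v and w, the right-hand side is not yet. The summand h makes the distance bound
  strict even if v = w = 0.\<close>

lemma second_difference_mean_value:
  fixes f :: "'a::real_normed_vector \<Rightarrow> real"
  assumes f: "times_cont_diff_on 2 f S" and S: "ball x r \<subseteq> S"
    and h: "0 < h" "h * (norm v + norm w) < r"
  shows "\<exists>y. dist x y < h * (norm v + norm w) + h \<and> y \<in> S \<and>
    f (x + h *\<^sub>R v + h *\<^sub>R w) - f (x + h *\<^sub>R v) - f (x + h *\<^sub>R w) + f x
      = h\<^sup>2 * frechet_derivative (\<lambda>y. frechet_derivative f (at y) v) (at y) w"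
proof -
  let ?D = "\<lambda>y. frechet_derivative f (at y) v"
  have dist: "dist x (x + s *\<^sub>R v + t *\<^sub>R w) \<le> h * (norm v + norm w)"
    if "0 \<le> s" "s \<le> h" "0 \<le> t" "t \<le> h" for s t
  proof -
    have "dist x (x + s *\<^sub>R v + t *\<^sub>R w) = norm (s *\<^sub>R v + t *\<^sub>R w)"
      by (metis add.assoc add_diff_cancel_left' dist_commute dist_norm)
    also have "\<dots> \<le> s * norm v + t * norm w"
      using norm_triangle_ineq[of "s *\<^sub>R v" "t *\<^sub>R w"] that by simp
    also have "\<dots> \<le> h * (norm v + norm w)"
      unfolding distrib_left using that by (intro add_mono mult_right_mono) auto
    finally show ?thesis .
  qed
  then have inS: "x + s *\<^sub>R v + t *\<^sub>R w \<in> S" if "0 \<le> s" "s \<le> h" "0 \<le> t" "t \<le> h" for s t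
    using that h(2) S by fastforce
  have d1: "(f has_derivative frechet_derivative f (at y)) (at y)" if "y \<in> S" for y
    using tcd_has_derivative[of 1 f S y] f that by (simp add: numeral_2_eq_2)
  have d2: "(?D has_derivative frechet_derivative ?D (at y)) (at y)" if "y \<in> S" for y
    using tcd_has_derivative[of 0 ?D S y] f that by (simp add: numeral_2_eq_2)
  have ds: "((\<lambda>s. f (x + s *\<^sub>R v + t *\<^sub>R w)) has_real_derivative ?D (x + s *\<^sub>R v + t *\<^sub>R w)) (at s)"
    if "0 \<le> s" "s \<le> h" "0 \<le> t" "t \<le> h" for s t
  proof -
    have "((\<lambda>s. x + s *\<^sub>R v + t *\<^sub>R w) has_derivative (\<lambda>a. a *\<^sub>R v)) (at s)"
      by (auto intro!: derivative_eq_intros)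
    from has_derivative_compose[OF this d1[OF inS[OF that]]] show ?thesis
      using linear_scale[OF has_derivative_linear[OF d1[OF inS[OF that]]]]
      by (simp add: has_field_derivative_def mult_commute_abs)
  qed
  have dt: "((\<lambda>t. ?D (x + s *\<^sub>R v + t *\<^sub>R w)) has_real_derivative
      frechet_derivative ?D (at (x + s *\<^sub>R v + t *\<^sub>R w)) w) (at t)"
    if "0 \<le> s" "s \<le> h" "0 \<le> t" "t \<le> h" for s t
  proof -
    have "((\<lambda>t. x + s *\<^sub>R v + t *\<^sub>R w) has_derivative (\<lambda>a. a *\<^sub>R w)) (at t)"
      by (auto intro!: derivative_eq_intros)
    from has_derivative_compose[OF this d2[OF inS[OF that]]] show ?thesis
      using linear_scale[OF has_derivative_linear[OF d2[OF inS[OF that]]]]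
      by (simp add: has_field_derivative_def mult_commute_abs)
  qed
  have "\<exists>\<xi>. 0 < \<xi> \<and> \<xi> < h \<and>
      (f (x + h *\<^sub>R v + h *\<^sub>R w) - f (x + h *\<^sub>R v + 0 *\<^sub>R w)) - (f (x + 0 *\<^sub>R v + h *\<^sub>R w) - f (x + 0 *\<^sub>R v + 0 *\<^sub>R w))
      = (h - 0) * (?D (x + \<xi> *\<^sub>R v + h *\<^sub>R w) - ?D (x + \<xi> *\<^sub>R v + 0 *\<^sub>R w))"
    by (rule MVT2) (use h(1) in \<open>auto intro!: DERIV_diff ds[of _ 0, simplified] ds\<close>)
  then obtain \<xi> where \<xi>: "0 < \<xi>" "\<xi> < h"
    "f (x + h *\<^sub>R v + h *\<^sub>R w) - f (x + h *\<^sub>R v) - f (x + h *\<^sub>R w) + f x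
      = h * (?D (x + \<xi> *\<^sub>R v + h *\<^sub>R w) - ?D (x + \<xi> *\<^sub>R v + 0 *\<^sub>R w))"
    by (auto simp: algebra_simps)
  have "\<exists>\<eta>. 0 < \<eta> \<and> \<eta> < h \<and> ?D (x + \<xi> *\<^sub>R v + h *\<^sub>R w) - ?D (x + \<xi> *\<^sub>R v + 0 *\<^sub>R w)
      = (h - 0) * frechet_derivative ?D (at (x + \<xi> *\<^sub>R v + \<eta> *\<^sub>R w)) w"
    by (rule MVT2) (use h(1) \<xi> dt in auto)
  then obtain \<eta> where \<eta>: "0 < \<eta>" "\<eta> < h" "?D (x + \<xi> *\<^sub>R v + h *\<^sub>R w) - ?D (x + \<xi> *\<^sub>R v + 0 *\<^sub>R w)
      = h * frechet_derivative ?D (at (x + \<xi> *\<^sub>R v + \<eta> *\<^sub>R w)) w"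
    by auto
  show ?thesis
    by (rule exI[of _ "x + \<xi> *\<^sub>R v + \<eta> *\<^sub>R w"])
      (use dist[of \<xi> \<eta>] inS[of \<xi> \<eta>] \<xi> \<eta> h in \<open>auto simp: power2_eq_square\<close>)
qed

text \<open>The same second difference is h^2 times a mixed derivative in either order, at two
  intermediate points that tend to x with h; continuity of both mixed derivatives gives equality at
  x.\<close>

lemma symmetric_second_derivative_real:
  fixes f :: "'a::real_normed_vector \<Rightarrow> real"
  assumes f: "times_cont_diff_on 2 f S" and "open S" "x \<in> S"
  shows "frechet_derivative (\<lambda>y. frechet_derivative f (at y) v) (at x) w
    = frechet_derivative (\<lambda>y. frechet_derivative f (at y) w) (at x) v"
    (is "?A x = ?B x")
proof -
  obtain r where r: "r > 0" "ball x r \<subseteq> S"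
    using \<open>open S\<close> \<open>x \<in> S\<close> open_contains_ball by blast
  define N where "N = norm v + norm w + 1"
  have "N > 0" by (simp add: N_def add_nonneg_pos)
  \<comment> \<open>The shift by 2 gives h n * N < r already for n = 0, so that all the
    parallelograms stay inside the ball; the summand 1 in N excludes division by 0.\<close>
  define h where "h n = r / (N * real (n + 2))" for n :: nat
  have h0: "h n > 0" for n using r \<open>N > 0\<close> by (simp add: h_def)
  have hN: "h n * N < r" for n
    using r \<open>N > 0\<close> by (simp add: h_def divide_simps)
  have small: "h n * (norm v + norm w) < r" for n
    using hN[of n] h0[of n] by (simp add: N_def distrib_left)
  have hlim: "(\<lambda>n. h n * N) \<longlonglongrightarrow> 0"
  proof -
    have "(\<lambda>n. r * inverse (real (n + 2))) \<longlonglongrightarrow> r * 0"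
      by (intro tendsto_mult tendsto_const LIMSEQ_ignore_initial_segment[OF lim_inverse_n'[unfolded inverse_eq_divide[symmetric]]])
    moreover have "h n * N = r * inverse (real (n + 2))" for n
      using \<open>N > 0\<close> by (simp add: h_def divide_simps)
    ultimately show ?thesis by simp
  qed
  have lim: "C \<longlonglongrightarrow> x" if "\<And>n. dist x (C n) < h n * (norm v + norm w) + h n" for C
  proof (rule metric_tendsto_imp_tendsto[OF hlim])
    show "\<forall>\<^sub>F n in sequentially. dist (C n) x \<le> dist (h n * N) 0"
      using that h0 \<open>N > 0\<close> by (intro always_eventually allI)
        (auto simp: dist_commute N_def distrib_left dist_real_def abs_mult less_imp_le intro!: order.trans[OF less_imp_le[OF that]])
  qed
  obtain a where a: "\<And>n. dist x (a n) < h n * (norm v + norm w) + h n" "\<And>n. a n \<in> S"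
    "\<And>n. f (x + h n *\<^sub>R v + h n *\<^sub>R w) - f (x + h n *\<^sub>R v) - f (x + h n *\<^sub>R w) + f x = (h n)\<^sup>2 * ?A (a n)"
    using second_difference_mean_value[OF f r(2) h0 small] by metis
  have small': "h n * (norm w + norm v) < r" for n
    using small by (simp add: add.commute)
  obtain b where b: "\<And>n. dist x (b n) < h n * (norm w + norm v) + h n" "\<And>n. b n \<in> S"
    "\<And>n. f (x + h n *\<^sub>R w + h n *\<^sub>R v) - f (x + h n *\<^sub>R w) - f (x + h n *\<^sub>R v) + f x = (h n)\<^sup>2 * ?B (b n)"
    using second_difference_mean_value[OF f r(2) h0 small'] by metis
  have "(h n)\<^sup>2 * ?A (a n) = (h n)\<^sup>2 * ?B (b n)" for n
    unfolding a(3)[symmetric] b(3)[symmetric] by (simp add: add.commute add.left_commute)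
  then have eq: "?A (a n) = ?B (b n)" for n
    using h0[of n] by (metis mult_left_cancel power_not_zero less_numeral_extra(3))
  have "continuous_on S ?A" "continuous_on S ?B"
    using f by (auto simp: numeral_2_eq_2)
  then have "(\<lambda>n. ?A (a n)) \<longlonglongrightarrow> ?A x" "(\<lambda>n. ?B (b n)) \<longlonglongrightarrow> ?B x"
    using lim[OF a(1)] lim[of b] b(1) a(2) b(2) \<open>x \<in> S\<close>
    by (auto intro!: continuous_on_tendsto_compose[of S] always_eventually simp: add.commute)
  then show ?thesis
    using eq LIMSEQ_unique by simp
qed

lemma frechet_derivative_bounded_linear:
  assumes "bounded_linear L" "f differentiable at x"
  shows "frechet_derivative (\<lambda>y. L (f y)) (at x) v = L (frechet_derivative f (at x) v)"
  using bounded_linear.has_derivative[OF assms(1)] assms(2)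
  by (metis frechet_derivative_at frechet_derivative_works)

lemma frechet_derivative_cong_open:
  assumes "open S" "x \<in> S" "\<And>y. y \<in> S \<Longrightarrow> f y = g y"
  shows "frechet_derivative f (at x) = frechet_derivative g (at x)"
proof -
  have "(f has_derivative D) (at x) \<longleftrightarrow> (g has_derivative D) (at x)" for D
    using has_derivative_transform_within_open[OF _ assms(1,2)] assms(3) by metis
  then show ?thesis by (simp add: frechet_derivative_def)
qed

lemma symmetric_second_derivative:
  fixes f :: "'a::real_normed_vector \<Rightarrow> real^'n"
  assumes f: "times_cont_diff_on 2 f S" and S: "open S" "x \<in> S"
  shows "frechet_derivative (\<lambda>y. frechet_derivative f (at y) v) (at x) w
    = frechet_derivative (\<lambda>y. frechet_derivative f (at y) w) (at x) v"
proof -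
  have diff: "f differentiable at y" "(\<lambda>y. frechet_derivative f (at y) v) differentiable at y" if "y \<in> S" for y v
    using f that by (auto simp: numeral_2_eq_2)
  have *: "frechet_derivative (\<lambda>y. frechet_derivative f (at y) v) (at x) w $ i
      = frechet_derivative (\<lambda>y. frechet_derivative (\<lambda>z. f z $ i) (at y) v) (at x) w" for v w i
  proof -
    have "frechet_derivative (\<lambda>y. frechet_derivative (\<lambda>z. f z $ i) (at y) v) (at x)
        = frechet_derivative (\<lambda>y. frechet_derivative f (at y) v $ i) (at x)"
      by (rule frechet_derivative_cong_open[OF S])
        (simp add: frechet_derivative_bounded_linear[OF bounded_linear_vec_nth] diff)
    then show ?thesis
      by (simp add: frechet_derivative_bounded_linear[OF bounded_linear_vec_nth] diff S)
  qed
  show ?thesis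
    using symmetric_second_derivative_real[OF tcd_vec_nth[OF S(1) f] S]
    by (simp add: vec_eq_iff *)
qed

section \<open>The inverse function behind the conformal factor\<close>

text \<open>S is the inverse of s -> s (1 + s) powr (-\<beta>). Its domain reaches below 0 because
  smoothness is a statement about open sets and e = 0 occurs; the bound -1/2 keeps 1 + S e positive
  there.\<close>

lemma conformal_profile_exists:
  fixes \<beta> :: real
  assumes "0 < \<beta>" "\<beta> < 1"
  shows "\<exists>S I. open I \<and> {0..} \<subseteq> I \<and> (\<forall>k. times_cont_diff_on k S I) \<and>
    (\<forall>e\<in>I. S e > -1/2) \<and> (\<forall>e\<ge>0. S e \<ge> 0 \<and> S e * (1 + S e) powr (- \<beta>) = e)"
proof -
  define \<phi> where "\<phi> s = s * (1 + s) powr (- \<beta>)" for s :: real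
  define \<phi>' where "\<phi>' s = (1 + s) powr (- \<beta> - 1) * (1 + (1 - \<beta>) * s)" for s :: real
  \<comment> \<open>For s > -1/2 both 1 + s and 1 + (1 - \<beta>) s are positive, so
    \<open>\<phi>'\<close> is positive on U.\<close>
  define U where "U = ({-1/2<..} :: real set)"
  have "open U" by (simp add: U_def)
  have deriv: "(\<phi> has_real_derivative \<phi>' s) (at s)" if "s \<in> U" for s
  proof -
    have s: "1 + s > 0" using that by (simp add: U_def)
    have "(1 + s) powr (- \<beta>) = (1 + s) powr (- \<beta> - 1) * (1 + s)"
      using s powr_add[of "1 + s" "- \<beta> - 1" 1] by simp
    then show ?thesis
      unfolding \<phi>_def \<phi>'_def using s
      by (auto intro!: derivative_eq_intros simp: algebra_simps)
  qed
  have pos: "\<phi>' s > 0" if "s \<in> U" for s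
  proof -
    have "(1 - \<beta>) * s \<ge> (1 - \<beta>) * (-1/2)"
      using that assms by (intro mult_left_mono) (auto simp: U_def)
    then have "1 + (1 - \<beta>) * s > 0" using assms by (simp add: field_simps)
    moreover have "1 + s > 0" using that by (simp add: U_def)
    ultimately show ?thesis unfolding \<phi>'_def by simp
  qed
  have smooth: "times_cont_diff_on k \<phi>' U" for k
    unfolding \<phi>'_def
    by (intro tcd_mult tcd_powr_compose tcd_add tcd_const tcd_ident \<open>open U\<close>) (simp add: U_def)
  have mono: "\<phi> s < \<phi> t" if "s \<in> U" "s < t" for s t
  proof (rule DERIV_pos_imp_increasing[OF that(2)])
    fix x assume "s \<le> x" "x \<le> t"
    then have "x \<in> U" using that by (simp add: U_def)
    then show "\<exists>y. (\<phi> has_real_derivative y) (at x) \<and> 0 < y"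
      using deriv pos by blast
  qed
  have inj: "inj_on \<phi> U"
    using mono by (metis inj_onI linorder_neqE_linordered_idom order_less_irrefl)
  have cont: "continuous_on U \<phi>"
    using deriv by (auto intro!: continuous_at_imp_continuous_on DERIV_isCont)
  obtain S where S: "homeomorphism U (\<phi> ` U) \<phi> S"
    using invariance_of_domain_homeomorphism[OF \<open>open U\<close> cont _ inj] by auto
  define I where "I = \<phi> ` U"
  have "open I"
    unfolding I_def by (rule invariance_of_domain[OF cont \<open>open U\<close> inj])
  have SU: "S e \<in> U" "\<phi> (S e) = e" if "e \<in> I" for e
    using S that unfolding homeomorphism_def I_def by auto
  have contS: "continuous_on I S"
    using S unfolding homeomorphism_def I_def by simp
  have derivS: "(S has_real_derivative inverse (\<phi>' (S e))) (at e)" if "e \<in> I" for e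
  proof -
    obtain r where r: "r > 0" "ball e r \<subseteq> I"
      using \<open>open I\<close> \<open>e \<in> I\<close> open_contains_ball by blast
    show ?thesis
    proof (rule DERIV_inverse_function[where a = "e - r" and b = "e + r"])
      show "\<phi>' (S e) \<noteq> 0" using pos[OF SU(1)[OF that]] by simp
      show "\<phi> (S y) = y" if "e - r < y" "y < e + r" for y
        using that r by (intro SU subsetD[OF r(2)]) (simp add: dist_real_def abs_less_iff)
      show "isCont S e"
        using contS \<open>open I\<close> that by (simp add: continuous_on_eq_continuous_at)
    qed (use deriv[OF SU(1)[OF that]] r in auto)
  qed
  \<comment> \<open>Bootstrapping: S' = 1 / \<open>\<phi>'\<close> (S), so if S is of class C^k then
    so is S'.\<close>
  have tcdS: "times_cont_diff_on k S I" for k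
  proof (induction k)
    case (Suc k)
    show ?case
    proof (rule tcd_real_SucI[OF \<open>open I\<close> derivS], assumption)
      have "times_cont_diff_on k (\<lambda>e. \<phi>' (S e)) I"
        by (rule tcd_compose[OF \<open>open I\<close> \<open>open U\<close> _ smooth Suc]) (use SU in auto)
      then show "times_cont_diff_on k (\<lambda>e. inverse (\<phi>' (S e))) I"
        by (rule tcd_inverse_compose[OF \<open>open I\<close>]) (use SU pos in auto)
    qed
  qed (use contS in simp)
  have nonneg: "e \<in> I \<and> S e \<ge> 0" if "e \<ge> 0" for e
  proof -
    \<comment> \<open>Since \<open>\<phi>\<close> s = (1 + s) powr (1 - \<beta>) - (1 + s) powr
      (-\<beta>), the point b with b powr (1 - \<beta>) = 1 + e yields \<open>\<phi>\<close> (b + e)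
      \<ge> (1 + e) - 1. This upper end for the intermediate value theorem exists because \<beta> <
      1.\<close>
    define b where "b = (1 + e) powr (1 / (1 - \<beta>))"
    have b1: "b \<ge> 1" unfolding b_def using that assms by (intro ge_one_powr_ge_zero) auto
    have "e \<le> \<phi> (b + e)"
    proof -
      have "(1 + (b + e)) powr (1 - \<beta>) \<ge> b powr (1 - \<beta>)"
        using b1 that assms by (intro powr_mono2) auto
      also have "b powr (1 - \<beta>) = 1 + e"
        using that assms by (simp add: b_def powr_powr)
      finally have "(1 + (b + e)) powr (1 - \<beta>) \<ge> 1 + e" .
      moreover have "(1 + (b + e)) powr (1 - \<beta>) = (1 + (b + e)) * (1 + (b + e)) powr (- \<beta>)"
        using b1 that powr_add[of "1 + (b + e)" 1 "- \<beta>"] by simp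
      moreover have "(1 + (b + e)) powr (- \<beta>) \<le> 1"
        using b1 that assms powr_mono[of "- \<beta>" 0 "1 + (b + e)"] by simp
      ultimately show ?thesis unfolding \<phi>_def by (simp add: algebra_simps)
    qed
    moreover have "\<phi> 0 \<le> e" using that by (simp add: \<phi>_def)
    moreover have "continuous_on {0..b + e} \<phi>"
      by (rule continuous_on_subset[OF cont]) (auto simp: U_def)
    ultimately obtain s where s: "0 \<le> s" "\<phi> s = e"
      using IVT'[of \<phi> 0 e "b + e"] b1 \<open>0 \<le> e\<close> by auto
    then have "s \<in> U" by (simp add: U_def)
    then have "e \<in> I" using s(2) by (auto simp: I_def)
    moreover have "S e = s"
      by (rule inj_onD[OF inj]) (use SU[OF \<open>e \<in> I\<close>] s(2) \<open>s \<in> U\<close> in auto)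
    ultimately show ?thesis using s(1) by simp
  qed
  show ?thesis
  proof (intro exI conjI)
    show "\<forall>e\<ge>0. 0 \<le> S e \<and> S e * (1 + S e) powr (- \<beta>) = e"
      using nonneg SU(2) unfolding \<phi>_def by blast
    show "\<forall>e\<in>I. - 1 / 2 < S e" using SU(1) by (simp add: U_def)
  qed (use \<open>open I\<close> tcdS nonneg in auto)
qed

section \<open>Derivatives of determinants and of inverse matrices\<close>

text \<open>With C = B A^-1, row i of B is the combination of the rows of A with the coefficients in
  row i of C, so replacing row i multiplies det A by C_ii. The sum is det A times the trace of
  C.\<close>

lemma det_replace_row_sum:
  fixes A B :: "real^'n^'n"
  assumes "det A \<noteq> 0"
  shows "(\<Sum>i\<in>UNIV. det (\<chi> k. if k = i then B $ i else A $ k))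
    = det A * (\<Sum>i\<in>UNIV. \<Sum>j\<in>UNIV. B $ i $ j * matrix_inv A $ j $ i)"
proof -
  have inv: "invertible A" using assms by (simp add: invertible_det_nz)
  define C where "C = B ** matrix_inv A"
  have "C ** A = B"
    unfolding C_def using matrix_inv_left_right(2)[OF inv]
    by (simp add: matrix_mul_assoc[symmetric])
  then have B: "B $ i = (\<Sum>l\<in>UNIV. (C $ i) $ l *s row l A)" for i
    by (auto simp: vec_eq_iff matrix_matrix_mult_def row_def)
  have row: "row i A = A $ i" for i
    by (simp add: row_def vec_eq_iff)
  have "det (\<chi> k. if k = i then B $ i else A $ k) = C $ i $ i * det A" for i
    using cramer_lemma_transpose[of i "C $ i" A] unfolding B row .
  then show ?thesis
    by (simp add: C_def matrix_matrix_mult_def sum_distrib_right sum_distrib_left mult.commute)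
qed

text \<open>Jacobi's formula. The product rule in the Leibniz expansion yields the sum over i of the
  determinants with row i replaced by its derivative.\<close>

lemma has_derivative_det:
  fixes A :: "'a::real_normed_vector \<Rightarrow> real^'n^'n"
  assumes A: "\<And>i j. ((\<lambda>x. A x $ i $ j) has_derivative A' i j) (at x)" and "det (A x) \<noteq> 0"
  shows "((\<lambda>x. det (A x)) has_derivative
    (\<lambda>v. det (A x) * (\<Sum>i\<in>UNIV. \<Sum>j\<in>UNIV. A' i j v * matrix_inv (A x) $ j $ i))) (at x)"
proof -
  let ?D = "\<lambda>v. \<Sum>p | p permutes UNIV. of_int (sign p) *
    (\<Sum>i\<in>UNIV. A' i (p i) v * (\<Prod>k\<in>UNIV - {i}. A x $ k $ p k))"
  have "((\<lambda>x. det (A x)) has_derivative ?D) (at x)"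
    unfolding det_def by (intro has_derivative_sum has_derivative_mult_right has_derivative_prod A)
  moreover have "?D v = det (A x) * (\<Sum>i\<in>UNIV. \<Sum>j\<in>UNIV. A' i j v * matrix_inv (A x) $ j $ i)" for v
  proof -
    define B where "B = (\<chi> i j. A' i j v)"
    have "A' i (p i) v * (\<Prod>k\<in>UNIV - {i}. A x $ k $ p k)
        = (\<Prod>k\<in>UNIV. (\<chi> k. if k = i then B $ i else A x $ k) $ k $ p k)" for p i
      by (subst (2) prod.remove[of _ i]) (auto simp: B_def intro!: prod.cong)
    then have "?D v = (\<Sum>i\<in>UNIV. det (\<chi> k. if k = i then B $ i else A x $ k))"
      unfolding det_def by (subst sum.swap) (simp add: sum_distrib_left)
    then show ?thesis
      using det_replace_row_sum[OF assms(2), of B] by (simp add: B_def)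
  qed
  ultimately show ?thesis by simp
qed

lemma partial_deriv_eqI: "(f has_derivative f') (at x) \<Longrightarrow> partial_deriv i f x = f' (axis i 1)"
  unfolding partial_deriv_def using frechet_derivative_at by metis

lemma partial_deriv_det:
  fixes A :: "real^'m \<Rightarrow> real^'n^'n"
  assumes "A differentiable at x" "det (A x) \<noteq> 0"
  shows "partial_deriv i (\<lambda>y. det (A y)) x
    = det (A x) * (\<Sum>k\<in>UNIV. \<Sum>l\<in>UNIV. matrix_inv (A x) $ k $ l * partial_deriv i (\<lambda>y. A y $ l $ k) x)"
proof -
  have "((\<lambda>y. A y $ k $ l) has_derivative (\<lambda>v. frechet_derivative A (at x) v $ k $ l)) (at x)" for k l
    by (intro bounded_linear.has_derivative[OF bounded_linear_vec_nth]
        assms(1)[unfolded frechet_derivative_works])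
  from partial_deriv_eqI[OF has_derivative_det[OF this assms(2)]] partial_deriv_eqI[OF this]
  have "partial_deriv i (\<lambda>y. det (A y)) x
    = det (A x) * (\<Sum>l\<in>UNIV. \<Sum>k\<in>UNIV. partial_deriv i (\<lambda>y. A y $ l $ k) x * matrix_inv (A x) $ k $ l)"
    by simp
  then show ?thesis
    by (subst sum.swap) (simp add: mult.commute)
qed

text \<open>Differentiate A A^-1 = 1, which holds near x, and solve for the derivative of the
  inverse by multiplying with A^-1 from the left.\<close>

lemma partial_deriv_matrix_inv:
  fixes A :: "real^'m \<Rightarrow> real^'n^'n"
  assumes A: "A differentiable at x" and inv: "(\<lambda>y. matrix_inv (A y)) differentiable at x"
    and S: "open S" "x \<in> S" "\<And>y. y \<in> S \<Longrightarrow> invertible (A y)"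
  shows "partial_deriv i (\<lambda>y. matrix_inv (A y) $ k $ l) x
    = - (\<Sum>p\<in>UNIV. \<Sum>q\<in>UNIV. matrix_inv (A x) $ k $ p * partial_deriv i (\<lambda>y. A y $ p $ q) x * matrix_inv (A x) $ q $ l)"
proof -
  let ?B = "\<lambda>y. matrix_inv (A y)"
  let ?dA = "\<lambda>p q. partial_deriv i (\<lambda>y. A y $ p $ q) x"
  let ?dB = "\<lambda>p q. partial_deriv i (\<lambda>y. ?B y $ p $ q) x"
  have dA: "((\<lambda>y. A y $ k $ l) has_derivative (\<lambda>v. frechet_derivative A (at x) v $ k $ l)) (at x)" for k l
    by (intro bounded_linear.has_derivative[OF bounded_linear_vec_nth]
        A[unfolded frechet_derivative_works])
  have dB: "((\<lambda>y. ?B y $ k $ l) has_derivative (\<lambda>v. frechet_derivative ?B (at x) v $ k $ l)) (at x)" for k l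
    by (intro bounded_linear.has_derivative[OF bounded_linear_vec_nth]
        inv[unfolded frechet_derivative_works])
  have eq: "(\<Sum>q\<in>UNIV. A x $ p $ q * ?dB q l) = - (\<Sum>q\<in>UNIV. ?dA p q * ?B x $ q $ l)" for p
  proof -
    have "((\<lambda>y. \<Sum>q\<in>UNIV. A y $ p $ q * ?B y $ q $ l) has_derivative
      (\<lambda>v. \<Sum>q\<in>UNIV. A x $ p $ q * (frechet_derivative ?B (at x) v $ q $ l)
         + (frechet_derivative A (at x) v $ p $ q) * ?B x $ q $ l)) (at x)"
      by (intro has_derivative_sum has_derivative_mult dA dB)
    moreover have "((\<lambda>y. \<Sum>q\<in>UNIV. A y $ p $ q * ?B y $ q $ l) has_derivative (\<lambda>v. 0)) (at x)"
    proof (rule has_derivative_transform_within_open[OF _ S(1,2)])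
      show "((\<lambda>y. (mat 1 :: real^'n^'n) $ p $ l) has_derivative (\<lambda>v. 0)) (at x)" by simp
      show "(mat 1 :: real^'n^'n) $ p $ l = (\<Sum>q\<in>UNIV. A y $ p $ q * ?B y $ q $ l)" if "y \<in> S" for y
        by (subst matrix_inv_left_right(1)[OF S(3)[OF that], symmetric])
          (simp add: matrix_matrix_mult_def)
    qed
    ultimately have "(\<lambda>v. \<Sum>q\<in>UNIV. A x $ p $ q * (frechet_derivative ?B (at x) v $ q $ l)
         + (frechet_derivative A (at x) v $ p $ q) * ?B x $ q $ l) = (\<lambda>v. 0)"
      by (rule has_derivative_unique)
    from fun_cong[OF this, of "axis i 1"] show ?thesis
      by (simp add: partial_deriv_eqI[OF dA] partial_deriv_eqI[OF dB] sum.distrib)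
  qed
  have BA: "(\<Sum>p\<in>UNIV. ?B x $ k $ p * A x $ p $ q) = (if k = q then 1 else 0)" for q
    using arg_cong[OF matrix_inv_left_right(2)[OF S(3)[OF S(2)]], of "\<lambda>X. X $ k $ q"]
    by (simp add: matrix_matrix_mult_def mat_def)
  have "?dB k l = (\<Sum>q\<in>UNIV. (\<Sum>p\<in>UNIV. ?B x $ k $ p * A x $ p $ q) * ?dB q l)"
    unfolding BA by (simp add: if_distrib[of "\<lambda>c. c * _"] cong: if_cong)
  also have "\<dots> = (\<Sum>p\<in>UNIV. ?B x $ k $ p * (\<Sum>q\<in>UNIV. A x $ p $ q * ?dB q l))"
    by (simp only: sum_distrib_right sum_distrib_left mult.assoc) (rule sum.swap)
  also have "\<dots> = - (\<Sum>p\<in>UNIV. \<Sum>q\<in>UNIV. ?B x $ k $ p * ?dA p q * ?B x $ q $ l)"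
    unfolding eq by (simp add: sum_distrib_left sum_negf mult.assoc)
  finally show ?thesis .
qed

section \<open>Index identities for the divergence of the flux\<close>

text \<open>Pure algebra at one point: \<gamma> is the inverse metric, s the volume density, and the
  names starting with d stand for partial derivatives. The identity is d_i (s \<gamma>^ij) = - s
  \<gamma>^kl \<Gamma>^j_kl. Jacobi's formula contributes P and the derivative of the inverse
  contributes Q; both sides equal s (P/2 - Q).\<close>

lemma divergence_christoffel_identity:
  fixes \<gamma> :: "'m::finite \<Rightarrow> 'm \<Rightarrow> real"
  assumes \<gamma>: "\<And>i j. \<gamma> i j = \<gamma> j i" and dG: "\<And>i k l. dG i k l = dG i l k"
    and ds: "\<And>i. ds i = 1/2 * s * (\<Sum>k\<in>UNIV. \<Sum>l\<in>UNIV. \<gamma> k l * dG i l k)"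
    and d\<gamma>: "\<And>i k l. d\<gamma> i k l = - (\<Sum>p\<in>UNIV. \<Sum>q\<in>UNIV. \<gamma> k p * dG i p q * \<gamma> q l)"
    and \<Gamma>: "\<And>k i j. \<Gamma> k i j = 1/2 * (\<Sum>l\<in>UNIV. \<gamma> k l * (dG i j l + dG j i l - dG l i j))"
  shows "(\<Sum>i\<in>UNIV. ds i * \<gamma> i j + s * d\<gamma> i i j) = - s * (\<Sum>k\<in>UNIV. \<Sum>l\<in>UNIV. \<gamma> k l * \<Gamma> j k l)"
proof -
  define P where "P = (\<Sum>i\<in>UNIV. \<Sum>k\<in>UNIV. \<Sum>l\<in>UNIV. \<gamma> i j * \<gamma> k l * dG i k l)"
  define Q where "Q = (\<Sum>i\<in>UNIV. \<Sum>k\<in>UNIV. \<Sum>l\<in>UNIV. \<gamma> i k * \<gamma> l j * dG i k l)"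
  have 1: "(\<Sum>i\<in>UNIV. ds i * \<gamma> i j) = s * (P / 2)"
    unfolding ds P_def sum_distrib_left sum_distrib_right sum_divide_distrib
    by (intro sum.cong refl) (simp add: dG)
  have 2: "(\<Sum>i\<in>UNIV. s * d\<gamma> i i j) = - s * Q"
    unfolding d\<gamma> Q_def sum_distrib_left sum_negf[symmetric]
    by (intro sum.cong refl) (simp add: algebra_simps sum_distrib_left sum_negf[symmetric])
  have 3: "(\<Sum>k\<in>UNIV. \<Sum>l\<in>UNIV. \<gamma> k l * \<Gamma> j k l)
    = 1/2 * (\<Sum>k\<in>UNIV. \<Sum>l\<in>UNIV. \<Sum>q\<in>UNIV. \<gamma> k l * \<gamma> j q * dG k l q)
      + 1/2 * (\<Sum>k\<in>UNIV. \<Sum>l\<in>UNIV. \<Sum>q\<in>UNIV. \<gamma> k l * \<gamma> j q * dG l k q)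
      - 1/2 * (\<Sum>k\<in>UNIV. \<Sum>l\<in>UNIV. \<Sum>q\<in>UNIV. \<gamma> k l * \<gamma> j q * dG q k l)"
    unfolding \<Gamma> sum_distrib_left sum.distrib[symmetric] sum_subtractf[symmetric]
    by (intro sum.cong refl) (simp add: algebra_simps)
  have 4: "(\<Sum>k\<in>UNIV. \<Sum>l\<in>UNIV. \<Sum>q\<in>UNIV. \<gamma> k l * \<gamma> j q * dG k l q) = Q"
    unfolding Q_def by (intro sum.cong refl) (simp add: \<gamma>)
  have 5: "(\<Sum>k\<in>UNIV. \<Sum>l\<in>UNIV. \<Sum>q\<in>UNIV. \<gamma> k l * \<gamma> j q * dG l k q) = Q"
    unfolding Q_def by (subst sum.swap) (intro sum.cong refl, simp add: \<gamma>)
  have 6: "(\<Sum>k\<in>UNIV. \<Sum>l\<in>UNIV. \<Sum>q\<in>UNIV. \<gamma> k l * \<gamma> j q * dG q k l) = P"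
  proof -
    have "(\<Sum>k\<in>UNIV. \<Sum>l\<in>UNIV. \<Sum>q\<in>UNIV. \<gamma> k l * \<gamma> j q * dG q k l)
        = (\<Sum>k\<in>UNIV. \<Sum>q\<in>UNIV. \<Sum>l\<in>UNIV. \<gamma> k l * \<gamma> j q * dG q k l)"
      by (intro sum.cong refl sum.swap)
    also have "\<dots> = P"
      unfolding P_def by (subst sum.swap) (intro sum.cong refl, simp add: \<gamma>)
    finally show ?thesis .
  qed
  show ?thesis
    unfolding sum.distrib 1 2 3 4 5 6 by (simp add: algebra_simps)
qed

text \<open>Pointwise algebra again: u and uu are the first and second derivatives of the map, V is
  the variation field with derivatives W, H the target metric, K the 1-form h(V, d\<psi>), and Z i
  stands for d_i of s \<gamma>^ij K_j. The harmonic map equation eliminates uu, and what remains is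
  s/2 times the variation of the energy density.\<close>

lemma divergence_energy_identity:
  fixes \<gamma> :: "'m::finite \<Rightarrow> 'm \<Rightarrow> real" and H :: "'n::finite \<Rightarrow> 'n \<Rightarrow> real"
  assumes \<gamma>: "\<And>i j. \<gamma> i j = \<gamma> j i" and H: "\<And>a b. H a b = H b a"
    and dH: "\<And>e a b. dH e a b = dH e b a"
    and \<Gamma>N: "\<And>a b e. (\<Sum>f\<in>UNIV. H a f * \<Gamma>N f b e) = 1/2 * (dH b e a + dH e b a - dH a b e)"
    and tension: "\<And>a. (\<Sum>i\<in>UNIV. \<Sum>j\<in>UNIV. \<gamma> i j * (uu i j a - (\<Sum>k\<in>UNIV. \<Gamma> k i j * u k a)
        + (\<Sum>b\<in>UNIV. \<Sum>e\<in>UNIV. \<Gamma>N a b e * u i b * u j e))) = 0"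
    and div: "\<And>j. (\<Sum>i\<in>UNIV. ds i * \<gamma> i j + s * d\<gamma> i i j) = - s * (\<Sum>k\<in>UNIV. \<Sum>l\<in>UNIV. \<gamma> k l * \<Gamma> j k l)"
    and K: "\<And>j. K j = (\<Sum>a\<in>UNIV. \<Sum>b\<in>UNIV. H a b * V a * u j b)"
    and Z: "\<And>i. Z i = (\<Sum>j\<in>UNIV. ds i * \<gamma> i j * K j + s * d\<gamma> i i j * K j
        + s * \<gamma> i j * (\<Sum>a\<in>UNIV. \<Sum>b\<in>UNIV. (\<Sum>e\<in>UNIV. dH e a b * u i e) * V a * u j b
            + H a b * W i a * u j b + H a b * V a * uu i j b))"
  shows "(\<Sum>i\<in>UNIV. Z i) = s / 2 * (\<Sum>i\<in>UNIV. \<Sum>j\<in>UNIV. \<gamma> i j *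
     (\<Sum>a\<in>UNIV. \<Sum>b\<in>UNIV. (\<Sum>e\<in>UNIV. dH e a b * V e) * u i a * u j b
        + H a b * W i a * u j b + H a b * u i a * W j b))"
proof -
  \<comment> \<open>The product rule for K has three parts: Q1 differentiates the target metric, Q2
    the variation field, Q3 the map. P is the derivative of the target metric along V, and R is the
    target Christoffel term paired with V.\<close>
  define Q1 where "Q1 i j = (\<Sum>a\<in>UNIV. \<Sum>b\<in>UNIV. \<Sum>e\<in>UNIV. V a * dH e a b * u i e * u j b)" for i j
  define Q2 where "Q2 i j = (\<Sum>a\<in>UNIV. \<Sum>b\<in>UNIV. H a b * W i a * u j b)" for i j
  define Q3 where "Q3 i j = (\<Sum>a\<in>UNIV. \<Sum>b\<in>UNIV. H a b * V a * uu i j b)" for i j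
  define P where "P i j = (\<Sum>a\<in>UNIV. \<Sum>b\<in>UNIV. \<Sum>e\<in>UNIV. V a * dH a b e * u i b * u j e)" for i j
  define R where "R i j = (\<Sum>a\<in>UNIV. V a * (\<Sum>f\<in>UNIV. H a f * (\<Sum>b\<in>UNIV. \<Sum>e\<in>UNIV. \<Gamma>N f b e * u i b * u j e)))" for i j
  have Zi: "Z i = (\<Sum>j\<in>UNIV. (ds i * \<gamma> i j + s * d\<gamma> i i j) * K j) + s * (\<Sum>j\<in>UNIV. \<gamma> i j * (Q1 i j + Q2 i j + Q3 i j))" for i
  proof -
    have "(\<Sum>a\<in>UNIV. \<Sum>b\<in>UNIV. (\<Sum>e\<in>UNIV. dH e a b * u i e) * V a * u j b
            + H a b * W i a * u j b + H a b * V a * uu i j b) = Q1 i j + Q2 i j + Q3 i j" for j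
      unfolding Q1_def Q2_def Q3_def sum_distrib_right sum.distrib[symmetric]
      by (intro sum.cong refl arg_cong2[where f = "(+)"]) (simp add: mult.assoc mult.commute mult.left_commute)
    then have "Z i = (\<Sum>j\<in>UNIV. ds i * \<gamma> i j * K j + s * d\<gamma> i i j * K j
        + s * \<gamma> i j * (Q1 i j + Q2 i j + Q3 i j))"
      unfolding Z by (simp only:)
    then show ?thesis
      unfolding sum_distrib_left sum.distrib[symmetric]
      by (simp add: algebra_simps)
  qed
  have "(\<Sum>i\<in>UNIV. \<Sum>j\<in>UNIV. (ds i * \<gamma> i j + s * d\<gamma> i i j) * K j)
      = (\<Sum>j\<in>UNIV. (- s * (\<Sum>k\<in>UNIV. \<Sum>l\<in>UNIV. \<gamma> k l * \<Gamma> j k l)) * K j)"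
    by (subst sum.swap) (simp only: sum_distrib_right[symmetric] div)
  also have "\<dots> = - s * (\<Sum>k\<in>UNIV. \<Sum>l\<in>UNIV. \<gamma> k l * (\<Sum>j\<in>UNIV. \<Gamma> j k l * K j))"
  proof -
    have "(\<Sum>j\<in>UNIV. (\<Sum>k\<in>UNIV. \<Sum>l\<in>UNIV. \<gamma> k l * \<Gamma> j k l) * K j)
        = (\<Sum>j\<in>UNIV. \<Sum>k\<in>UNIV. \<Sum>l\<in>UNIV. \<gamma> k l * (\<Gamma> j k l * K j))"
      by (simp add: sum_distrib_right mult.assoc)
    also have "\<dots> = (\<Sum>k\<in>UNIV. \<Sum>j\<in>UNIV. \<Sum>l\<in>UNIV. \<gamma> k l * (\<Gamma> j k l * K j))"
      by (rule sum.swap)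
    also have "\<dots> = (\<Sum>k\<in>UNIV. \<Sum>l\<in>UNIV. \<Sum>j\<in>UNIV. \<gamma> k l * (\<Gamma> j k l * K j))"
      by (intro sum.cong refl sum.swap)
    finally show ?thesis
      by (simp only: mult.assoc sum_distrib_left[symmetric])
  qed
  finally have Zsum: "(\<Sum>i\<in>UNIV. Z i) = s * (\<Sum>i\<in>UNIV. \<Sum>j\<in>UNIV. \<gamma> i j *
      (Q1 i j + Q2 i j + Q3 i j - (\<Sum>k\<in>UNIV. \<Gamma> k i j * K k)))"
    unfolding Zi by (simp add: sum.distrib sum_distrib_left[symmetric] sum_subtractf algebra_simps)
  \<comment> \<open>Pairing the harmonic map equation with V expresses the contraction of Q3 through
    the Christoffel terms of M and N.\<close>
  have "0 = (\<Sum>a\<in>UNIV. V a * (\<Sum>f\<in>UNIV. H a f * (\<Sum>i\<in>UNIV. \<Sum>j\<in>UNIV. \<gamma> i j *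
        (uu i j f - (\<Sum>k\<in>UNIV. \<Gamma> k i j * u k f) + (\<Sum>b\<in>UNIV. \<Sum>e\<in>UNIV. \<Gamma>N f b e * u i b * u j e)))))"
    unfolding tension by simp
  also have "\<dots> = (\<Sum>a\<in>UNIV. \<Sum>f\<in>UNIV. \<Sum>i\<in>UNIV. \<Sum>j\<in>UNIV. V a * (H a f * (\<gamma> i j *
        (uu i j f - (\<Sum>k\<in>UNIV. \<Gamma> k i j * u k f) + (\<Sum>b\<in>UNIV. \<Sum>e\<in>UNIV. \<Gamma>N f b e * u i b * u j e)))))"
    by (simp only: sum_distrib_left)
  also have "\<dots> = (\<Sum>a\<in>UNIV. \<Sum>i\<in>UNIV. \<Sum>j\<in>UNIV. \<Sum>f\<in>UNIV. V a * (H a f * (\<gamma> i j *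
        (uu i j f - (\<Sum>k\<in>UNIV. \<Gamma> k i j * u k f) + (\<Sum>b\<in>UNIV. \<Sum>e\<in>UNIV. \<Gamma>N f b e * u i b * u j e)))))"
    by (intro sum.cong refl trans[OF sum.swap] sum.swap)
  also have "\<dots> = (\<Sum>i\<in>UNIV. \<Sum>j\<in>UNIV. \<Sum>a\<in>UNIV. \<Sum>f\<in>UNIV. V a * (H a f * (\<gamma> i j *
        (uu i j f - (\<Sum>k\<in>UNIV. \<Gamma> k i j * u k f) + (\<Sum>b\<in>UNIV. \<Sum>e\<in>UNIV. \<Gamma>N f b e * u i b * u j e)))))"
    by (rule trans[OF sum.swap]) (intro sum.cong refl sum.swap)
  also have "\<dots> = (\<Sum>i\<in>UNIV. \<Sum>j\<in>UNIV. \<gamma> i j * (Q3 i j - (\<Sum>k\<in>UNIV. \<Gamma> k i j * K k) + R i j))"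
  proof (intro sum.cong refl)
    fix i j
    have "(\<Sum>k\<in>UNIV. \<Gamma> k i j * K k) = (\<Sum>a\<in>UNIV. \<Sum>f\<in>UNIV. V a * (H a f * (\<Sum>k\<in>UNIV. \<Gamma> k i j * u k f)))"
    proof -
      have "(\<Sum>k\<in>UNIV. \<Gamma> k i j * K k) = (\<Sum>k\<in>UNIV. \<Sum>a\<in>UNIV. \<Sum>f\<in>UNIV. V a * (H a f * (\<Gamma> k i j * u k f)))"
        unfolding K sum_distrib_left by (intro sum.cong refl) (simp add: mult.assoc mult.commute mult.left_commute)
      also have "\<dots> = (\<Sum>a\<in>UNIV. \<Sum>k\<in>UNIV. \<Sum>f\<in>UNIV. V a * (H a f * (\<Gamma> k i j * u k f)))"
        by (rule sum.swap)
      also have "\<dots> = (\<Sum>a\<in>UNIV. \<Sum>f\<in>UNIV. \<Sum>k\<in>UNIV. V a * (H a f * (\<Gamma> k i j * u k f)))"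
        by (intro sum.cong refl sum.swap)
      finally show ?thesis by (simp only: sum_distrib_left)
    qed
    moreover have "R i j = (\<Sum>a\<in>UNIV. \<Sum>f\<in>UNIV. V a * (H a f * (\<Sum>b\<in>UNIV. \<Sum>e\<in>UNIV. \<Gamma>N f b e * u i b * u j e)))"
      unfolding R_def by (simp only: sum_distrib_left)
    ultimately show "(\<Sum>a\<in>UNIV. \<Sum>f\<in>UNIV. V a * (H a f * (\<gamma> i j *
        (uu i j f - (\<Sum>k\<in>UNIV. \<Gamma> k i j * u k f) + (\<Sum>b\<in>UNIV. \<Sum>e\<in>UNIV. \<Gamma>N f b e * u i b * u j e)))))
      = \<gamma> i j * (Q3 i j - (\<Sum>k\<in>UNIV. \<Gamma> k i j * K k) + R i j)"
      unfolding Q3_def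
      by (simp only: sum.distrib[symmetric] sum_subtractf[symmetric] sum_distrib_left[of "\<gamma> i j"])
        (intro sum.cong refl, simp add: algebra_simps)
  qed
  finally have tens: "(\<Sum>i\<in>UNIV. \<Sum>j\<in>UNIV. \<gamma> i j * (Q3 i j - (\<Sum>k\<in>UNIV. \<Gamma> k i j * K k) + R i j)) = 0"
    by simp
  \<comment> \<open>Lowering the index turns the target Christoffel symbol into three first
    derivatives of H. After contraction with the symmetric \<gamma>, R amounts to Q1 - P/2, so Q1
    cancels and P/2 is left.\<close>
  have R: "R i j = 1/2 * (Q1 i j + Q1 j i - P i j)" for i j
  proof -
    have "(\<Sum>f\<in>UNIV. H a f * (\<Sum>b\<in>UNIV. \<Sum>e\<in>UNIV. \<Gamma>N f b e * u i b * u j e))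
      = (\<Sum>b\<in>UNIV. \<Sum>e\<in>UNIV. (1/2 * (dH b e a + dH e b a - dH a b e)) * u i b * u j e)" for a
    proof -
      have "(\<Sum>f\<in>UNIV. H a f * (\<Sum>b\<in>UNIV. \<Sum>e\<in>UNIV. \<Gamma>N f b e * u i b * u j e))
        = (\<Sum>f\<in>UNIV. \<Sum>b\<in>UNIV. \<Sum>e\<in>UNIV. H a f * \<Gamma>N f b e * u i b * u j e)"
        by (simp add: sum_distrib_left mult.assoc)
      also have "\<dots> = (\<Sum>b\<in>UNIV. \<Sum>f\<in>UNIV. \<Sum>e\<in>UNIV. H a f * \<Gamma>N f b e * u i b * u j e)"
        by (rule sum.swap)
      also have "\<dots> = (\<Sum>b\<in>UNIV. \<Sum>e\<in>UNIV. \<Sum>f\<in>UNIV. H a f * \<Gamma>N f b e * u i b * u j e)"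
        by (intro sum.cong refl sum.swap)
      finally show ?thesis by (simp only: sum_distrib_right[symmetric] \<Gamma>N)
    qed
    then have "R i j = (\<Sum>a\<in>UNIV. V a * (\<Sum>b\<in>UNIV. \<Sum>e\<in>UNIV.
        (1/2 * (dH b e a + dH e b a - dH a b e)) * u i b * u j e))"
      unfolding R_def by (simp only:)
    also have "\<dots> = (\<Sum>a\<in>UNIV. \<Sum>b\<in>UNIV. \<Sum>e\<in>UNIV. 1/2 * (V a * dH b e a * u i b * u j e)
        + 1/2 * (V a * dH e b a * u i b * u j e) - 1/2 * (V a * dH a b e * u i b * u j e))"
      unfolding sum_distrib_left by (intro sum.cong refl) (simp add: algebra_simps)
    also have "\<dots> = 1/2 * (\<Sum>a\<in>UNIV. \<Sum>b\<in>UNIV. \<Sum>e\<in>UNIV. V a * dH b e a * u i b * u j e)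
        + 1/2 * (\<Sum>a\<in>UNIV. \<Sum>b\<in>UNIV. \<Sum>e\<in>UNIV. V a * dH e b a * u i b * u j e) - 1/2 * P i j"
      unfolding P_def sum_distrib_left sum.distrib[symmetric] sum_subtractf[symmetric] ..
    also have "(\<Sum>a\<in>UNIV. \<Sum>b\<in>UNIV. \<Sum>e\<in>UNIV. V a * dH b e a * u i b * u j e) = Q1 i j"
      unfolding Q1_def by (intro sum.cong refl trans[OF sum.swap]) (simp add: dH)
    also have "(\<Sum>a\<in>UNIV. \<Sum>b\<in>UNIV. \<Sum>e\<in>UNIV. V a * dH e b a * u i b * u j e) = Q1 j i"
      unfolding Q1_def by (intro sum.cong refl) (simp add: dH)
    finally show ?thesis by (simp add: algebra_simps)
  qed
  have Q1_swap: "(\<Sum>i\<in>UNIV. \<Sum>j\<in>UNIV. \<gamma> i j * Q1 j i) = (\<Sum>i\<in>UNIV. \<Sum>j\<in>UNIV. \<gamma> i j * Q1 i j)"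
    by (subst sum.swap) (simp add: \<gamma>)
  have Q2_swap: "(\<Sum>i\<in>UNIV. \<Sum>j\<in>UNIV. \<gamma> i j * Q2 j i) = (\<Sum>i\<in>UNIV. \<Sum>j\<in>UNIV. \<gamma> i j * Q2 i j)"
    by (subst sum.swap) (simp add: \<gamma>)
  have "(\<Sum>a\<in>UNIV. \<Sum>b\<in>UNIV. (\<Sum>e\<in>UNIV. dH e a b * V e) * u i a * u j b
        + H a b * W i a * u j b + H a b * u i a * W j b) = P i j + Q2 i j + Q2 j i" for i j
  proof -
    have "P i j = (\<Sum>b\<in>UNIV. \<Sum>a\<in>UNIV. \<Sum>e\<in>UNIV. V a * dH a b e * u i b * u j e)"
      unfolding P_def by (rule sum.swap)
    also have "\<dots> = (\<Sum>b\<in>UNIV. \<Sum>e\<in>UNIV. \<Sum>a\<in>UNIV. V a * dH a b e * u i b * u j e)"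
      by (intro sum.cong refl sum.swap)
    also have "\<dots> = (\<Sum>a\<in>UNIV. \<Sum>b\<in>UNIV. (\<Sum>e\<in>UNIV. dH e a b * V e) * u i a * u j b)"
      unfolding sum_distrib_right by (intro sum.cong refl) (simp add: mult.commute)
    finally have "P i j = (\<Sum>a\<in>UNIV. \<Sum>b\<in>UNIV. (\<Sum>e\<in>UNIV. dH e a b * V e) * u i a * u j b)" .
    moreover have "Q2 j i = (\<Sum>a\<in>UNIV. \<Sum>b\<in>UNIV. H a b * u i a * W j b)"
      unfolding Q2_def by (subst sum.swap) (intro sum.cong refl, simp add: H mult.assoc mult.commute mult.left_commute)
    ultimately show ?thesis
      by (simp add: Q2_def sum.distrib)
  qed
  then have E1: "(\<Sum>i\<in>UNIV. \<Sum>j\<in>UNIV. \<gamma> i j * (\<Sum>a\<in>UNIV. \<Sum>b\<in>UNIV. (\<Sum>e\<in>UNIV. dH e a b * V e) * u i a * u j b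
        + H a b * W i a * u j b + H a b * u i a * W j b))
     = (\<Sum>i\<in>UNIV. \<Sum>j\<in>UNIV. \<gamma> i j * P i j) + 2 * (\<Sum>i\<in>UNIV. \<Sum>j\<in>UNIV. \<gamma> i j * Q2 i j)"
    using Q2_swap by (simp add: distrib_left sum.distrib)
  have E2: "(\<Sum>i\<in>UNIV. \<Sum>j\<in>UNIV. \<gamma> i j * (Q1 i j + Q2 i j + Q3 i j - (\<Sum>k\<in>UNIV. \<Gamma> k i j * K k)))
     = (\<Sum>i\<in>UNIV. \<Sum>j\<in>UNIV. \<gamma> i j * Q1 i j) + (\<Sum>i\<in>UNIV. \<Sum>j\<in>UNIV. \<gamma> i j * Q2 i j)
       - (\<Sum>i\<in>UNIV. \<Sum>j\<in>UNIV. \<gamma> i j * R i j)"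
    using tens by (simp add: distrib_left right_diff_distrib sum.distrib sum_subtractf)
  have E3: "(\<Sum>i\<in>UNIV. \<Sum>j\<in>UNIV. \<gamma> i j * R i j)
     = (\<Sum>i\<in>UNIV. \<Sum>j\<in>UNIV. \<gamma> i j * Q1 i j) - 1/2 * (\<Sum>i\<in>UNIV. \<Sum>j\<in>UNIV. \<gamma> i j * P i j)"
  proof -
    have "(\<Sum>i\<in>UNIV. \<Sum>j\<in>UNIV. \<gamma> i j * R i j) = 1/2 * (\<Sum>i\<in>UNIV. \<Sum>j\<in>UNIV. \<gamma> i j * Q1 i j)
        + 1/2 * (\<Sum>i\<in>UNIV. \<Sum>j\<in>UNIV. \<gamma> i j * Q1 j i) - 1/2 * (\<Sum>i\<in>UNIV. \<Sum>j\<in>UNIV. \<gamma> i j * P i j)"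
      unfolding R sum_distrib_left sum.distrib[symmetric] sum_subtractf[symmetric]
      by (intro sum.cong refl) (simp add: algebra_simps)
    then show ?thesis unfolding Q1_swap by simp
  qed
  show ?thesis
    unfolding Zsum E1 E2 E3 by (simp add: algebra_simps)
qed

section \<open>The Hilbert-Schmidt pairing and its invariance\<close>

text \<open>The inner product that G and H induce on linear maps. The bilinear form, rather than its
  quadratic form, also covers the flux, where one argument has rank one.\<close>

definition hs_inner :: "real^'m^'m \<Rightarrow> real^'n^'n \<Rightarrow> real^'m^'n \<Rightarrow> real^'m^'n \<Rightarrow> real" where
  "hs_inner G H A B = (\<Sum>i\<in>UNIV. \<Sum>j\<in>UNIV. matrix_inv G $ i $ j * (column i A \<bullet> (H *v column j B)))"

lemma hs_inner_trace:
  "hs_inner G H A B = trace (matrix_inv G ** transpose (transpose A ** H ** B))"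
proof -
  have "column i A \<bullet> (H *v column j B) = (transpose A ** H ** B) $ i $ j" for i j
  proof -
    have "(transpose A ** H ** B) $ i $ j = (transpose A ** (H ** B)) $ i $ j"
      by (simp add: matrix_mul_assoc)
    then show ?thesis
      by (simp add: column_def transpose_def inner_vec_def matrix_vector_mult_def matrix_matrix_mult_def)
  qed
  then show ?thesis
    by (simp add: hs_inner_def trace_def matrix_matrix_mult_def transpose_def)
qed

text \<open>J is the Jacobian of the chart change on the domain and K that on the target. In the
  trace form the factors J cancel by cyclicity of the trace, and K is absorbed by the transformation
  law of H.\<close>

lemma hs_inner_invariant:
  fixes G G' J :: "real^'m^'m" and H H' K :: "real^'n^'n"
  assumes "G = transpose J ** G' ** J" "H = transpose K ** H' ** K" "invertible J" "invertible G'"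
    and A: "A' ** J = K ** A" and B: "B' ** J = K ** B"
  shows "hs_inner G H A B = hs_inner G' H' A' B'"
proof -
  define Ji where "Ji = matrix_inv J"
  have J: "J ** Ji = mat 1" "Ji ** J = mat 1"
    using matrix_inv_left_right[OF assms(3)] by (auto simp: Ji_def)
  have Jt: "transpose J ** transpose Ji = mat 1" "transpose Ji ** transpose J = mat 1"
    unfolding matrix_transpose_mul[symmetric] J by (auto simp: transpose_mat)
  have G': "G' ** matrix_inv G' = mat 1" using matrix_inv_left_right[OF assms(4)] by simp
  have "G ** (Ji ** matrix_inv G' ** transpose Ji)
      = transpose J ** G' ** (J ** Ji) ** matrix_inv G' ** transpose Ji"
    unfolding assms(1) by (simp only: matrix_mul_assoc)
  also have "\<dots> = transpose J ** (G' ** matrix_inv G') ** transpose Ji"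
    unfolding J by (simp add: matrix_mul_assoc)
  also have "\<dots> = mat 1"
    unfolding G' by (simp add: Jt)
  finally have Gi: "matrix_inv G = Ji ** matrix_inv G' ** transpose Ji"
    by (rule matrix_inv_eqI)
  define P where "P = transpose A' ** H' ** B'"
  have "transpose A ** H ** B = transpose (K ** A) ** H' ** (K ** B)"
    unfolding assms(2) by (simp add: matrix_transpose_mul matrix_mul_assoc)
  also have "\<dots> = transpose J ** P ** J"
    unfolding A[symmetric] B[symmetric] P_def by (simp add: matrix_transpose_mul matrix_mul_assoc)
  finally have "transpose (transpose A ** H ** B) = transpose J ** transpose P ** J"
    by (simp add: matrix_transpose_mul matrix_mul_assoc)
  then have "matrix_inv G ** transpose (transpose A ** H ** B)
      = Ji ** matrix_inv G' ** (transpose Ji ** transpose J) ** transpose P ** J"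
    unfolding Gi by (simp only: matrix_mul_assoc)
  also have "\<dots> = Ji ** (matrix_inv G' ** transpose P ** J)"
    unfolding Jt by (simp add: matrix_mul_assoc)
  finally have "hs_inner G H A B = trace (Ji ** (matrix_inv G' ** transpose P ** J))"
    unfolding hs_inner_trace by simp
  also have "\<dots> = trace ((matrix_inv G' ** transpose P) ** (J ** Ji))"
    unfolding trace_mul_sym[of Ji] by (simp add: matrix_mul_assoc)
  finally show ?thesis
    unfolding J hs_inner_trace P_def by simp
qed

text \<open>The change of variables theorems of HOL-Analysis need a well-ordered index type, while
  charts take values in \<open>real^'m\<close> for an arbitrary finite index type. This copy of the index
  type transfers them.\<close>

typedef (overloaded) ('m::finite) wo_index = "{..<CARD('m)}"
  by (auto intro!: exI[of _ 0])

instantiation wo_index :: (finite) "{finite, wellorder}"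
begin

definition less_eq_wo_index :: "'a wo_index \<Rightarrow> 'a wo_index \<Rightarrow> bool" where
  "x \<le> y \<longleftrightarrow> Rep_wo_index x \<le> Rep_wo_index y"

definition less_wo_index :: "'a wo_index \<Rightarrow> 'a wo_index \<Rightarrow> bool" where
  "x < y \<longleftrightarrow> Rep_wo_index x < Rep_wo_index y"

instance
proof
  show "finite (UNIV :: 'a wo_index set)"
    by (rule finite_imageD[of Rep_wo_index])
      (auto intro!: finite_subset[of _ "{..<CARD('a)}"] Rep_wo_index[simplified] simp: inj_on_def Rep_wo_index_inject)
  fix P :: "'a wo_index \<Rightarrow> bool" and a
  assume *: "\<And>x. (\<And>y. y < x \<Longrightarrow> P y) \<Longrightarrow> P x"
  show "P a"
    by (induction "Rep_wo_index a" arbitrary: a rule: less_induct) (rule *, simp add: less_wo_index_def)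
qed (auto simp: less_eq_wo_index_def less_wo_index_def Rep_wo_index_inject)

end

lemma card_wo_index: "CARD('m::finite wo_index) = CARD('m)"
  using type_definition.card[OF type_definition_wo_index[where 'm = 'm]] by simp

section \<open>Change of variables for Lebesgue measure\<close>

text \<open>Conjugation by b is a sign-preserving bijection between the permutations of the two
  index types, so the Leibniz sums agree term by term.\<close>

lemma det_reindex:
  fixes A :: "real^'m^'m" and b :: "'k::finite \<Rightarrow> 'm"
  assumes b: "bij b"
  shows "det (\<chi> i j. A $ b i $ b j) = det A"
proof -
  have inv_b: "bij_betw (inv b) UNIV UNIV" using b by (rule bij_imp_bij_inv)
  have b': "inj b" "\<And>x. b (inv b x) = x" "\<And>x. inv b (b x) = x"
    using b by (auto simp: bij_def surj_f_inv_f)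
  have "det (\<chi> i j. A $ b i $ b j) = (\<Sum>p | p permutes UNIV. of_int (sign p) * (\<Prod>i\<in>UNIV. A $ b i $ b (p i)))"
    by (simp add: det_def)
  also have "\<dots> = (\<Sum>p | p permutes UNIV. of_int (sign p) * (\<Prod>i\<in>UNIV. A $ i $ p i))"
  proof (rule sum.reindex_bij_witness[where i = "map_permutation UNIV (inv b)" and j = "map_permutation UNIV b"])
    fix p assume "p \<in> {p. p permutes (UNIV :: 'k set)}"
    then have p: "p permutes UNIV" by simp
    show "map_permutation UNIV (inv b) (map_permutation UNIV b p) = p"
      by (rule map_permutation_compose_inv[OF _ p]) (use b b' in auto)
    show "map_permutation UNIV b p \<in> {p. p permutes UNIV}"
      using map_permutation_permutes[OF b p] by simp
    have "(\<Prod>i\<in>UNIV. A $ i $ map_permutation UNIV b p i) = (\<Prod>i\<in>UNIV. A $ b i $ map_permutation UNIV b p (b i))"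
      using prod.reindex_bij_betw[OF b, of "\<lambda>i. A $ i $ map_permutation UNIV b p i"] by simp
    then show "of_int (sign (map_permutation UNIV b p)) * (\<Prod>i\<in>UNIV. A $ i $ map_permutation UNIV b p i)
        = of_int (sign p) * (\<Prod>i\<in>UNIV. A $ b i $ b (p i))"
      using sign_map_permutation[of b UNIV p] p b' by (simp add: map_permutation_apply)
  next
    fix p assume "p \<in> {p. p permutes (UNIV :: 'm set)}"
    then have p: "p permutes UNIV" by simp
    show "map_permutation UNIV b (map_permutation UNIV (inv b) p) = p"
      by (rule map_permutation_compose_inv[OF _ p]) (use inv_b b' in auto)
    show "map_permutation UNIV (inv b) p \<in> {p. p permutes UNIV}"
      using map_permutation_permutes[OF inv_b p] by simp
  qed
  finally show ?thesis by (simp add: det_def)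
qed

text \<open>The image is the preimage of A under the continuous inverse h.\<close>

lemma borel_image_of_continuous_inverse:
  fixes g :: "'a::euclidean_space \<Rightarrow> 'b::euclidean_space"
  assumes "open (g ` S)" "continuous_on (g ` S) h" "\<And>x. x \<in> S \<Longrightarrow> h (g x) = x"
    "A \<in> sets borel" "A \<subseteq> S"
  shows "g ` A \<in> sets borel"
proof -
  have "h \<in> borel_measurable (restrict_space borel (g ` S))"
    by (rule borel_measurable_continuous_on_restrict[OF assms(2)])
  then have "h -` A \<inter> space (restrict_space borel (g ` S)) \<in> sets (restrict_space borel (g ` S))"
    using assms(4) by (rule measurable_sets)
  moreover have "h -` A \<inter> space (restrict_space borel (g ` S)) = g ` A"
    using assms(3,5) by (auto simp: space_restrict_space)
  ultimately show ?thesis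
    using assms(1) by (auto simp: sets_restrict_space)
qed

text \<open>If the Jacobian is integrable over A, the formula for finite measures applies. If not,
  the image has infinite measure, and so has the right-hand side, because a finite integral of a
  nonnegative measurable function would give integrability.\<close>

lemma emeasure_diffeomorphic_image_wellorder:
  fixes g :: "real^'n::{finite,wellorder} \<Rightarrow> real^'n::_"
  assumes S: "open S" "open (g ` S)" and der: "\<And>x. x \<in> S \<Longrightarrow> (g has_derivative g' x) (at x)"
    and cont: "continuous_on S (\<lambda>x. det (matrix (g' x)))"
    and h: "continuous_on (g ` S) h" "\<And>x. x \<in> S \<Longrightarrow> h (g x) = x"
    and A: "A \<in> sets borel" "A \<subseteq> S"
  shows "emeasure lborel (g ` A) = (\<integral>\<^sup>+x. ennreal \<bar>det (matrix (g' x))\<bar> * indicator A x \<partial>lborel)"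
proof -
  let ?d = "\<lambda>x. \<bar>det (matrix (g' x))\<bar>"
  have gA: "g ` A \<in> sets borel"
    by (rule borel_image_of_continuous_inverse[OF S(2) h A])
  have inj: "inj_on g A"
    using h(2) A(2) by (metis inj_onI subsetD)
  have derA: "(g has_derivative g' x) (at x within A)" if "x \<in> A" for x
    using der that A(2) has_derivative_at_withinI by blast
  have AL: "A \<in> sets lebesgue" using A(1) by simp
  show ?thesis
  proof (cases "?d integrable_on A")
    case True
    then have "(?d has_integral (integral A ?d)) A" by (rule integrable_integral)
    then have "g ` A \<in> lmeasurable" "measure lebesgue (g ` A) = integral A ?d"
      "integral\<^sup>N lborel (\<lambda>x. ennreal (?d x) * indicator A x) = ennreal (integral A ?d)"
      using has_measure_differentiable_image[OF AL derA inj] nn_integral_has_integral_lebesgue'[of A ?d]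
      by auto
    moreover have "emeasure lebesgue (g ` A) = ennreal (measure lebesgue (g ` A))"
      by (rule emeasure_eq_ennreal_measure[OF fmeasurableD2[OF \<open>g ` A \<in> lmeasurable\<close>]])
    ultimately show ?thesis using gA by simp
  next
    case False
    have "g ` A \<notin> lmeasurable"
      using False measurable_differentiable_image_eq[OF AL derA inj] by blast
    then have "\<not> emeasure lborel (g ` A) < \<infinity>"
      using gA by (auto simp: fmeasurable_def)
    then have "emeasure lborel (g ` A) = \<infinity>"
      by (simp add: less_top[symmetric])
    moreover have "(\<integral>\<^sup>+x. ennreal (?d x) * indicator A x \<partial>lborel) = \<infinity>"
    proof (rule ccontr)
      assume fin: "(\<integral>\<^sup>+x. ennreal (?d x) * indicator A x \<partial>lborel) \<noteq> \<infinity>"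
      have cA: "?d \<in> borel_measurable (restrict_space borel A)"
        by (intro borel_measurable_continuous_on_restrict continuous_on_rabs continuous_on_subset[OF cont A(2)])
      have "(\<lambda>x. indicator A x *\<^sub>R ?d x) integrable_on UNIV"
      proof (rule nn_integral_integrable_on)
        show "(\<lambda>x. indicator A x *\<^sub>R ?d x) \<in> borel_measurable borel"
          using cA A(1) by (subst (asm) borel_measurable_restrict_space_iff) auto
        have "ennreal (indicator A x *\<^sub>R ?d x) = ennreal (?d x) * indicator A x" for x
          by (auto simp: indicator_def)
        then show "(\<integral>\<^sup>+x. ennreal (indicator A x *\<^sub>R ?d x) \<partial>lborel) < \<infinity>"
          using fin by (simp add: top.not_eq_extremum)
      qed (auto simp: indicator_def)
      then have "(\<lambda>x. if x \<in> A then ?d x else 0) integrable_on UNIV"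
        by (rule integrable_eq) (auto simp: indicator_def)
      then show False
        using False integrable_restrict_UNIV by blast
    qed
    ultimately show ?thesis by simp
  qed
qed

lemma prod_Basis_vec: "(\<Prod>b\<in>Basis. f b) = (\<Prod>i\<in>UNIV. f (axis i 1))"
  for f :: "real^'n \<Rightarrow> real"
proof -
  have "Basis = range (\<lambda>i. axis i 1 :: real^'n)"
    by (auto simp: Basis_vec_def)
  moreover have "inj (\<lambda>i. axis i 1 :: real^'n)"
    by (auto simp: inj_on_def axis_eq_axis)
  ultimately show ?thesis
    using prod.reindex[of "\<lambda>i. axis i 1 :: real^'n" UNIV f] by simp
qed

definition reindex_vec :: "('k \<Rightarrow> 'm) \<Rightarrow> 'a^'m \<Rightarrow> 'a^'k" where
  "reindex_vec b x = (\<chi> i. x $ b i)"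

lemma bounded_linear_reindex_vec:
  "bounded_linear (reindex_vec b :: real^'m::finite \<Rightarrow> real^'k::finite)"
  unfolding linear_conv_bounded_linear[symmetric]
  by (rule linearI) (auto simp: reindex_vec_def vec_eq_iff)

text \<open>The preimage of a box under a relabelling of the coordinates is the box with relabelled
  sides and has the same volume; boxes determine Lebesgue measure.\<close>

lemma lborel_distr_reindex_vec:
  fixes b :: "'m::finite \<Rightarrow> 'k::finite"
  assumes b: "bij b"
  shows "distr lborel borel (reindex_vec b) = (lborel :: (real^'m) measure)"
proof (rule lborel_eqI[symmetric])
  have b': "\<And>x. b (inv b x) = x" "\<And>x. inv b (b x) = x"
    using b by (auto simp: bij_def surj_f_inv_f)
  have meas: "(reindex_vec b :: real^'k \<Rightarrow> real^'m) \<in> borel_measurable lborel"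
    using bounded_linear_reindex_vec[of b]
    by (simp add: borel_measurable_continuous_onI linear_continuous_on)
  fix l u :: "real^'m"
  assume lu: "\<And>c. c \<in> Basis \<Longrightarrow> l \<bullet> c \<le> u \<bullet> c"
  have pre: "reindex_vec b -` box l u = box (reindex_vec (inv b) l) (reindex_vec (inv b) u)"
  proof (intro set_eqI)
    fix x :: "real^'k"
    have "x \<in> reindex_vec b -` box l u \<longleftrightarrow> (\<forall>i. l $ i < x $ b i \<and> x $ b i < u $ i)"
      by (simp add: mem_box_cart reindex_vec_def)
    also have "\<dots> \<longleftrightarrow> (\<forall>j. l $ inv b j < x $ j \<and> x $ j < u $ inv b j)"
      using b' by metis
    finally show "x \<in> reindex_vec b -` box l u \<longleftrightarrow> x \<in> box (reindex_vec (inv b) l) (reindex_vec (inv b) u)"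
      by (simp add: mem_box_cart reindex_vec_def)
  qed
  have "l $ i \<le> u $ i" for i
    using lu[of "axis i 1"] by (simp add: inner_axis)
  then have "\<forall>c\<in>Basis. reindex_vec (inv b) l \<bullet> c \<le> reindex_vec (inv b) u \<bullet> c"
    by (auto simp: Basis_vec_def inner_axis reindex_vec_def)
  then have "emeasure (distr lborel borel (reindex_vec b)) (box l u)
      = (\<Prod>c\<in>Basis. (reindex_vec (inv b) u - reindex_vec (inv b) l) \<bullet> c)"
    using meas by (simp add: emeasure_distr pre)
  also have "\<dots> = (\<Prod>j\<in>UNIV. u $ inv b j - l $ inv b j)"
    by (simp add: prod_Basis_vec inner_axis reindex_vec_def)
  also have "\<dots> = (\<Prod>i\<in>UNIV. u $ i - l $ i)"
    using prod.reindex_bij_betw[OF bij_imp_bij_inv[OF b], of "\<lambda>i. u $ i - l $ i"] by simp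
  finally show "emeasure (distr lborel borel (reindex_vec b)) (box l u) = ennreal (\<Prod>c\<in>Basis. (u - l) \<bullet> c)"
    by (simp add: prod_Basis_vec inner_axis)
qed simp

text \<open>Conjugation with the relabelling ?T gives a map between spaces with well-ordered index;
  ?T preserves Lebesgue measure, and the determinant of the derivative is unchanged by
  \<open>det_reindex\<close>.\<close>

lemma emeasure_diffeomorphic_image:
  fixes g :: "real^'m \<Rightarrow> real^'m"
  assumes S: "open S" "open (g ` S)" and der: "\<And>x. x \<in> S \<Longrightarrow> (g has_derivative g' x) (at x)"
    and cont: "continuous_on S (\<lambda>x. det (matrix (g' x)))"
    and h: "continuous_on (g ` S) h" "\<And>x. x \<in> S \<Longrightarrow> h (g x) = x"
    and A: "A \<in> sets borel" "A \<subseteq> S"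
  shows "emeasure lborel (g ` A) = (\<integral>\<^sup>+x. ennreal \<bar>det (matrix (g' x))\<bar> * indicator A x \<partial>lborel)"
proof -
  obtain b :: "'m wo_index \<Rightarrow> 'm" where b: "bij b"
    using finite_same_card_bij[of "UNIV :: 'm wo_index set" "UNIV :: 'm set"] card_wo_index by auto
  have b': "\<And>x. b (inv b x) = x" "\<And>x. inv b (b x) = x"
    using b by (auto simp: bij_def surj_f_inv_f)
  let ?T = "reindex_vec b :: real^'m \<Rightarrow> real^'m wo_index"
  let ?T' = "reindex_vec (inv b) :: real^'m wo_index \<Rightarrow> real^'m"
  have T: "?T' (?T x) = x" "?T (?T' y) = y" for x y
    by (auto simp: reindex_vec_def vec_eq_iff b')
  have lin: "bounded_linear ?T" "bounded_linear ?T'"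
    by (rule bounded_linear_reindex_vec)+
  have contT: "continuous_on X ?T" "continuous_on Y ?T'" for X Y
    by (rule linear_continuous_on[OF lin(1)], rule linear_continuous_on[OF lin(2)])
  have meas: "?T \<in> borel_measurable borel" "?T' \<in> borel_measurable borel"
    by (rule borel_measurable_continuous_onI[OF contT(1)], rule borel_measurable_continuous_onI[OF contT(2)])
  have image_T: "?T ` X = ?T' -` X" for X
    using T by (auto simp: image_iff) metis
  have open_T: "open (?T ` X)" if "open X" for X
    unfolding image_T using that contT(2) by (simp add: open_vimage)
  have borel_T: "?T ` X \<in> sets borel" if "X \<in> sets borel" for X
    unfolding image_T using measurable_sets[OF meas(2) that] by simp
  define G where "G = (\<lambda>y. ?T (g (?T' y)))"
  define G' where "G' = (\<lambda>y v. ?T (g' (?T' y) (?T' v)))"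
  have det_G': "det (matrix (G' y)) = det (matrix (g' (?T' y)))" for y
  proof -
    have "?T' (axis j 1) = axis (b j) 1" for j
      using b' by (auto simp: reindex_vec_def vec_eq_iff axis_def)
    then have "matrix (G' y) = (\<chi> i j. matrix (g' (?T' y)) $ b i $ b j)"
      by (simp add: matrix_def G'_def vec_eq_iff) (simp add: reindex_vec_def)
    then show ?thesis using det_reindex[OF b] by metis
  qed
  have GT: "G ` ?T ` X = ?T ` g ` X" for X
    by (auto simp: G_def T image_iff)
  have inTS: "?T' y \<in> S" if "y \<in> ?T ` S" for y
    using that T by auto
  have "emeasure lborel (G ` ?T ` A) = (\<integral>\<^sup>+y. ennreal \<bar>det (matrix (G' y))\<bar> * indicator (?T ` A) y \<partial>lborel)"
  proof (rule emeasure_diffeomorphic_image_wellorder[where S = "?T ` S" and h = "\<lambda>y. ?T (h (?T' y))"])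
    show "open (?T ` S)" "open (G ` ?T ` S)"
      unfolding GT by (intro open_T S)+
    show "(G has_derivative G' y) (at y)" if "y \<in> ?T ` S" for y
      unfolding G_def G'_def
      by (intro bounded_linear.has_derivative[OF lin(1)]
          has_derivative_compose[OF bounded_linear_imp_has_derivative[OF lin(2)] der] inTS that)
    show "continuous_on (?T ` S) (\<lambda>y. det (matrix (G' y)))"
      unfolding det_G' using inTS by (intro continuous_on_compose2[OF cont contT(2)]) auto
    show "continuous_on (G ` ?T ` S) (\<lambda>y. ?T (h (?T' y)))"
      unfolding GT using T by (intro continuous_on_compose2[OF contT(1)] continuous_on_compose2[OF h(1) contT(2)]) auto
    show "?T (h (?T' (G y))) = y" if "y \<in> ?T ` S" for y
      using that h(2) by (auto simp: G_def T)
  qed (use A borel_T in auto)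
  also have "\<dots> = (\<integral>\<^sup>+y. ennreal \<bar>det (matrix (g' (?T' y)))\<bar> * indicator A (?T' y) \<partial>lborel)"
    unfolding det_G' image_T by (intro nn_integral_cong) (simp add: indicator_def)
  also have "\<dots> = (\<integral>\<^sup>+x. ennreal \<bar>det (matrix (g' x))\<bar> * indicator A x \<partial>distr lborel borel ?T')"
  proof -
    have "(\<lambda>x. det (matrix (g' x))) \<in> borel_measurable (restrict_space borel A)"
      by (intro borel_measurable_continuous_on_restrict continuous_on_subset[OF cont A(2)])
    then have "(\<lambda>x. ennreal \<bar>det (matrix (g' x))\<bar>) \<in> borel_measurable (restrict_space borel A)"
      by measurable
    then have "(\<lambda>x. ennreal \<bar>det (matrix (g' x))\<bar> * indicator A x) \<in> borel_measurable borel"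
      using A(1) by (subst (asm) borel_measurable_restrict_space_iff_ennreal) auto
    then show ?thesis
      using meas by (subst nn_integral_distr) auto
  qed
  also have "distr lborel borel ?T' = lborel"
    by (rule lborel_distr_reindex_vec[OF bij_imp_bij_inv[OF b]])
  also have "emeasure lborel (G ` ?T ` A) = emeasure lborel (g ` A)"
  proof -
    have "g ` A \<in> sets borel"
      by (rule borel_image_of_continuous_inverse[OF S(2) h A])
    then have "emeasure (distr lborel borel ?T') (g ` A) = emeasure lborel (?T' -` (g ` A))"
      using meas by (simp add: emeasure_distr)
    then show ?thesis
      unfolding GT lborel_distr_reindex_vec[OF bij_imp_bij_inv[OF b]] image_T[of "g ` A"] by simp
  qed
  finally show ?thesis .
qed

text \<open>The formula for sets says that Lebesgue measure on g \<open>S is the image under g of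
  the measure with density |det g'| on S. The rules for image measures and densities then give the
  integral formula. Everything is restricted to S and g\<close> S because g and w are under control
  only there.\<close>

lemma nn_integral_diffeomorphic_image:
  fixes g :: "real^'m \<Rightarrow> real^'m"
  assumes S: "open S" "open (g ` S)" and der: "\<And>x. x \<in> S \<Longrightarrow> (g has_derivative g' x) (at x)"
    and cont: "continuous_on S (\<lambda>x. det (matrix (g' x)))"
    and h: "continuous_on (g ` S) h" "\<And>x. x \<in> S \<Longrightarrow> h (g x) = x"
    and A: "A \<in> sets borel" "A \<subseteq> S" and w: "continuous_on (g ` S) w"
  shows "(\<integral>\<^sup>+y. ennreal (w y) * indicator (g ` A) y \<partial>lborel)
    = (\<integral>\<^sup>+x. ennreal \<bar>det (matrix (g' x))\<bar> * ennreal (w (g x)) * indicator A x \<partial>lborel)"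
proof -
  let ?d = "\<lambda>x. ennreal \<bar>det (matrix (g' x))\<bar>"
  let ?RS = "restrict_space lborel S" and ?RT = "restrict_space lborel (g ` S)"
  have Sb: "S \<in> sets borel" "g ` S \<in> sets borel" using S by auto
  have "continuous_on S g"
    using der has_derivative_continuous continuous_at_imp_continuous_on by blast
  then have "g \<in> borel_measurable (restrict_space borel S)"
    by (rule borel_measurable_continuous_on_restrict)
  then have g_meas: "g \<in> measurable ?RS ?RT"
    by (auto intro!: measurable_restrict_space2 simp: space_restrict_space
        cong: measurable_cong_sets sets_restrict_space_cong)
  have "(\<lambda>x. det (matrix (g' x))) \<in> borel_measurable (restrict_space borel S)"
    by (rule borel_measurable_continuous_on_restrict[OF cont])
  then have d_meas: "?d \<in> borel_measurable ?RS"
    by (simp cong: measurable_cong_sets sets_restrict_space_cong)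
  have "w \<in> borel_measurable (restrict_space borel (g ` S))"
    by (rule borel_measurable_continuous_on_restrict[OF w])
  then have w_meas: "(\<lambda>y. ennreal (w y)) \<in> borel_measurable ?RT"
    by (simp cong: measurable_cong_sets sets_restrict_space_cong)
  have gA: "g ` A \<in> sets borel"
    by (rule borel_image_of_continuous_inverse[OF S(2) h A])
  then have gA': "g ` A \<in> sets ?RT"
    using A(2) Sb by (subst sets_restrict_space_iff) auto
  have eq: "?RT = distr (density ?RS ?d) ?RT g"
  proof (rule measure_eqI)
    fix B assume "B \<in> sets ?RT"
    then have B: "B \<in> sets borel" "B \<subseteq> g ` S"
      using Sb by (auto simp: sets_restrict_space)
    have pre: "g -` B \<inter> S \<in> sets ?RS"
      using measurable_sets[OF g_meas \<open>B \<in> sets ?RT\<close>] by (simp add: space_restrict_space)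
    then have pre': "g -` B \<inter> S \<in> sets borel"
      using Sb by (auto simp: sets_restrict_space)
    have "g ` (g -` B \<inter> S) = B" using B(2) by auto
    then have "emeasure ?RT B = (\<integral>\<^sup>+x. ?d x * indicator (g -` B \<inter> S) x \<partial>lborel)"
      using emeasure_diffeomorphic_image[OF S der cont h pre'] B Sb
      by (simp add: emeasure_restrict_space)
    also have "\<dots> = (\<integral>\<^sup>+x. ?d x * indicator (g -` B \<inter> S) x \<partial>?RS)"
      using Sb by (subst nn_integral_restrict_space) (auto intro!: nn_integral_cong simp: indicator_def)
    also have "\<dots> = emeasure (density ?RS ?d) (g -` B \<inter> S)"
      by (rule emeasure_density[OF d_meas pre, symmetric])
    also have "\<dots> = emeasure (distr (density ?RS ?d) ?RT g) B"
      using g_meas \<open>B \<in> sets ?RT\<close> by (subst emeasure_distr) (auto simp: space_restrict_space)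
    finally show "emeasure ?RT B = emeasure (distr (density ?RS ?d) ?RT g) B" .
  qed simp
  have "(\<integral>\<^sup>+y. ennreal (w y) * indicator (g ` A) y \<partial>lborel) = (\<integral>\<^sup>+y. ennreal (w y) * indicator (g ` A) y \<partial>?RT)"
  proof -
    have "g x \<in> g ` S" if "x \<in> A" for x using that A(2) by blast
    then show ?thesis
      using Sb by (subst nn_integral_restrict_space) (auto intro!: nn_integral_cong simp: indicator_def)
  qed
  also have "\<dots> = (\<integral>\<^sup>+x. ennreal (w (g x)) * indicator (g ` A) (g x) \<partial>density ?RS ?d)"
    by (subst eq, rule nn_integral_distr) (use g_meas w_meas gA' in auto)
  also have "\<dots> = (\<integral>\<^sup>+x. ?d x * (ennreal (w (g x)) * indicator (g ` A) (g x)) \<partial>?RS)"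
    by (intro nn_integral_density d_meas borel_measurable_times_ennreal measurable_compose[OF g_meas w_meas]
        measurable_compose[OF g_meas borel_measurable_indicator[OF gA']])
  also have "\<dots> = (\<integral>\<^sup>+x. ?d x * (ennreal (w (g x)) * indicator (g ` A) (g x)) * indicator S x \<partial>lborel)"
    using Sb by (intro nn_integral_restrict_space) auto
  also have "\<dots> = (\<integral>\<^sup>+x. ?d x * ennreal (w (g x)) * indicator A x \<partial>lborel)"
  proof (intro nn_integral_cong)
    fix x
    have "x \<in> S \<Longrightarrow> g x \<in> g ` A \<longleftrightarrow> x \<in> A"
      using h(2) A(2) by (metis image_iff subsetD)
    then show "?d x * (ennreal (w (g x)) * indicator (g ` A) (g x)) * indicator S x
        = ?d x * ennreal (w (g x)) * indicator A x"
      using A(2) by (auto simp: indicator_def)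
  qed
  finally show ?thesis .
qed

section \<open>Charts and the volume measure\<close>

lemma continuous_on_det:
  fixes A :: "'a::topological_space \<Rightarrow> real^'n^'n"
  assumes "\<And>i j. continuous_on S (\<lambda>x. A x $ i $ j)"
  shows "continuous_on S (\<lambda>x. det (A x))"
  unfolding det_def by (intro continuous_intros assms)

text \<open>The segment from the identity to G consists of positive definite, hence invertible,
  matrices, so the determinant cannot change its sign along it.\<close>

lemma posdef_det_pos:
  fixes G :: "real^'n^'n"
  assumes "\<And>v. v \<noteq> 0 \<Longrightarrow> v \<bullet> (G *v v) > 0"
  shows "det G > 0"
proof (rule ccontr)
  assume neg: "\<not> det G > 0"
  define A where "A t = (1 - t) *\<^sub>R mat 1 + t *\<^sub>R G" for t :: real
  have "continuous_on {0..1} (\<lambda>t. det (A t))"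
    unfolding A_def by (intro continuous_on_det) (auto intro!: continuous_intros)
  moreover have "det (A 0) \<ge> 0" "det (A 1) \<le> 0"
    using neg by (auto simp: A_def)
  ultimately obtain t where t: "0 \<le> t" "t \<le> 1" "det (A t) = 0"
    using IVT2'[of "\<lambda>t. det (A t)" 1 0 0] by auto
  then have "\<not> invertible (A t)" by (simp add: invertible_det_nz)
  then obtain v where v: "v \<noteq> 0" "A t *v v = 0"
    unfolding invertible_left_inverse matrix_left_invertible_ker by blast
  have "v \<bullet> (A t *v v) = (1 - t) * (v \<bullet> v) + t * (v \<bullet> (G *v v))"
    unfolding A_def by (simp add: matrix_vector_mult_add_rdistrib scaleR_matrix_vector_assoc[symmetric] inner_add_right)
  moreover have "(1 - t) * (v \<bullet> v) \<ge> 0" "t * (v \<bullet> (G *v v)) \<ge> 0" "(v \<bullet> v) > 0" "v \<bullet> (G *v v) > 0"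
    using t v assms[of v] by auto
  moreover have "v \<bullet> (A t *v v) = 0" using v(2) by simp
  ultimately have "(1 - t) * (v \<bullet> v) = 0" "t * (v \<bullet> (G *v v)) = 0"
    by linarith+
  then show False
    using \<open>(v \<bullet> v) > 0\<close> \<open>v \<bullet> (G *v v) > 0\<close> by auto
qed

lemma smooth_manifoldD:
  assumes "smooth_manifold M"
  shows "Hausdorff_space (mtop M)" "c \<in> atlas M \<Longrightarrow> topological_chart (mtop M) c"
    "(\<Union>c\<in>atlas M. chart_dom c) = topspace (mtop M)"
    "c \<in> atlas M \<Longrightarrow> d \<in> atlas M \<Longrightarrow>
      times_cont_diff_on k (chart_map d \<circ> chart_inv c) (chart_map c ` (chart_dom c \<inter> chart_dom d))"
  using assms unfolding smooth_manifold_def smooth_on_def by auto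

lemma chart_inv_map: "p \<in> chart_dom c \<Longrightarrow> chart_inv c (chart_map c p) = p"
  if "smooth_manifold M" "c \<in> atlas M"
proof -
  assume "p \<in> chart_dom c"
  have "topological_chart (mtop M) c" using smooth_manifoldD(2) that by blast
  then have "inj_on (chart_map c) (chart_dom c)"
    unfolding topological_chart_def homeomorphic_eq_everything_map
    by (metis openin_subset topspace_subtopology_subset)
  then show ?thesis using \<open>p \<in> chart_dom c\<close> by (simp add: chart_inv_def)
qed

lemma chart_map_inv:
  assumes "x \<in> chart_img c"
  shows "chart_map c (chart_inv c x) = x" "chart_inv c x \<in> chart_dom c"
  using assms unfolding chart_img_def chart_inv_def
  by (auto intro: f_inv_into_f inv_into_into)

lemma chart_map_in_img: "p \<in> chart_dom c \<Longrightarrow> chart_map c p \<in> chart_img c"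
  by (simp add: chart_img_def)

lemma chart_image_eq:
  assumes "smooth_manifold M" "c \<in> atlas M"
  shows "chart_map c ` (U \<inter> chart_dom c) = {x \<in> chart_img c. chart_inv c x \<in> U}"
proof (intro set_eqI iffI)
  fix x assume "x \<in> {x \<in> chart_img c. chart_inv c x \<in> U}"
  then show "x \<in> chart_map c ` (U \<inter> chart_dom c)"
    using chart_map_inv[of x c] by (intro image_eqI[of _ _ "chart_inv c x"]) auto
qed (auto simp: chart_inv_map[OF assms] chart_map_in_img)

lemma chart_open:
  assumes "smooth_manifold M" "c \<in> atlas M"
  shows "openin (mtop M) (chart_dom c)" "open (chart_img c)" "chart_dom c \<subseteq> topspace (mtop M)"
  using smooth_manifoldD(2)[OF assms] openin_subset unfolding topological_chart_def by auto

lemma open_chart_image: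
  assumes "smooth_manifold M" "c \<in> atlas M" "openin (mtop M) U"
  shows "open (chart_map c ` (U \<inter> chart_dom c))"
proof -
  have "topological_chart (mtop M) c" using smooth_manifoldD(2) assms by blast
  then have "open_map (subtopology (mtop M) (chart_dom c)) (top_of_set (chart_img c)) (chart_map c)"
    unfolding topological_chart_def homeomorphic_eq_everything_map by blast
  moreover have "openin (subtopology (mtop M) (chart_dom c)) (U \<inter> chart_dom c)"
    using assms(3) by (auto simp: openin_subtopology)
  ultimately have "openin (top_of_set (chart_img c)) (chart_map c ` (U \<inter> chart_dom c))"
    unfolding open_map_def by blast
  then show ?thesis
    using chart_open(2)[OF assms(1,2)] openin_open_trans by blast
qed

lemma open_chart_inv_vimage:
  assumes "smooth_manifold M" "c \<in> atlas M" "openin (mtop M) U"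
  shows "open {x \<in> chart_img c. chart_inv c x \<in> U}"
  using open_chart_image[OF assms] unfolding chart_image_eq[OF assms(1,2)] .

lemma openin_chart_map_vimage:
  assumes "smooth_manifold M" "c \<in> atlas M" "open W"
  shows "openin (mtop M) {p \<in> chart_dom c. chart_map c p \<in> W}"
proof -
  have top: "topological_chart (mtop M) c" using smooth_manifoldD(2) assms by blast
  then have "continuous_map (subtopology (mtop M) (chart_dom c)) (top_of_set (chart_img c)) (chart_map c)"
    unfolding topological_chart_def homeomorphic_eq_everything_map by blast
  then have "continuous_map (subtopology (mtop M) (chart_dom c)) euclidean (chart_map c)"
    using continuous_map_into_fulltopology by blast
  then have "openin (subtopology (mtop M) (chart_dom c))
      {p \<in> topspace (subtopology (mtop M) (chart_dom c)). chart_map c p \<in> W}"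
    by (rule openin_continuous_map_preimage) (use assms(3) in simp)
  then have "openin (subtopology (mtop M) (chart_dom c)) {p \<in> chart_dom c. chart_map c p \<in> W}"
    using chart_open(3)[OF assms(1,2)] by (simp add: Int_absorb1)
  then show ?thesis
    using chart_open(1)[OF assms(1,2)] openin_trans_full by blast
qed

lemma continuous_map_chart_inv:
  assumes "smooth_manifold M" "c \<in> atlas M"
  shows "continuous_map (top_of_set (chart_img c)) (mtop M) (chart_inv c)"
  unfolding continuous_map_def
proof (intro conjI allI impI)
  show "chart_inv c \<in> topspace (top_of_set (chart_img c)) \<rightarrow> topspace (mtop M)"
    using chart_map_inv(2) chart_open(3)[OF assms] by fastforce
  fix U assume "openin (mtop M) U"
  then have "open {x \<in> chart_img c. chart_inv c x \<in> U}"
    by (rule open_chart_inv_vimage[OF assms])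
  then show "openin (top_of_set (chart_img c)) {x \<in> topspace (top_of_set (chart_img c)). chart_inv c x \<in> U}"
    by (auto intro: open_subset)
qed

lemma chart_at:
  assumes "smooth_manifold M" "p \<in> topspace (mtop M)"
  shows "chart_at M p \<in> atlas M" "p \<in> chart_dom (chart_at M p)"
proof -
  have "\<exists>c. c \<in> atlas M \<and> p \<in> chart_dom c"
    using smooth_manifoldD(3)[OF assms(1)] assms(2) by blast
  then have "chart_at M p \<in> atlas M \<and> p \<in> chart_dom (chart_at M p)"
    unfolding chart_at_def by (rule someI_ex)
  then show "chart_at M p \<in> atlas M" "p \<in> chart_dom (chart_at M p)" by auto
qed

lemma transition_has_derivative:
  assumes "smooth_manifold M" "c \<in> atlas M" "d \<in> atlas M" "p \<in> chart_dom c" "p \<in> chart_dom d"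
  shows "((chart_map d \<circ> chart_inv c) has_derivative
    ((*v) (jacobian (chart_map d \<circ> chart_inv c) (at (chart_map c p))))) (at (chart_map c p))"
proof -
  have "chart_map c p \<in> chart_map c ` (chart_dom c \<inter> chart_dom d)" using assms by auto
  from tcd_has_derivative[OF smooth_manifoldD(4)[OF assms(1-3), of "Suc 0"] this]
  show ?thesis
    unfolding jacobian_def by (simp add: matrix_vector_mul(2)[OF has_derivative_linear])
qed

lemma riemannian_metricD:
  assumes "riemannian_metric M g" "c \<in> atlas M"
  shows "times_cont_diff_on k (metric_rep g c) (chart_img c)"
    "p \<in> chart_dom c \<Longrightarrow> transpose (g c p) = g c p"
    "p \<in> chart_dom c \<Longrightarrow> v \<noteq> 0 \<Longrightarrow> v \<bullet> (g c p *v v) > 0"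
    "d \<in> atlas M \<Longrightarrow> p \<in> chart_dom c \<Longrightarrow> p \<in> chart_dom d \<Longrightarrow>
      g c p = transpose (jacobian (chart_map d \<circ> chart_inv c) (at (chart_map c p))) ** g d p **
        jacobian (chart_map d \<circ> chart_inv c) (at (chart_map c p))"
  using assms unfolding riemannian_metric_def smooth_on_def Let_def by blast+

lemma metric_det_pos:
  assumes "riemannian_metric M g" "c \<in> atlas M" "p \<in> chart_dom c"
  shows "det (g c p) > 0"
  using posdef_det_pos riemannian_metricD(3)[OF assms] by blast

lemma metric_rep_det_pos:
  assumes "riemannian_metric M g" "c \<in> atlas M" "x \<in> chart_img c"
  shows "det (metric_rep g c x) > 0"
  unfolding metric_rep_def by (rule metric_det_pos[OF assms(1,2) chart_map_inv(2)[OF assms(3)]])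

lemma tcd_det_metric:
  assumes "smooth_manifold M" "riemannian_metric M g" "c \<in> atlas M"
  shows "times_cont_diff_on k (\<lambda>x. det (metric_rep g c x)) (chart_img c)"
  using chart_open(2)[OF assms(1,3)]
  by (intro tcd_det tcd_vec_nth riemannian_metricD(1)[OF assms(2,3)])

lemma tcd_sqrt_det_metric:
  assumes "smooth_manifold M" "riemannian_metric M g" "c \<in> atlas M"
  shows "times_cont_diff_on k (\<lambda>x. sqrt (det (metric_rep g c x))) (chart_img c)"
  by (intro tcd_sqrt_compose tcd_det_metric[OF assms] chart_open(2)[OF assms(1,3)]
      metric_rep_det_pos[OF assms(2,3)])

section \<open>Existence, uniqueness and chart formula of the volume measure\<close>

definition borel_manifold :: "('a, 'm::finite) manifold \<Rightarrow> 'a measure" where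
  "borel_manifold M = sigma (topspace (mtop M)) {U. openin (mtop M) U}"

lemma space_borel_manifold: "space (borel_manifold M) = topspace (mtop M)"
  and sets_borel_manifold: "sets (borel_manifold M) = sigma_sets (topspace (mtop M)) {U. openin (mtop M) U}"
proof -
  have "{U. openin (mtop M) U} \<subseteq> Pow (topspace (mtop M))"
    using openin_subset by blast
  then show "space (borel_manifold M) = topspace (mtop M)"
    "sets (borel_manifold M) = sigma_sets (topspace (mtop M)) {U. openin (mtop M) U}"
    by (auto simp: borel_manifold_def)
qed

lemma openin_borel_manifold: "openin (mtop M) U \<Longrightarrow> U \<in> sets (borel_manifold M)"
  unfolding sets_borel_manifold by auto

lemma measurable_chart_inv:
  assumes "smooth_manifold M" "c \<in> atlas M"
  shows "chart_inv c \<in> measurable (restrict_space lborel (chart_img c)) (borel_manifold M)"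
  unfolding borel_manifold_def
proof (rule measurable_measure_of)
  show "{U. openin (mtop M) U} \<subseteq> Pow (topspace (mtop M))"
    using openin_subset by blast
  show "chart_inv c \<in> space (restrict_space lborel (chart_img c)) \<rightarrow> topspace (mtop M)"
    using chart_map_inv(2) chart_open(3)[OF assms] by (fastforce simp: space_restrict_space)
  fix U assume "U \<in> {U. openin (mtop M) U}"
  then have "open {x \<in> chart_img c. chart_inv c x \<in> U}"
    using open_chart_inv_vimage[OF assms] by blast
  moreover have "chart_inv c -` U \<inter> space (restrict_space lborel (chart_img c)) = {x \<in> chart_img c. chart_inv c x \<in> U}"
    by (auto simp: space_restrict_space)
  ultimately show "chart_inv c -` U \<inter> space (restrict_space lborel (chart_img c)) \<in> sets (restrict_space lborel (chart_img c))"
    using chart_open(2)[OF assms] by (auto simp: sets_restrict_space_iff)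
qed

lemma borel_chart_image:
  assumes "smooth_manifold M" "c \<in> atlas M" "B \<in> sets (borel_manifold M)"
  shows "chart_map c ` (B \<inter> chart_dom c) \<in> sets borel"
proof -
  have "chart_inv c -` B \<inter> space (restrict_space lborel (chart_img c)) \<in> sets (restrict_space lborel (chart_img c))"
    using measurable_chart_inv[OF assms(1,2)] assms(3) by (rule measurable_sets)
  moreover have "chart_inv c -` B \<inter> space (restrict_space lborel (chart_img c)) = chart_map c ` (B \<inter> chart_dom c)"
    unfolding chart_image_eq[OF assms(1,2)] by (auto simp: space_restrict_space)
  ultimately show ?thesis
    using chart_open(2)[OF assms(1,2)] by (auto simp: sets_restrict_space)
qed

text \<open>A measure on all of M that does not charge the complement of the chart domain; the
  measures of different charts thus live on one sigma-algebra and can be compared and added.\<close>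

definition chart_measure ::
  "('a, 'm::finite) manifold \<Rightarrow> ('a, 'm) metric \<Rightarrow> ('a, 'm) chart \<Rightarrow> 'a measure" where
  "chart_measure M g c = distr
     (density (restrict_space lborel (chart_img c)) (\<lambda>x. ennreal (sqrt (det (metric_rep g c x)))))
     (borel_manifold M) (chart_inv c)"

lemma sets_chart_measure: "sets (chart_measure M g c) = sets (borel_manifold M)"
  by (simp add: chart_measure_def)

context
  fixes M :: "('a, 'm::finite) manifold" and g :: "('a, 'm) metric"
  assumes M: "smooth_manifold M" and g: "riemannian_metric M g"
begin

lemma sqrt_det_measurable:
  assumes c: "c \<in> atlas M"
  shows "(\<lambda>x. sqrt (det (metric_rep g c x))) \<in> borel_measurable (restrict_space lborel (chart_img c))"
proof -
  have "(\<lambda>x. sqrt (det (metric_rep g c x))) \<in> borel_measurable (restrict_space borel (chart_img c))"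
    by (intro borel_measurable_continuous_on_restrict tcd_continuous_on[OF tcd_sqrt_det_metric[OF M g c]])
  then show ?thesis
    by (simp cong: measurable_cong_sets sets_restrict_space_cong)
qed

lemma emeasure_chart_measure:
  assumes c: "c \<in> atlas M" and B: "B \<in> sets (borel_manifold M)"
  shows "emeasure (chart_measure M g c) B =
    (\<integral>\<^sup>+x. ennreal (sqrt (det (metric_rep g c x))) * indicator (chart_map c ` (B \<inter> chart_dom c)) x \<partial>lborel)"
proof -
  let ?R = "restrict_space lborel (chart_img c)"
  have pre: "chart_inv c -` B \<inter> chart_img c \<in> sets ?R"
    using measurable_sets[OF measurable_chart_inv[OF M c] B] by (simp add: space_restrict_space)
  have "emeasure (chart_measure M g c) B = emeasure (density ?R (\<lambda>x. ennreal (sqrt (det (metric_rep g c x)))))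
      (chart_inv c -` B \<inter> chart_img c)"
    unfolding chart_measure_def using measurable_chart_inv[OF M c] B
    by (subst emeasure_distr) (auto simp: space_restrict_space)
  also have "\<dots> = (\<integral>\<^sup>+x. ennreal (sqrt (det (metric_rep g c x))) * indicator (chart_inv c -` B \<inter> chart_img c) x \<partial>?R)"
    using sqrt_det_measurable[OF c] pre by (intro emeasure_density) auto
  also have "\<dots> = (\<integral>\<^sup>+x. ennreal (sqrt (det (metric_rep g c x))) * indicator (chart_map c ` (B \<inter> chart_dom c)) x \<partial>lborel)"
    unfolding chart_image_eq[OF M c] using chart_open(2)[OF M c]
    by (subst nn_integral_restrict_space) (auto intro!: nn_integral_cong simp: indicator_def)
  finally show ?thesis .
qed

text \<open>The transformation law of g gives sqrt (det g_c) = |det J| sqrt (det g_d), and |det J|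
  is the factor in the change of variables from chart c to chart d.\<close>

lemma chart_measure_independent:
  assumes c: "c \<in> atlas M" and d: "d \<in> atlas M"
    and B: "B \<in> sets (borel_manifold M)" "B \<subseteq> chart_dom c" "B \<subseteq> chart_dom d"
  shows "emeasure (chart_measure M g c) B = emeasure (chart_measure M g d) B"
proof -
  define S where "S = chart_map c ` (chart_dom c \<inter> chart_dom d)"
  let ?G = "chart_map d \<circ> chart_inv c"
  have GS: "?G ` S = chart_map d ` (chart_dom c \<inter> chart_dom d)"
    unfolding S_def image_image o_def
    by (intro image_cong refl arg_cong[of _ _ "chart_map d"] chart_inv_map[OF M c]) auto
  have GB: "?G ` (chart_map c ` B) = chart_map d ` B"
    unfolding image_image o_def
    by (intro image_cong refl arg_cong[of _ _ "chart_map d"] chart_inv_map[OF M c] subsetD[OF B(2)])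
  have S: "open S" "open (?G ` S)"
    unfolding GS unfolding S_def
    using open_chart_image[OF M c chart_open(1)[OF M d]] open_chart_image[OF M d chart_open(1)[OF M c]]
    by (auto simp: Int_commute)
  have "chart_map d ` (chart_dom d \<inter> chart_dom c) \<subseteq> chart_img d"
    by (auto simp: chart_img_def)
  then have dS: "?G ` S \<subseteq> chart_img d" unfolding GS by (simp add: Int_commute)
  have der: "(?G has_derivative frechet_derivative ?G (at x)) (at x)" if "x \<in> S" for x
    using tcd_has_derivative[OF smooth_manifoldD(4)[OF M c d, of "Suc 0"]] that by (simp add: S_def)
  have lin: "linear (frechet_derivative ?G (at x))" if "x \<in> S" for x
    using has_derivative_linear[OF der[OF that]] .
  have cont: "continuous_on S (\<lambda>x. det (matrix (frechet_derivative ?G (at x))))"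
  proof -
    have "times_cont_diff_on 0 (\<lambda>x. frechet_derivative ?G (at x) v) S" for v
      using smooth_manifoldD(4)[OF M c d, of "Suc 0"] by (simp add: S_def)
    then show ?thesis
      by (intro continuous_on_det) (auto simp: matrix_def intro: continuous_intros)
  qed
  have "(\<integral>\<^sup>+y. ennreal (sqrt (det (metric_rep g d y))) * indicator (?G ` (chart_map c ` B)) y \<partial>lborel)
    = (\<integral>\<^sup>+x. ennreal \<bar>det (matrix (frechet_derivative ?G (at x)))\<bar> * ennreal (sqrt (det (metric_rep g d (?G x))))
        * indicator (chart_map c ` B) x \<partial>lborel)"
  proof (rule nn_integral_diffeomorphic_image[OF S der cont, where h = "chart_map c \<circ> chart_inv d"])
    show "continuous_on (?G ` S) (chart_map c \<circ> chart_inv d)"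
      using tcd_continuous_on[OF smooth_manifoldD(4)[OF M d c, of 0]]
      unfolding GS by (simp add: Int_commute)
    show "(chart_map c \<circ> chart_inv d) (?G x) = x" if "x \<in> S" for x
      using that by (auto simp: S_def chart_inv_map[OF M c] chart_inv_map[OF M d])
    show "chart_map c ` B \<in> sets borel"
      using borel_chart_image[OF M c B(1)] B(2) by (simp add: Int_absorb2)
    show "chart_map c ` B \<subseteq> S" using B by (auto simp: S_def)
    show "continuous_on (?G ` S) (\<lambda>y. sqrt (det (metric_rep g d y)))"
      by (rule continuous_on_subset[OF tcd_continuous_on[OF tcd_sqrt_det_metric[OF M g d, of 0]] dS])
  qed auto
  also have "\<dots> = (\<integral>\<^sup>+x. ennreal (sqrt (det (metric_rep g c x))) * indicator (chart_map c ` B) x \<partial>lborel)"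
  proof (intro nn_integral_cong)
    fix x
    show "ennreal \<bar>det (matrix (frechet_derivative ?G (at x)))\<bar> * ennreal (sqrt (det (metric_rep g d (?G x))))
        * indicator (chart_map c ` B) x = ennreal (sqrt (det (metric_rep g c x))) * indicator (chart_map c ` B) x"
    proof (cases "x \<in> chart_map c ` B")
      case True
      then obtain p where p: "p \<in> B" "x = chart_map c p" by auto
      then have pd: "p \<in> chart_dom c" "p \<in> chart_dom d" using B by auto
      define J where "J = jacobian ?G (at x)"
      have rep: "metric_rep g c x = g c p" "metric_rep g d (?G x) = g d p"
        using p pd by (auto simp: metric_rep_def chart_inv_map[OF M c] chart_inv_map[OF M d])
      have "det (g c p) = (det J)\<^sup>2 * det (g d p)"
        using riemannian_metricD(4)[OF g c d pd] p(2)
        by (simp add: J_def det_mul power2_eq_square)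
      then have "sqrt (det (g c p)) = \<bar>det J\<bar> * sqrt (det (g d p))"
        by (simp add: real_sqrt_mult)
      then show ?thesis
        unfolding rep using metric_det_pos[OF g d pd(2)]
        by (simp add: J_def jacobian_def ennreal_mult less_imp_le)
    qed simp
  qed
  finally have "(\<integral>\<^sup>+y. ennreal (sqrt (det (metric_rep g d y))) * indicator (chart_map d ` B) y \<partial>lborel)
    = (\<integral>\<^sup>+x. ennreal (sqrt (det (metric_rep g c x))) * indicator (chart_map c ` B) x \<partial>lborel)"
    unfolding GB .
  then show ?thesis
    using emeasure_chart_measure[OF c B(1)] emeasure_chart_measure[OF d B(1)] B
    by (simp add: Int_absorb2)
qed

text \<open>The property described in \<open>volume_measure\<close>, phrased through
  \<open>chart_measure\<close> so that additivity and set algebra can be used instead of explicit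
  integrals.\<close>

definition volume_spec :: "'a measure \<Rightarrow> bool" where
  "volume_spec \<mu> \<longleftrightarrow> sets \<mu> = sets (borel_manifold M) \<and>
     (\<forall>c\<in>atlas M. \<forall>B\<in>sets \<mu>. B \<subseteq> chart_dom c \<longrightarrow> emeasure \<mu> B = emeasure (chart_measure M g c) B)"

lemma volume_measure_eq_THE: "volume_measure M g = (THE \<mu>. volume_spec \<mu>)"
proof -
  have "volume_spec \<mu> \<longleftrightarrow> sets \<mu> = sets (sigma (topspace (mtop M)) {U. openin (mtop M) U}) \<and>
     (\<forall>c\<in>atlas M. \<forall>B\<in>sets \<mu>. B \<subseteq> chart_dom c \<longrightarrow>
        emeasure \<mu> B =
          (\<integral>\<^sup>+x. ennreal (sqrt (det (metric_rep g c x))) * indicator (chart_map c ` B) x \<partial>lborel))" for \<mu>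
    unfolding volume_spec_def borel_manifold_def[symmetric]
    by (auto simp: emeasure_chart_measure Int_absorb2)
  then show ?thesis
    unfolding volume_measure_def by simp
qed

text \<open>Cuts M into finitely many Borel pieces, each inside one chart: a measure prescribed on
  subsets of chart domains is then both constructed and determined piece by piece.\<close>

lemma chart_cover_disjointed:
  assumes "compact_space (mtop M)"
  obtains I :: "nat set" and C B where "finite I" "\<And>i. i \<in> I \<Longrightarrow> C i \<in> atlas M"
    "\<And>i. i \<in> I \<Longrightarrow> B i \<in> sets (borel_manifold M) \<and> B i \<subseteq> chart_dom (C i)"
    "disjoint_family_on B I" "(\<Union>i\<in>I. B i) = topspace (mtop M)"
proof -
  obtain F where F: "finite F" "F \<subseteq> chart_dom ` atlas M" "topspace (mtop M) \<subseteq> \<Union> F"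
    using assms[unfolded compact_space_alt, rule_format, of "chart_dom ` atlas M"]
      smooth_manifoldD(3)[OF M] chart_open(1)[OF M] by auto
  then have "\<Union> F = topspace (mtop M)"
    using chart_open(3)[OF M] by blast
  note F = F(1,2) this
  obtain D where D: "finite D" "D \<subseteq> atlas M" "F = chart_dom ` D"
    using F(1,2) by (meson finite_subset_image)
  obtain n :: nat and C where C: "D = C ` {i. i < n}"
    using D(1) finite_imp_nat_seg_image_inj_on by blast
  \<comment> \<open>\<open>disjointed\<close> works on sequences, so the finite family is continued
    by empty sets.\<close>
  define B where "B = disjointed (\<lambda>i. if i < n then chart_dom (C i) else {})"
  show thesis
  proof (rule that[of "{i. i < n}" C B])
    show "B i \<in> sets (borel_manifold M) \<and> B i \<subseteq> chart_dom (C i)" if "i \<in> {i. i < n}" for i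
    proof
      have "chart_dom (C j) \<in> sets (borel_manifold M)" if "j < n" for j
        by (intro openin_borel_manifold chart_open(1)[OF M]) (use D C that in blast)
      then have "range (\<lambda>i. if i < n then chart_dom (C i) else {}) \<subseteq> sets (borel_manifold M)"
        by auto
      then show "B i \<in> sets (borel_manifold M)"
        unfolding B_def using sets.range_disjointed_sets by blast
      show "B i \<subseteq> chart_dom (C i)"
        using that disjointed_subset[of "\<lambda>i. if i < n then chart_dom (C i) else {}" i]
        unfolding B_def by auto
    qed
    show "disjoint_family_on B {i. i < n}"
      unfolding B_def by (rule disjoint_family_on_mono[OF subset_UNIV disjoint_family_disjointed])
    have "B i = {}" if "\<not> i < n" for i
      using that disjointed_subset[of "\<lambda>i. if i < n then chart_dom (C i) else {}" i] unfolding B_def by auto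
    then have "(\<Union>i\<in>{i. i < n}. B i) = (\<Union>i. B i)" by auto
    also have "\<dots> = \<Union> F"
      unfolding B_def UN_disjointed_eq D(3) C by (auto simp: image_iff split: if_splits)
    finally show "(\<Union>i\<in>{i. i < n}. B i) = topspace (mtop M)" using F(3) by simp
  qed (use D C in auto)
qed

lemma emeasure_cover:
  assumes "finite I" "disjoint_family_on B I" "(\<Union>i\<in>I. B i) = topspace (mtop M)"
    "\<And>i. i \<in> I \<Longrightarrow> B i \<in> sets \<mu>" "sets \<mu> = sets (borel_manifold M)" "A \<in> sets \<mu>"
  shows "emeasure \<mu> A = (\<Sum>i\<in>I. emeasure \<mu> (A \<inter> B i))"
proof -
  have "A \<subseteq> topspace (mtop M)"
    using sets.sets_into_space[OF assms(6)] sets_eq_imp_space_eq[OF assms(5)] space_borel_manifold by metis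
  then have "A = (\<Union>i\<in>I. A \<inter> B i)" using assms(3) by auto
  moreover have "disjoint_family_on (\<lambda>i. A \<inter> B i) I"
    using assms(2) by (auto simp: disjoint_family_on_def)
  ultimately show ?thesis
    using sum_emeasure[of "\<lambda>i. A \<inter> B i" I \<mu>] assms(1,4,6) by (auto simp: image_subset_iff)
qed

text \<open>Existence: add up the chart measures of the pieces of a disjoint cover; independence of
  the chart yields the prescribed values in every chart. Uniqueness: the values on subsets of the
  pieces are prescribed, and additivity gives all others. Both are needed to unfold the definite
  description.\<close>

lemma volume_measure_spec:
  assumes "compact_space (mtop M)"
  shows "volume_spec (volume_measure M g)"
proof -
  obtain I :: "nat set" and C B where I: "finite I" "\<And>i. i \<in> I \<Longrightarrow> C i \<in> atlas M"
    and B: "\<And>i. i \<in> I \<Longrightarrow> B i \<in> sets (borel_manifold M) \<and> B i \<subseteq> chart_dom (C i)"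
    "disjoint_family_on B I" "(\<Union>i\<in>I. B i) = topspace (mtop M)"
    using chart_cover_disjointed[OF assms] by metis
  define m where "m A = (\<Sum>i\<in>I. emeasure (chart_measure M g (C i)) (A \<inter> B i))" for A
  define \<mu> where "\<mu> = measure_of (topspace (mtop M)) (sets (borel_manifold M)) m"
  have sa: "sigma_algebra (topspace (mtop M)) (sets (borel_manifold M))"
    using sets.sigma_algebra_axioms[of "borel_manifold M"] by (simp add: space_borel_manifold)
  have "countably_additive (sets (borel_manifold M)) m"
    unfolding countably_additive_def
  proof (intro allI impI)
    fix A :: "nat \<Rightarrow> 'a set"
    assume A: "range A \<subseteq> sets (borel_manifold M)" "disjoint_family A"
    have "(\<Sum>k. m (A k)) = (\<Sum>i\<in>I. \<Sum>k. emeasure (chart_measure M g (C i)) (A k \<inter> B i))"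
      unfolding m_def by (rule suminf_sum) (simp add: summableI)
    also have "\<dots> = (\<Sum>i\<in>I. emeasure (chart_measure M g (C i)) ((\<Union>k. A k) \<inter> B i))"
    proof (intro sum.cong refl)
      fix i assume i: "i \<in> I"
      have "(\<Sum>k. emeasure (chart_measure M g (C i)) (A k \<inter> B i))
          = emeasure (chart_measure M g (C i)) (\<Union>k. A k \<inter> B i)"
        using A B(1)[OF i] by (intro suminf_emeasure) (auto simp: sets_chart_measure disjoint_family_on_def)
      then show "(\<Sum>k. emeasure (chart_measure M g (C i)) (A k \<inter> B i))
          = emeasure (chart_measure M g (C i)) ((\<Union>k. A k) \<inter> B i)" by simp
    qed
    finally show "(\<Sum>k. m (A k)) = m (\<Union>k. A k)" by (simp add: m_def)
  qed
  then have em: "emeasure \<mu> A = m A" if "A \<in> sets (borel_manifold M)" for A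
    unfolding \<mu>_def using that sa
    by (intro emeasure_measure_of_sigma) (auto simp: positive_def m_def)
  have sets_\<mu>: "sets \<mu> = sets (borel_manifold M)"
    unfolding \<mu>_def using sigma_algebra.sets_measure_of_eq[OF sa] by simp
  have spec: "volume_spec \<mu>"
    unfolding volume_spec_def
  proof (intro conjI ballI impI sets_\<mu>)
    fix c A assume c: "c \<in> atlas M" and A: "A \<in> sets \<mu>" "A \<subseteq> chart_dom c"
    have "emeasure \<mu> A = (\<Sum>i\<in>I. emeasure (chart_measure M g (C i)) (A \<inter> B i))"
      using em A sets_\<mu> by (simp add: m_def)
    also have "\<dots> = (\<Sum>i\<in>I. emeasure (chart_measure M g c) (A \<inter> B i))"
      using A B I sets_\<mu> c by (intro sum.cong refl chart_measure_independent) auto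
    also have "\<dots> = emeasure (chart_measure M g c) A"
      using emeasure_cover[OF I(1) B(2,3), of "chart_measure M g c" A] A B sets_\<mu>
      by (simp add: sets_chart_measure)
    finally show "emeasure \<mu> A = emeasure (chart_measure M g c) A" .
  qed
  have unique: "\<nu> = \<mu>" if "volume_spec \<nu>" for \<nu>
  proof (rule measure_eqI)
    show sets_eq: "sets \<nu> = sets \<mu>" using that sets_\<mu> by (simp add: volume_spec_def)
    fix A assume A: "A \<in> sets \<nu>"
    have "emeasure \<nu> (A \<inter> B i) = emeasure \<mu> (A \<inter> B i)" if "i \<in> I" for i
      using spec \<open>volume_spec \<nu>\<close> I(2)[OF that] B(1)[OF that] A sets_\<mu> sets_eq
      unfolding volume_spec_def by (metis inf.coboundedI2 sets.Int)
    moreover have "B i \<in> sets \<nu>" "B i \<in> sets \<mu>" if "i \<in> I" for i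
      using B(1)[OF that] sets_\<mu> sets_eq by auto
    ultimately show "emeasure \<nu> A = emeasure \<mu> A"
      using emeasure_cover[OF I(1) B(2,3), of \<nu> A] emeasure_cover[OF I(1) B(2,3), of \<mu> A] A sets_\<mu> sets_eq
      by auto
  qed
  show ?thesis
    unfolding volume_measure_eq_THE by (rule theI[of volume_spec, OF spec unique])
qed

lemma density_volume_measure:
  assumes "compact_space (mtop M)" and c: "c \<in> atlas M"
  shows "density (volume_measure M g) (indicator (chart_dom c)) = chart_measure M g c"
proof (rule measure_eqI)
  let ?\<mu> = "volume_measure M g"
  have spec: "sets ?\<mu> = sets (borel_manifold M)"
    "\<And>B. B \<in> sets ?\<mu> \<Longrightarrow> B \<subseteq> chart_dom c \<Longrightarrow> emeasure ?\<mu> B = emeasure (chart_measure M g c) B"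
    using volume_measure_spec[OF assms(1)] c unfolding volume_spec_def by auto
  show "sets (density ?\<mu> (indicator (chart_dom c))) = sets (chart_measure M g c)"
    using spec(1) by (simp add: sets_chart_measure)
  have dom: "chart_dom c \<in> sets ?\<mu>"
    using openin_borel_manifold[OF chart_open(1)[OF M c]] spec(1) by simp
  fix B assume "B \<in> sets (density ?\<mu> (indicator (chart_dom c)))"
  then have B: "B \<in> sets ?\<mu>" by simp
  have "emeasure (density ?\<mu> (indicator (chart_dom c))) B = emeasure ?\<mu> (B \<inter> chart_dom c)"
    using B dom by (subst emeasure_density) (auto simp: indicator_inter_arith[symmetric] Int_commute)
  also have "\<dots> = emeasure (chart_measure M g c) (B \<inter> chart_dom c)"
    using B dom by (intro spec(2)) auto
  also have "\<dots> = emeasure (chart_measure M g c) B"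
    using B dom spec(1) by (simp add: emeasure_chart_measure[OF c] Int_assoc)
  finally show "emeasure (density ?\<mu> (indicator (chart_dom c))) B = emeasure (chart_measure M g c) B" .
qed

text \<open>For a function that vanishes off one chart domain the volume may be replaced by
  \<open>chart_measure\<close>, hence by Lebesgue measure with a density. A partition of unity
  reduces all integrals over M to this case.\<close>

lemma volume_measure_chart_integral:
  fixes F :: "'a \<Rightarrow> real"
  assumes "compact_space (mtop M)" and c: "c \<in> atlas M"
    and F: "F \<in> borel_measurable (borel_manifold M)" "\<And>p. p \<notin> chart_dom c \<Longrightarrow> F p = 0"
  shows "(LINT p|volume_measure M g. F p) =
      (LINT x|lborel. indicator (chart_img c) x * (sqrt (det (metric_rep g c x)) * F (chart_inv c x)))"
    "integrable (volume_measure M g) F \<longleftrightarrow>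
      integrable lborel (\<lambda>x. indicator (chart_img c) x * (sqrt (det (metric_rep g c x)) * F (chart_inv c x)))"
proof -
  let ?\<mu> = "volume_measure M g" and ?R = "restrict_space lborel (chart_img c)"
    and ?w = "\<lambda>x. sqrt (det (metric_rep g c x))"
  have sets_\<mu>: "sets ?\<mu> = sets (borel_manifold M)"
    using volume_measure_spec[OF assms(1)] unfolding volume_spec_def by auto
  have F\<mu>: "F \<in> borel_measurable ?\<mu>"
    using F(1) sets_\<mu> by (simp cong: measurable_cong_sets)
  have dom: "chart_dom c \<in> sets ?\<mu>"
    using openin_borel_manifold[OF chart_open(1)[OF M c]] sets_\<mu> by simp
  have ind: "(\<lambda>p. indicator (chart_dom c) p *\<^sub>R F p) = F"
    by (rule ext) (use F(2) in \<open>auto simp: indicator_def\<close>)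
  have dens: "density ?\<mu> (\<lambda>p. ennreal (indicator (chart_dom c) p)) = chart_measure M g c"
    using density_volume_measure[OF assms(1) c] by (simp add: ennreal_indicator)
  have img: "chart_img c \<inter> space lborel \<in> sets lborel"
    using chart_open(2)[OF M c] by simp
  have Fc: "(\<lambda>x. F (chart_inv c x)) \<in> borel_measurable ?R"
    using measurable_compose[OF measurable_chart_inv[OF M c] F(1)] .
  note w = sqrt_det_measurable[OF c]
  have nonneg: "AE x in ?R. 0 \<le> ?w x"
    using metric_rep_det_pos[OF g c] by (intro AE_I2) (auto simp: space_restrict_space less_imp_le)
  have meas: "chart_inv c \<in> measurable (density ?R (\<lambda>x. ennreal (?w x))) (borel_manifold M)"
    using measurable_chart_inv[OF M c] by simp
  have "(LINT p|?\<mu>. F p) = (LINT p|chart_measure M g c. F p)"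
    unfolding dens[symmetric] using dom F\<mu> by (subst integral_density) (auto simp: ind[unfolded real_scaleR_def])
  also have "\<dots> = (LINT x|density ?R (\<lambda>x. ennreal (?w x)). F (chart_inv c x))"
    unfolding chart_measure_def by (rule integral_distr[OF meas F(1)])
  also have "\<dots> = (LINT x|?R. ?w x *\<^sub>R F (chart_inv c x))"
    by (rule integral_density[OF Fc w nonneg])
  also have "\<dots> = (LINT x|lborel. indicator (chart_img c) x *\<^sub>R (?w x *\<^sub>R F (chart_inv c x)))"
    by (rule integral_restrict_space[OF img])
  finally show "(LINT p|?\<mu>. F p) = (LINT x|lborel. indicator (chart_img c) x * (?w x * F (chart_inv c x)))"
    by simp
  have "integrable ?\<mu> F \<longleftrightarrow> integrable (chart_measure M g c) F"
    unfolding dens[symmetric] using dom F\<mu> by (subst integrable_density) (auto simp: ind[unfolded real_scaleR_def])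
  also have "\<dots> \<longleftrightarrow> integrable (density ?R (\<lambda>x. ennreal (?w x))) (\<lambda>x. F (chart_inv c x))"
    unfolding chart_measure_def by (rule integrable_distr_eq[OF meas F(1)])
  also have "\<dots> \<longleftrightarrow> integrable ?R (\<lambda>x. ?w x *\<^sub>R F (chart_inv c x))"
    by (rule integrable_density[OF Fc w nonneg])
  also have "\<dots> \<longleftrightarrow> integrable lborel (\<lambda>x. indicator (chart_img c) x *\<^sub>R (?w x *\<^sub>R F (chart_inv c x)))"
    by (rule integrable_restrict_space[OF img])
  finally show "integrable ?\<mu> F \<longleftrightarrow> integrable lborel (\<lambda>x. indicator (chart_img c) x * (?w x * F (chart_inv c x)))"
    by simp
qed

end

section \<open>Coordinate representations of maps and variations\<close>

text \<open>Time and position are joined in one argument, so that derivatives in t and x are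
  iterated derivatives of a single map and their order can be exchanged.\<close>

definition var_rep ::
  "('a, 'm::finite) chart \<Rightarrow> ('b, 'n::finite) chart \<Rightarrow> (real \<Rightarrow> 'a \<Rightarrow> 'b) \<Rightarrow> real \<times> (real^'m) \<Rightarrow> real^'n" where
  "var_rep c d \<Psi> = (\<lambda>(t, x). map_rep c d (\<Psi> t) x)"

definition var_dom ::
  "real \<Rightarrow> ('a, 'm::finite) chart \<Rightarrow> ('b, 'n::finite) chart \<Rightarrow> (real \<Rightarrow> 'a \<Rightarrow> 'b) \<Rightarrow> (real \<times> (real^'m)) set" where
  "var_dom \<epsilon> c d \<Psi> = {(t, x). t \<in> {-\<epsilon><..<\<epsilon>} \<and> x \<in> chart_img c \<and> \<Psi> t (chart_inv c x) \<in> chart_dom d}"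

definition map_dom ::
  "('a, 'm::finite) chart \<Rightarrow> ('b, 'n::finite) chart \<Rightarrow> ('a \<Rightarrow> 'b) \<Rightarrow> (real^'m) set" where
  "map_dom c d \<phi> = {x \<in> chart_img c. \<phi> (chart_inv c x) \<in> chart_dom d}"

lemma tcd_frechet_derivative:
  "times_cont_diff_on (Suc k) f S \<Longrightarrow> times_cont_diff_on k (\<lambda>x. frechet_derivative f (at x) v) S"
  by (simp only: times_cont_diff_on.simps)

lemma has_derivative_Pair_right: "((\<lambda>x. (t, x)) has_derivative (\<lambda>v. (0, v))) (at x)"
  by (auto intro!: derivative_eq_intros)

lemma has_derivative_Pair_left: "((\<lambda>t. (t, x)) has_derivative (\<lambda>s. (s, 0))) (at t)"
  by (auto intro!: derivative_eq_intros)

lemma column_matrix: "column i (matrix f) = f (axis i 1)" for f :: "real^'m \<Rightarrow> real^'n"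
  by (simp add: column_def matrix_def vec_eq_iff)

lemma matrix_eq_of_mult: "(\<And>v. A *v v = B *v v) \<Longrightarrow> A = B" for A B :: "real^'m^'n"
  by (simp add: matrix_eq)

lemma jacobian_cong_open:
  assumes "open S" "x \<in> S" "\<And>y. y \<in> S \<Longrightarrow> f y = g y"
  shows "jacobian f (at x) = jacobian g (at x)"
  using frechet_derivative_cong_open[of S x f g] assms by (simp add: jacobian_def)

section \<open>Nonnegativity of the Hilbert-Schmidt norm\<close>

text \<open>If B_kk = 0, then on the line e_i + s e_k the quadratic form is affine in s with slope 2
  B_ik, so nonnegativity forces the slope to vanish.\<close>

lemma psd_quadratic_zero_row:
  fixes B :: "real^'m^'m"
  assumes sym: "transpose B = B" and psd: "\<And>v. v \<bullet> (B *v v) \<ge> 0" and k: "B $ k $ k = 0"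
  shows "B $ i $ k = 0"
proof (rule ccontr)
  assume ne: "B $ i $ k \<noteq> 0"
  have "B $ k $ i = B $ i $ k"
    using arg_cong[OF sym, of "\<lambda>X. X $ i $ k"] by (simp add: transpose_def)
  then have "(axis i 1 + s *\<^sub>R axis k 1) \<bullet> (B *v (axis i 1 + s *\<^sub>R axis k 1)) = B $ i $ i + 2 * s * B $ i $ k" for s
    using k by (simp add: matrix_vector_right_distrib matrix_vector_mult_scaleR matrix_vector_mult_basis
        inner_add_left inner_add_right inner_axis' column_def algebra_simps)
  \<comment> \<open>At this value of s the form would be -1.\<close>
  from psd[of "axis i 1 + (- (B $ i $ i + 1) / (2 * B $ i $ k)) *\<^sub>R axis k 1", unfolded this]
  show False using ne by (simp add: field_simps)
qed

text \<open>Symmetric Gaussian elimination: subtracting a rank one matrix clears the row and column of a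
  nonzero diagonal entry and preserves semidefiniteness.\<close>

lemma psd_contraction_nonneg:
  fixes B :: "real^'m^'m" and P :: "'m \<Rightarrow> 'm \<Rightarrow> real"
  assumes "transpose B = B" "\<And>v. v \<bullet> (B *v v) \<ge> 0"
    and P: "\<And>b :: 'm \<Rightarrow> real. (\<Sum>i\<in>UNIV. \<Sum>j\<in>UNIV. b i * b j * P i j) \<ge> 0"
  shows "(\<Sum>i\<in>UNIV. \<Sum>j\<in>UNIV. B $ i $ j * P i j) \<ge> 0"
  using assms(1,2)
proof (induction "card {k. B $ k $ k \<noteq> 0}" arbitrary: B rule: less_induct)
  case less
  have sym: "B $ i $ j = B $ j $ i" for i j
    using arg_cong[OF less.prems(1), of "\<lambda>X. X $ j $ i"] by (simp add: transpose_def)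
  show ?case
  proof (cases "\<exists>k. B $ k $ k \<noteq> 0")
    case False
    then have "B $ i $ j = 0" for i j
      using psd_quadratic_zero_row[OF less.prems] by blast
    then show ?thesis by simp
  next
    case True
    then obtain k where k: "B $ k $ k \<noteq> 0" by blast
    have "axis k 1 \<bullet> (B *v axis k 1) = B $ k $ k"
      by (simp add: matrix_vector_mult_basis inner_axis' column_def)
    then have kpos: "B $ k $ k > 0" using k less.prems(2)[of "axis k 1"] by simp
    \<comment> \<open>The rank one step keeps zero diagonal entries at zero and clears entry k, so
      the number of nonzero diagonal entries drops.\<close>
    define C where "C = (\<chi> i j. B $ i $ j - B $ i $ k * B $ j $ k / B $ k $ k)"
    have "(\<Sum>i\<in>UNIV. \<Sum>j\<in>UNIV. C $ i $ j * P i j) \<ge> 0"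
    proof (rule less.hyps)
      have "C $ i $ i = 0" if "B $ i $ i = 0" for i
        using psd_quadratic_zero_row[OF less.prems that, of k] that by (simp add: C_def sym[of i k])
      moreover have "C $ k $ k = 0" using k by (simp add: C_def)
      ultimately have "{i. C $ i $ i \<noteq> 0} \<subset> {i. B $ i $ i \<noteq> 0}" using k by blast
      then show "card {i. C $ i $ i \<noteq> 0} < card {i. B $ i $ i \<noteq> 0}"
        by (intro psubset_card_mono) auto
      show "transpose C = C"
        by (simp add: transpose_def C_def vec_eq_iff sym mult.commute)
      fix v :: "real^'m"
      \<comment> \<open>Completing the square: the form of C at v is the form of B at v - (\<beta> /
        B_kk) e_k.\<close>
      define \<beta> where "\<beta> = (B *v v) $ k"
      have Bk: "(\<Sum>j\<in>UNIV. B $ j $ k * v $ j) = \<beta>"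
        by (simp add: \<beta>_def matrix_vector_mult_def sym[of k])
      have "(C *v v) $ i = (B *v v) $ i - \<beta> / B $ k $ k * B $ i $ k" for i
      proof -
        have "(C *v v) $ i = (\<Sum>j\<in>UNIV. B $ i $ j * v $ j) - (B $ i $ k / B $ k $ k) * (\<Sum>j\<in>UNIV. B $ j $ k * v $ j)"
          by (simp add: C_def matrix_vector_mult_def left_diff_distrib sum_subtractf sum_distrib_left mult.assoc)
        then show ?thesis
          unfolding Bk by (simp add: matrix_vector_mult_def)
      qed
      then have "v \<bullet> (C *v v) = v \<bullet> (B *v v) - \<beta> / B $ k $ k * (\<Sum>i\<in>UNIV. B $ i $ k * v $ i)"
        by (simp add: inner_vec_def right_diff_distrib sum_subtractf sum_distrib_left mult.commute mult.left_commute)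
      also have "\<dots> = v \<bullet> (B *v v) - \<beta>\<^sup>2 / B $ k $ k"
        by (simp add: Bk power2_eq_square)
      also have "\<dots> = (v - (\<beta> / B $ k $ k) *\<^sub>R axis k 1) \<bullet> (B *v (v - (\<beta> / B $ k $ k) *\<^sub>R axis k 1))"
      proof -
        have "v \<bullet> column k B = \<beta>"
          using Bk by (simp add: inner_vec_def column_def mult.commute)
        then show ?thesis
          using k by (simp add: matrix_vector_mult_diff_distrib matrix_vector_mult_scaleR matrix_vector_mult_basis
              inner_diff_left inner_diff_right inner_axis' \<beta>_def[symmetric] column_def[of k B, THEN arg_cong[of _ _ "\<lambda>x. x $ k"], simplified]
              power2_eq_square)
      qed
      also have "\<dots> \<ge> 0" by (rule less.prems(2))
      finally show "v \<bullet> (C *v v) \<ge> 0" .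
    qed
    moreover have "(\<Sum>i\<in>UNIV. \<Sum>j\<in>UNIV. B $ i $ j * P i j) = (\<Sum>i\<in>UNIV. \<Sum>j\<in>UNIV. C $ i $ j * P i j)
        + (\<Sum>i\<in>UNIV. \<Sum>j\<in>UNIV. B $ i $ k * B $ j $ k * P i j) / B $ k $ k"
      unfolding sum_divide_distrib sum.distrib[symmetric]
      by (intro sum.cong refl) (simp add: C_def left_diff_distrib)
    moreover have "(\<Sum>i\<in>UNIV. \<Sum>j\<in>UNIV. B $ i $ k * B $ j $ k * P i j) / B $ k $ k \<ge> 0"
      using P[of "\<lambda>i. B $ i $ k"] kpos by simp
    ultimately show ?thesis by simp
  qed
qed

lemma transpose_matrix_inv:
  fixes G :: "real^'m^'m"
  assumes "invertible G" "transpose G = G"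
  shows "transpose (matrix_inv G) = matrix_inv G"
proof -
  have "G ** transpose (matrix_inv G) = transpose (matrix_inv G ** G)"
    by (simp add: matrix_transpose_mul assms(2))
  then have "G ** transpose (matrix_inv G) = mat 1"
    by (simp add: matrix_inv_left_right(2)[OF assms(1)] transpose_mat)
  from matrix_inv_eqI[OF this] show ?thesis by simp
qed

text \<open>Both the inverse of G and the Gram matrix of the columns of A with respect to H are
  positive semidefinite, and the contraction of two such matrices is nonnegative. This keeps the
  base 1 + |d\<psi>|^2 of the power positive.\<close>

lemma hs_inner_nonneg:
  fixes G :: "real^'m^'m" and H :: "real^'n^'n"
  assumes G: "\<And>v. v \<noteq> 0 \<Longrightarrow> v \<bullet> (G *v v) > 0" and H: "\<And>v. v \<noteq> 0 \<Longrightarrow> v \<bullet> (H *v v) > 0"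
    and sym: "transpose G = G"
  shows "hs_inner G H A A \<ge> 0"
  unfolding hs_inner_def
proof (rule psd_contraction_nonneg)
  have inv: "invertible G"
    using posdef_det_pos[OF G] by (simp add: invertible_det_nz)
  show "transpose (matrix_inv G) = matrix_inv G"
    by (rule transpose_matrix_inv[OF inv sym])
  have G': "v \<bullet> (G *v v) \<ge> 0" for v using G[of v] by (cases "v = 0") (auto simp: less_imp_le)
  have H': "v \<bullet> (H *v v) \<ge> 0" for v using H[of v] by (cases "v = 0") (auto simp: less_imp_le)
  show "v \<bullet> (matrix_inv G *v v) \<ge> 0" for v
  proof -
    have "G *v (matrix_inv G *v v) = v"
      by (simp only: matrix_vector_mul_assoc matrix_inv_left_right(1)[OF inv] matrix_vector_mul_lid)
    then show ?thesis
      using G'[of "matrix_inv G *v v"] by (simp add: inner_commute)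
  qed
  fix b :: "'m \<Rightarrow> real"
  have "(\<Sum>i\<in>UNIV. b i *\<^sub>R column i A) \<bullet> (H *v (\<Sum>j\<in>UNIV. b j *\<^sub>R column j A))
      = (\<Sum>i\<in>UNIV. \<Sum>j\<in>UNIV. b i * b j * (column i A \<bullet> (H *v column j A)))"
    by (simp add: linear_sum[OF matrix_vector_mul_linear] matrix_vector_mult_scaleR inner_sum_left inner_sum_right
        sum_distrib_left mult.assoc)
      (subst sum.swap, simp add: mult.left_commute)
  then show "(\<Sum>i\<in>UNIV. \<Sum>j\<in>UNIV. b i * b j * (column i A \<bullet> (H *v column j A))) \<ge> 0"
    using H'[of "\<Sum>i\<in>UNIV. b i *\<^sub>R column i A"] by simp
qed

section \<open>Coordinate domains, transition rules and the energy density\<close>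

context
  fixes M :: "('a, 'm::finite) manifold"
  assumes M: "smooth_manifold M"
begin

lemma map_dom_image:
  assumes "c \<in> atlas M"
  shows "chart_map c ` {p \<in> chart_dom c. \<phi> p \<in> chart_dom d} = map_dom c d \<phi>"
proof -
  have "{p \<in> chart_dom c. \<phi> p \<in> chart_dom d} = {p. \<phi> p \<in> chart_dom d} \<inter> chart_dom c" by auto
  then show ?thesis
    using chart_image_eq[OF M assms, of "{p. \<phi> p \<in> chart_dom d}"] by (simp add: map_dom_def)
qed

lemma map_dom_memI:
  assumes "c \<in> atlas M" "p \<in> chart_dom c" "\<phi> p \<in> chart_dom d"
  shows "chart_map c p \<in> map_dom c d \<phi>"
  using assms by (auto simp: map_dom_def chart_map_in_img chart_inv_map[OF M])

lemma jacobian_identity: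
  assumes c: "c \<in> atlas M" and p: "p \<in> chart_dom c"
  shows "jacobian (chart_map c \<circ> chart_inv c) (at (chart_map c p)) = mat 1"
proof -
  have "jacobian (chart_map c \<circ> chart_inv c) (at (chart_map c p)) = jacobian (\<lambda>x. x) (at (chart_map c p))"
    by (rule jacobian_cong_open[OF chart_open(2)[OF M c] chart_map_in_img[OF p]])
      (simp add: chart_map_inv)
  then show ?thesis
    by (simp add: jacobian_def frechet_derivative_ident matrix_id_mat_1[unfolded id_def])
qed

lemma jacobian_transition_invertible:
  assumes c: "c \<in> atlas M" "c' \<in> atlas M" and p: "p \<in> chart_dom c" "p \<in> chart_dom c'"
  shows "invertible (jacobian (chart_map c' \<circ> chart_inv c) (at (chart_map c p)))"
proof -
  let ?J = "jacobian (chart_map c' \<circ> chart_inv c) (at (chart_map c p))"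
    and ?J' = "jacobian (chart_map c \<circ> chart_inv c') (at (chart_map c' p))"
  have cp: "(chart_map c' \<circ> chart_inv c) (chart_map c p) = chart_map c' p"
    using p by (simp add: chart_inv_map[OF M c(1)])
  have "((\<lambda>x. (chart_map c \<circ> chart_inv c') ((chart_map c' \<circ> chart_inv c) x)) has_derivative (\<lambda>v. ?J' *v (?J *v v)))
      (at (chart_map c p))"
    by (rule has_derivative_compose[OF transition_has_derivative[OF M c p]])
      (unfold cp, rule transition_has_derivative[OF M c(2,1) p(2,1)])
  moreover have "((\<lambda>x. (chart_map c \<circ> chart_inv c') ((chart_map c' \<circ> chart_inv c) x)) has_derivative (\<lambda>v. v))
      (at (chart_map c p))"
    by (rule has_derivative_transform_within_open[OF has_derivative_ident
          open_chart_inv_vimage[OF M c(1) chart_open(1)[OF M c(2)]]])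
      (use p in \<open>auto simp: chart_map_in_img chart_inv_map[OF M c(1)] chart_inv_map[OF M c(2)] chart_map_inv\<close>)
  ultimately have "(\<lambda>v. ?J' *v (?J *v v)) = (\<lambda>v. v)"
    by (rule has_derivative_unique)
  then have "?J' ** ?J = mat 1"
    by (intro matrix_eq_of_mult) (simp add: matrix_vector_mul_assoc[symmetric] fun_eq_iff)
  then show ?thesis
    using invertible_left_inverse by blast
qed

lemma var_dom_image:
  assumes "c \<in> atlas M"
  shows "{(t, chart_map c p) |t p. t \<in> {-\<epsilon><..<\<epsilon>} \<and> p \<in> chart_dom c \<and> \<Psi> t p \<in> chart_dom d} = var_dom \<epsilon> c d \<Psi>"
proof (intro set_eqI iffI)
  fix z assume "z \<in> var_dom \<epsilon> c d \<Psi>"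
  then obtain t x where z: "z = (t, x)" "t \<in> {-\<epsilon><..<\<epsilon>}" "x \<in> chart_img c" "\<Psi> t (chart_inv c x) \<in> chart_dom d"
    by (auto simp: var_dom_def)
  then have "z = (t, chart_map c (chart_inv c x)) \<and> t \<in> {-\<epsilon><..<\<epsilon>} \<and> chart_inv c x \<in> chart_dom c \<and> \<Psi> t (chart_inv c x) \<in> chart_dom d"
    using chart_map_inv[of x c] by simp
  then show "z \<in> {(t, chart_map c p) |t p. t \<in> {-\<epsilon><..<\<epsilon>} \<and> p \<in> chart_dom c \<and> \<Psi> t p \<in> chart_dom d}"
    by blast
qed (auto simp: var_dom_def chart_map_in_img chart_inv_map[OF M assms])

end

context
  fixes M :: "('a, 'm::finite) manifold" and N :: "('b, 'n::finite) manifold"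
  assumes M: "smooth_manifold M" and N: "smooth_manifold N"
begin

lemma tcd_map_rep:
  assumes "smooth_map M N \<phi>" "c \<in> atlas M" "d \<in> atlas N"
  shows "times_cont_diff_on k (map_rep c d \<phi>) (map_dom c d \<phi>)"
  using assms unfolding smooth_map_def smooth_on_def map_dom_image[OF M assms(2), symmetric] by blast

lemma open_map_dom:
  assumes "smooth_map M N \<phi>" "c \<in> atlas M" "d \<in> atlas N"
  shows "open (map_dom c d \<phi>)"
proof -
  have "openin (mtop M) {p \<in> topspace (mtop M). \<phi> p \<in> chart_dom d}"
    using assms chart_open(1)[OF N assms(3)] unfolding smooth_map_def
    by (intro openin_continuous_map_preimage) auto
  note open_chart_inv_vimage[OF M assms(2) this]
  moreover have "{x \<in> chart_img c. chart_inv c x \<in> {p \<in> topspace (mtop M). \<phi> p \<in> chart_dom d}} = map_dom c d \<phi>"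
    using chart_map_inv(2) chart_open(3)[OF M assms(2)] by (fastforce simp: map_dom_def)
  ultimately show ?thesis by simp
qed

lemma map_rep_has_derivative:
  assumes "smooth_map M N \<phi>" "c \<in> atlas M" "d \<in> atlas N" "p \<in> chart_dom c" "\<phi> p \<in> chart_dom d"
  shows "(map_rep c d \<phi> has_derivative
    ((*v) (jacobian (map_rep c d \<phi>) (at (chart_map c p))))) (at (chart_map c p))"
  using tcd_has_derivative[OF tcd_map_rep[OF assms(1-3), of "Suc 0"] map_dom_memI[OF M, of c p \<phi> d]] assms
  unfolding jacobian_def by (simp add: matrix_vector_mul(2)[OF has_derivative_linear])

text \<open>The chain rule applied to two factorizations of the same local map; this is the
  intertwining hypothesis of \<open>hs_inner_invariant\<close>.\<close>

lemma map_rep_jacobian_transition: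
  assumes \<phi>: "smooth_map M N \<phi>" and c: "c \<in> atlas M" "c' \<in> atlas M" and d: "d \<in> atlas N" "d' \<in> atlas N"
    and p: "p \<in> chart_dom c" "p \<in> chart_dom c'" "\<phi> p \<in> chart_dom d" "\<phi> p \<in> chart_dom d'"
  shows "jacobian (map_rep c' d' \<phi>) (at (chart_map c' p)) ** jacobian (chart_map c' \<circ> chart_inv c) (at (chart_map c p))
    = jacobian (chart_map d' \<circ> chart_inv d) (at (chart_map d (\<phi> p))) ** jacobian (map_rep c d \<phi>) (at (chart_map c p))"
    (is "?A' ** ?J = ?K ** ?A")
proof -
  let ?x = "chart_map c p"
  have cp: "(chart_map c' \<circ> chart_inv c) ?x = chart_map c' p" "map_rep c d \<phi> ?x = chart_map d (\<phi> p)"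
    using p by (simp_all add: chart_inv_map[OF M c(1)] map_rep_def)
  have "((\<lambda>x. map_rep c' d' \<phi> ((chart_map c' \<circ> chart_inv c) x)) has_derivative (\<lambda>v. ?A' *v (?J *v v))) (at ?x)"
    by (rule has_derivative_compose[OF transition_has_derivative[OF M c p(1,2)]])
      (unfold cp, rule map_rep_has_derivative[OF \<phi> c(2) d(2) p(2,4)])
  moreover have "((\<lambda>x. map_rep c' d' \<phi> ((chart_map c' \<circ> chart_inv c) x)) has_derivative (\<lambda>v. ?K *v (?A *v v))) (at ?x)"
  proof (rule has_derivative_transform_within_open)
    show "((\<lambda>x. (chart_map d' \<circ> chart_inv d) (map_rep c d \<phi> x)) has_derivative (\<lambda>v. ?K *v (?A *v v))) (at ?x)"
      by (rule has_derivative_compose[OF map_rep_has_derivative[OF \<phi> c(1) d(1) p(1,3)]])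
        (unfold cp, rule transition_has_derivative[OF N d p(3,4)])
    show "open (map_dom c d \<phi> \<inter> {x \<in> chart_img c. chart_inv c x \<in> chart_dom c'})"
      by (intro open_Int open_map_dom \<phi> c d open_chart_inv_vimage[OF M c(1) chart_open(1)[OF M c(2)]])
    show "?x \<in> map_dom c d \<phi> \<inter> {x \<in> chart_img c. chart_inv c x \<in> chart_dom c'}"
      using p by (auto intro: map_dom_memI[OF M] c simp: chart_map_in_img chart_inv_map[OF M c(1)])
    show "(chart_map d' \<circ> chart_inv d) (map_rep c d \<phi> x) = map_rep c' d' \<phi> ((chart_map c' \<circ> chart_inv c) x)"
      if "x \<in> map_dom c d \<phi> \<inter> {x \<in> chart_img c. chart_inv c x \<in> chart_dom c'}" for x
      using that by (simp add: map_dom_def map_rep_def chart_inv_map[OF M c(2)] chart_inv_map[OF N d(1)])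
  qed
  ultimately have "(\<lambda>v. ?A' *v (?J *v v)) = (\<lambda>v. ?K *v (?A *v v))"
    by (rule has_derivative_unique)
  then show ?thesis
    by (intro matrix_eq_of_mult) (simp add: matrix_vector_mul_assoc[symmetric] fun_eq_iff)
qed

lemma tcd_var_rep:
  assumes "smooth_variation M N \<psi> \<epsilon> \<Psi>" "c \<in> atlas M" "d \<in> atlas N"
  shows "times_cont_diff_on k (var_rep c d \<Psi>) (var_dom \<epsilon> c d \<Psi>)"
  using assms unfolding smooth_variation_def smooth_on_def var_rep_def var_dom_image[OF M assms(2), symmetric]
  by blast

lemma open_var_dom:
  assumes "smooth_variation M N \<psi> \<epsilon> \<Psi>" "c \<in> atlas M" "d \<in> atlas N"
  shows "open (var_dom \<epsilon> c d \<Psi>)"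
proof -
  let ?D = "{-\<epsilon><..<\<epsilon>} \<times> chart_img c"
  have fst: "continuous_map (top_of_set ?D) (top_of_set {-\<epsilon><..<\<epsilon>}) fst"
    by (auto intro: continuous_intros)
  have "continuous_map (top_of_set ?D) (top_of_set (chart_img c)) snd"
    by (auto intro: continuous_intros)
  then have snd: "continuous_map (top_of_set ?D) (mtop M) (\<lambda>z. chart_inv c (snd z))"
    using continuous_map_compose[OF _ continuous_map_chart_inv[OF M assms(2)], of "top_of_set ?D" snd]
    by (simp only: o_def)
  have "continuous_map (top_of_set ?D) (prod_topology (top_of_set {-\<epsilon><..<\<epsilon>}) (mtop M)) (\<lambda>z. (fst z, chart_inv c (snd z)))"
    using fst snd by (simp add: continuous_map_pairedI)
  then have "continuous_map (top_of_set ?D) (mtop N) ((\<lambda>(t, p). \<Psi> t p) \<circ> (\<lambda>z. (fst z, chart_inv c (snd z))))"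
    using assms(1) unfolding smooth_variation_def by (blast intro: continuous_map_compose)
  then have "openin (top_of_set ?D) {z \<in> topspace (top_of_set ?D).
      ((\<lambda>(t, p). \<Psi> t p) \<circ> (\<lambda>z. (fst z, chart_inv c (snd z)))) z \<in> chart_dom d}"
    by (rule openin_continuous_map_preimage) (rule chart_open(1)[OF N assms(3)])
  moreover have "{z \<in> topspace (top_of_set ?D).
      ((\<lambda>(t, p). \<Psi> t p) \<circ> (\<lambda>z. (fst z, chart_inv c (snd z)))) z \<in> chart_dom d} = var_dom \<epsilon> c d \<Psi>"
    by (auto simp: var_dom_def)
  ultimately show ?thesis
    using openin_open_trans[OF _ open_Times[OF open_greaterThanLessThan chart_open(2)[OF M assms(2)]]] by simp
qed

lemma smooth_variation_slice:
  assumes \<Psi>: "smooth_variation M N \<psi> \<epsilon> \<Psi>" and t: "t \<in> {-\<epsilon><..<\<epsilon>}"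
  shows "smooth_map M N (\<Psi> t)"
  unfolding smooth_map_def smooth_on_def
proof (intro conjI ballI allI)
  have "continuous_map (mtop M) (prod_topology (top_of_set {-\<epsilon><..<\<epsilon>}) (mtop M)) (\<lambda>p. (t, p))"
    using t by (intro continuous_map_pairedI) auto
  then have "continuous_map (mtop M) (mtop N) ((\<lambda>(t, p). \<Psi> t p) \<circ> (\<lambda>p. (t, p)))"
    using \<Psi> unfolding smooth_variation_def by (blast intro: continuous_map_compose)
  then show "continuous_map (mtop M) (mtop N) (\<Psi> t)" by (simp add: o_def)
  fix c d k assume c: "c \<in> atlas M" and d: "d \<in> atlas N"
  have eq: "map_dom c d (\<Psi> t) = (\<lambda>x. (t, x)) -` var_dom \<epsilon> c d \<Psi>"
    using t by (auto simp: map_dom_def var_dom_def)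
  have op: "open (map_dom c d (\<Psi> t))"
    unfolding eq by (intro open_vimage open_var_dom[OF \<Psi> c d] continuous_intros)
  have "times_cont_diff_on k (\<lambda>x. var_rep c d \<Psi> (t, x)) (map_dom c d (\<Psi> t))"
    by (rule tcd_compose[OF op open_var_dom[OF \<Psi> c d] _ tcd_var_rep[OF \<Psi> c d]
          tcd_Pair[OF op tcd_const tcd_ident[OF op]]])
      (auto simp: eq)
  then show "times_cont_diff_on k (map_rep c d (\<Psi> t)) (chart_map c ` {p \<in> chart_dom c. \<Psi> t p \<in> chart_dom d})"
    unfolding map_dom_image[OF M c] by (simp add: var_rep_def)
qed

text \<open>Makes smoothness of the energy density of a single map an instance of the statement
  about variations.\<close>

lemma smooth_variation_const:
  assumes \<psi>: "smooth_map M N \<psi>"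
  shows "smooth_variation M N \<psi> 1 (\<lambda>t. \<psi>)"
  unfolding smooth_variation_def smooth_on_def
proof (intro conjI ballI allI)
  have "continuous_map (prod_topology (top_of_set {-1<..<1::real}) (mtop M)) (mtop N) (\<psi> \<circ> snd)"
    using \<psi> unfolding smooth_map_def by (blast intro: continuous_map_compose continuous_map_snd)
  moreover have "\<psi> \<circ> snd = (\<lambda>(t :: real, p). \<psi> p)" by auto
  ultimately show "continuous_map (prod_topology (top_of_set {- 1<..<1::real}) (mtop M)) (mtop N) (\<lambda>(t, p). \<psi> p)"
    by simp
  fix c d k assume c: "c \<in> atlas M" and d: "d \<in> atlas N"
  have eq: "var_dom 1 c d (\<lambda>t. \<psi>) = {-1<..<1} \<times> map_dom c d \<psi>"
    by (auto simp: var_dom_def map_dom_def)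
  have op: "open ({-1<..<1::real} \<times> map_dom c d \<psi>)"
    by (intro open_Times open_map_dom \<psi> c d) simp
  have "times_cont_diff_on k (\<lambda>z. map_rep c d \<psi> (snd z)) ({-1<..<1::real} \<times> map_dom c d \<psi>)"
    by (rule tcd_compose[OF op open_map_dom[OF \<psi> c d] _ tcd_map_rep[OF \<psi> c d] tcd_bounded_linear[OF bounded_linear_snd op]])
      auto
  moreover have "(\<lambda>z. map_rep c d \<psi> (snd z)) = (\<lambda>(t :: real, x). map_rep c d \<psi> x)" by auto
  ultimately show "times_cont_diff_on k (\<lambda>(t :: real, x). map_rep c d \<psi> x)
      {(t, chart_map c p) |t p. t \<in> {- 1<..<1} \<and> p \<in> chart_dom c \<and> \<psi> p \<in> chart_dom d}"
    using var_dom_image[OF M c, of 1 "\<lambda>t. \<psi>" d] eq by (simp only:)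
qed auto

lemma partial_deriv_map_rep:
  assumes \<Psi>: "smooth_variation M N \<psi> \<epsilon> \<Psi>" and c: "c \<in> atlas M" and d: "d \<in> atlas N"
    and z: "(t, x) \<in> var_dom \<epsilon> c d \<Psi>"
  shows "partial_deriv i (map_rep c d (\<Psi> t)) x = frechet_derivative (var_rep c d \<Psi>) (at (t, x)) (0, axis i 1)"
proof -
  have "(var_rep c d \<Psi> has_derivative frechet_derivative (var_rep c d \<Psi>) (at (t, x))) (at (t, x))"
    by (rule tcd_has_derivative[OF tcd_var_rep[OF \<Psi> c d] z])
  from partial_deriv_eqI[OF has_derivative_compose[OF has_derivative_Pair_right this]]
  show ?thesis by (simp add: var_rep_def)
qed

end

lemma differential_norm_sq_rep_hs_inner:
  "differential_norm_sq_rep g h c d \<phi> x = hs_inner (metric_rep g c x) (metric_rep h d (map_rep c d \<phi> x))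
     (jacobian (map_rep c d \<phi>) (at x)) (jacobian (map_rep c d \<phi>) (at x))"
  unfolding differential_norm_sq_rep_def hs_inner_def Let_def jacobian_def column_matrix partial_deriv_def ..

lemma metric_rep_chart_map:
  assumes M: "smooth_manifold M" and "c \<in> atlas M" "p \<in> chart_dom c"
  shows "metric_rep g c (chart_map c p) = g c p"
  using assms(2,3) by (simp add: metric_rep_def chart_inv_map[OF M])

lemma metric_rep_map_rep:
  assumes M: "smooth_manifold M" and N: "smooth_manifold N" and "c \<in> atlas M" "p \<in> chart_dom c" "d \<in> atlas N" "\<phi> p \<in> chart_dom d"
  shows "metric_rep h d (map_rep c d \<phi> (chart_map c p)) = h d (\<phi> p)"
  using assms(3-) by (simp add: metric_rep_def map_rep_def chart_inv_map[OF M] chart_inv_map[OF N])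

lemma metric_invertible:
  assumes g: "riemannian_metric M g" and "c \<in> atlas M" "p \<in> chart_dom c"
  shows "invertible (g c p)"
  using metric_det_pos[OF assms] by (simp add: invertible_det_nz)

lemma tcd_metric_inv:
  assumes M: "smooth_manifold M" and g: "riemannian_metric M g" and c: "c \<in> atlas M"
  shows "times_cont_diff_on k (\<lambda>x. matrix_inv (metric_rep g c x)) (chart_img c)"
  by (intro tcd_matrix_inv chart_open(2)[OF M c] riemannian_metricD(1)[OF g c] metric_rep_det_pos[OF g c])

context
  fixes M :: "('a, 'm::finite) manifold" and N :: "('b, 'n::finite) manifold"
    and g :: "('a, 'm) metric" and h :: "('b, 'n) metric"
  assumes M: "smooth_manifold M" and N: "smooth_manifold N"
    and g: "riemannian_metric M g" and h: "riemannian_metric N h"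
begin

text \<open>The definition uses charts picked separately at each point, whose dependence on the
  point is uncontrolled. Invariance of the pairing allows fixed charts near a point, as
  differentiation demands.\<close>

lemma differential_norm_sq_eq_rep:
  assumes \<phi>: "smooth_map M N \<phi>" and c: "c \<in> atlas M" and d: "d \<in> atlas N"
    and p: "p \<in> chart_dom c" "\<phi> p \<in> chart_dom d"
  shows "differential_norm_sq M g N h \<phi> p = differential_norm_sq_rep g h c d \<phi> (chart_map c p)"
proof -
  let ?c = "chart_at M p" and ?d = "chart_at N (\<phi> p)"
  have pM: "p \<in> topspace (mtop M)" using chart_open(3)[OF M c] p(1) by blast
  have pN: "\<phi> p \<in> topspace (mtop N)" using chart_open(3)[OF N d] p(2) by blast
  note ca = chart_at[OF M pM] and da = chart_at[OF N pN]
  show ?thesis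
    unfolding differential_norm_sq_def differential_norm_sq_rep_hs_inner
      metric_rep_chart_map[OF M c p(1)] metric_rep_chart_map[OF M ca]
      metric_rep_map_rep[where \<phi> = \<phi>, OF M N c p(1) d p(2)] metric_rep_map_rep[where \<phi> = \<phi>, OF M N ca da]
    using map_rep_jacobian_transition[OF M N \<phi> ca(1) c da(1) d ca(2) p(1) da(2) p(2)]
    by (intro hs_inner_invariant[OF riemannian_metricD(4)[OF g ca(1) c ca(2) p(1)]
        riemannian_metricD(4)[OF h da(1) d da(2) p(2)]
        jacobian_transition_invertible[OF M ca(1) c ca(2) p(1)] metric_invertible[OF g c p(1)]])
qed

lemma differential_norm_sq_nonneg:
  assumes \<phi>: "smooth_map M N \<phi>" and p: "p \<in> topspace (mtop M)"
  shows "differential_norm_sq M g N h \<phi> p \<ge> 0"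
proof -
  have "\<phi> p \<in> topspace (mtop N)"
    using \<phi> p unfolding smooth_map_def continuous_map_def by blast
  then have d: "chart_at N (\<phi> p) \<in> atlas N" "\<phi> p \<in> chart_dom (chart_at N (\<phi> p))"
    by (rule chart_at[OF N])+
  note c = chart_at[OF M p]
  show ?thesis
    unfolding differential_norm_sq_def differential_norm_sq_rep_hs_inner
      metric_rep_chart_map[OF M c] metric_rep_map_rep[where \<phi> = \<phi>, OF M N c d]
    by (intro hs_inner_nonneg riemannian_metricD[OF g c(1)] riemannian_metricD[OF h d(1)] c d)
qed

lemma energy_density_eq:
  assumes \<Psi>: "smooth_variation M N \<psi> \<epsilon> \<Psi>" and c: "c \<in> atlas M" and d: "d \<in> atlas N"
    and z: "(t, x) \<in> var_dom \<epsilon> c d \<Psi>"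
  shows "differential_norm_sq M g N h (\<Psi> t) (chart_inv c x) =
    (\<Sum>i\<in>UNIV. \<Sum>j\<in>UNIV. matrix_inv (metric_rep g c x) $ i $ j *
      (frechet_derivative (var_rep c d \<Psi>) (at (t, x)) (0, axis i 1) \<bullet>
        (metric_rep h d (var_rep c d \<Psi> (t, x)) *v frechet_derivative (var_rep c d \<Psi>) (at (t, x)) (0, axis j 1))))"
proof -
  from z have t: "t \<in> {-\<epsilon><..<\<epsilon>}" and x: "x \<in> chart_img c" "\<Psi> t (chart_inv c x) \<in> chart_dom d"
    by (auto simp: var_dom_def)
  show ?thesis
    using differential_norm_sq_eq_rep[OF smooth_variation_slice[OF M N \<Psi> t] c d chart_map_inv(2)[OF x(1)] x(2)]
    by (simp add: chart_map_inv(1)[OF x(1)] differential_norm_sq_rep_def Let_def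
        partial_deriv_map_rep[OF M N \<Psi> c d z]) (simp add: var_rep_def)
qed

lemma tcd_metric_var_rep:
  assumes \<Psi>: "smooth_variation M N \<psi> \<epsilon> \<Psi>" and c: "c \<in> atlas M" and d: "d \<in> atlas N"
  shows "times_cont_diff_on k (\<lambda>z. metric_rep h d (var_rep c d \<Psi> z)) (var_dom \<epsilon> c d \<Psi>)"
  by (rule tcd_compose[OF open_var_dom[OF M N \<Psi> c d] chart_open(2)[OF N d] _ riemannian_metricD(1)[OF h d]
        tcd_var_rep[OF M N \<Psi> c d]])
    (auto simp: var_dom_def var_rep_def map_rep_def chart_map_in_img)

lemma tcd_energy_density:
  assumes \<Psi>: "smooth_variation M N \<psi> \<epsilon> \<Psi>" and c: "c \<in> atlas M"
  shows "times_cont_diff_on k (\<lambda>(t, x). differential_norm_sq M g N h (\<Psi> t) (chart_inv c x))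
    ({-\<epsilon><..<\<epsilon>} \<times> chart_img c)"
proof (rule tcd_local)
  fix z assume "z \<in> {-\<epsilon><..<\<epsilon>} \<times> chart_img c"
  then obtain t x where z: "z = (t, x)" "t \<in> {-\<epsilon><..<\<epsilon>}" "x \<in> chart_img c" by auto
  have "\<Psi> t (chart_inv c x) \<in> topspace (mtop N)"
    using smooth_variation_slice[OF M N \<Psi> z(2)] chart_map_inv(2)[OF z(3)] chart_open(3)[OF M c]
    unfolding smooth_map_def continuous_map_def by blast
  \<comment> \<open>The image of one chart of M need not lie in one chart of N, so the target chart
    is chosen near the given point only.\<close>
  then obtain d where d: "d \<in> atlas N" "\<Psi> t (chart_inv c x) \<in> chart_dom d"
    using smooth_manifoldD(3)[OF N] by blast
  let ?U = "var_rep c d \<Psi>" and ?W = "var_dom \<epsilon> c d \<Psi>"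
  have W: "open ?W" by (rule open_var_dom[OF M N \<Psi> c d(1)])
  have dU: "times_cont_diff_on k (\<lambda>z. frechet_derivative ?U (at z) v) ?W" for v
    by (rule tcd_frechet_derivative[OF tcd_var_rep[OF M N \<Psi> c d(1)]])
  have Ginv: "times_cont_diff_on k (\<lambda>z. matrix_inv (metric_rep g c (snd z))) ?W"
    by (rule tcd_compose[OF W chart_open(2)[OF M c] _ tcd_metric_inv[OF M g c] tcd_bounded_linear[OF bounded_linear_snd W]])
      (auto simp: var_dom_def)
  have "times_cont_diff_on k (\<lambda>z. \<Sum>i\<in>UNIV. \<Sum>j\<in>UNIV. matrix_inv (metric_rep g c (snd z)) $ i $ j *
      (frechet_derivative ?U (at z) (0, axis i 1) \<bullet>
        (metric_rep h d (?U z) *v frechet_derivative ?U (at z) (0, axis j 1)))) ?W"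
    by (intro tcd_sum tcd_mult tcd_inner tcd_vec_nth tcd_matrix_vector_mult W dU Ginv
        tcd_metric_var_rep[OF \<Psi> c d(1)])
  then have "times_cont_diff_on k (\<lambda>(t, x). differential_norm_sq M g N h (\<Psi> t) (chart_inv c x)) ?W"
    by (rule tcd_cong[OF W, rotated]) (auto simp: energy_density_eq[OF \<Psi> c d(1)])
  moreover have "z \<in> ?W" using z d by (simp add: var_dom_def)
  ultimately show "\<exists>T. open T \<and> z \<in> T \<and>
      times_cont_diff_on k (\<lambda>(t, x). differential_norm_sq M g N h (\<Psi> t) (chart_inv c x)) T"
    using W by blast
qed

lemma tcd_differential_norm_sq:
  assumes \<psi>: "smooth_map M N \<psi>" and c: "c \<in> atlas M"
  shows "times_cont_diff_on k (\<lambda>x. differential_norm_sq M g N h \<psi> (chart_inv c x)) (chart_img c)"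
  using tcd_compose[OF chart_open(2)[OF M c] _ _ tcd_energy_density[OF smooth_variation_const[OF M N \<psi>] c]
      tcd_Pair[OF chart_open(2)[OF M c] tcd_const[of k 0] tcd_ident[OF chart_open(2)[OF M c]]]]
  by (simp add: open_Times chart_open(2)[OF M c] image_subset_iff)


end

section \<open>First variation of the energy density\<close>

lemma linear_axis_expansion:
  fixes f :: "real^'n \<Rightarrow> 'b::real_vector"
  assumes "linear f"
  shows "f v = (\<Sum>i\<in>UNIV. v $ i *\<^sub>R f (axis i 1))"
proof -
  have "f v = f (\<Sum>i\<in>UNIV. v $ i *\<^sub>R axis i 1)"
    using basis_expansion[of v] by (simp add: scalar_mult_eq_scaleR)
  then show ?thesis
    using assms by (simp add: linear_sum linear_scale)
qed

lemma has_derivative_vec_nth: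
  "(f has_derivative f') (at x) \<Longrightarrow> ((\<lambda>y. f y $ i) has_derivative (\<lambda>v. f' v $ i)) (at x)"
  by (rule bounded_linear.has_derivative[OF bounded_linear_vec_nth])

lemma partial_deriv_cong_open:
  assumes "open S" "x \<in> S" "\<And>y. y \<in> S \<Longrightarrow> f y = g y"
  shows "partial_deriv i f x = partial_deriv i g x"
  unfolding partial_deriv_def using frechet_derivative_cong_open[OF assms] by simp

lemma matrix_inv_sym_nth:
  fixes G :: "real^'m^'m"
  assumes "invertible G" "transpose G = G"
  shows "matrix_inv G $ i $ j = matrix_inv G $ j $ i"
  using arg_cong[OF transpose_matrix_inv[OF assms], of "\<lambda>X. X $ j $ i"] by (simp add: transpose_def)

text \<open>A variation starts at \<psi> only on the points of M; the map that is differentiated is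
  \<Psi> 0, and harmonicity has to be carried over to it.\<close>

lemma harmonic_map_cong:
  assumes M: "smooth_manifold M" and "harmonic_map M g N h \<psi>" and \<phi>: "smooth_map M N \<phi>"
    and eq: "\<And>p. p \<in> topspace (mtop M) \<Longrightarrow> \<phi> p = \<psi> p"
  shows "harmonic_map M g N h \<phi>"
  unfolding harmonic_map_def
proof (intro conjI ballI impI \<phi>)
  fix c d p assume c: "c \<in> atlas M" and d: "d \<in> atlas N" and p: "p \<in> chart_dom c" "\<phi> p \<in> chart_dom d"
  have op: "open (chart_img c)" by (rule chart_open(2)[OF M c])
  have x: "chart_map c p \<in> chart_img c" by (rule chart_map_in_img[OF p(1)])
  have rep: "map_rep c d \<phi> y = map_rep c d \<psi> y" if "y \<in> chart_img c" for y
    unfolding map_rep_def using eq chart_map_inv(2)[OF that] chart_open(3)[OF M c] by auto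
  have pd: "partial_deriv j (map_rep c d \<phi>) y = partial_deriv j (map_rep c d \<psi>) y" if "y \<in> chart_img c" for y j
    by (rule partial_deriv_cong_open[OF op that rep])
  have pd2: "partial_deriv i (\<lambda>y. partial_deriv j (map_rep c d \<phi>) y $ a) (chart_map c p)
      = partial_deriv i (\<lambda>y. partial_deriv j (map_rep c d \<psi>) y $ a) (chart_map c p)" for i j a
    by (rule partial_deriv_cong_open[OF op x]) (simp add: pd)
  have "tension_field g h c d \<phi> (chart_map c p) = tension_field g h c d \<psi> (chart_map c p)"
    unfolding tension_field_def second_fundamental_form_def Let_def pd2 pd[OF x] rep[OF x] ..
  moreover have "\<psi> p \<in> chart_dom d"
    using p eq chart_open(3)[OF M c] by auto
  ultimately show "tension_field g h c d \<phi> (chart_map c p) = 0"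
    using assms(2) c d p(1) unfolding harmonic_map_def by simp
qed

text \<open>The linear map V tensor \<omega>. Its pairing with d\<psi> is \<omega> evaluated on the
  flux, so the flux inherits the invariance of \<open>hs_inner\<close>.\<close>

definition outer_vec :: "real^'n \<Rightarrow> real^'m \<Rightarrow> real^'m^'n" where
  "outer_vec V \<omega> = (\<chi> a i. V $ a * \<omega> $ i)"

definition var_field ::
  "('a, 'm::finite) chart \<Rightarrow> ('b, 'n::finite) chart \<Rightarrow> (real \<Rightarrow> 'a \<Rightarrow> 'b) \<Rightarrow> real^'m \<Rightarrow> real^'n" where
  "var_field c d \<Psi> x = frechet_derivative (var_rep c d \<Psi>) (at (0, x)) (1, 0)"

text \<open>The components of the vector field dual to the 1-form \<open>h(V, d\<psi>)\<close>, where V is the variation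
  field; twice its divergence is the variation of the energy density of a harmonic map.\<close>

definition flux_comp ::
  "('a, 'm::finite) metric \<Rightarrow> ('b, 'n::finite) metric \<Rightarrow> ('a, 'm) chart \<Rightarrow> ('b, 'n) chart \<Rightarrow>
    (real \<Rightarrow> 'a \<Rightarrow> 'b) \<Rightarrow> 'm \<Rightarrow> real^'m \<Rightarrow> real" where
  "flux_comp g h c d \<Psi> i x = (\<Sum>j\<in>UNIV. matrix_inv (metric_rep g c x) $ i $ j *
     (var_field c d \<Psi> x \<bullet> (metric_rep h d (map_rep c d (\<Psi> 0) x) *v partial_deriv j (map_rep c d (\<Psi> 0)) x)))"

text \<open>Picking the target chart pointwise turns the locally defined \<open>flux_comp\<close>
  into one function on the whole chart image.\<close>

definition flux ::
  "('a, 'm::finite) metric \<Rightarrow> ('b, 'n::finite) manifold \<Rightarrow> ('b, 'n) metric \<Rightarrow> ('a, 'm) chart \<Rightarrow>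
    (real \<Rightarrow> 'a \<Rightarrow> 'b) \<Rightarrow> 'm \<Rightarrow> real^'m \<Rightarrow> real" where
  "flux g N h c \<Psi> i x = flux_comp g h c (chart_at N (\<Psi> 0 (chart_inv c x))) \<Psi> i x"

lemma flux_comp_hs_inner:
  fixes g :: "('a, 'm::finite) metric" and h :: "('b, 'n::finite) metric"
  shows "(\<Sum>i\<in>UNIV. \<omega> $ i * flux_comp g h c d \<Psi> i x) = hs_inner (metric_rep g c x)
     (metric_rep h d (map_rep c d (\<Psi> 0) x)) (outer_vec (var_field c d \<Psi> x) \<omega>)
     (jacobian (map_rep c d (\<Psi> 0)) (at x))"
proof -
  have "column i (outer_vec V \<omega>) = \<omega> $ i *\<^sub>R V" for i and V :: "real^'n" and \<omega> :: "real^'m"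
    by (simp add: column_def outer_vec_def vec_eq_iff mult.commute)
  then show ?thesis
    unfolding hs_inner_def flux_comp_def jacobian_def column_matrix partial_deriv_def
    by (simp add: sum_distrib_left mult.assoc mult.left_commute)
qed

context
  fixes M :: "('a, 'm::finite) manifold" and N :: "('b, 'n::finite) manifold"
    and g :: "('a, 'm) metric" and h :: "('b, 'n) metric"
    and \<psi> :: "'a \<Rightarrow> 'b" and \<epsilon> :: real and \<Psi> :: "real \<Rightarrow> 'a \<Rightarrow> 'b"
  assumes M: "smooth_manifold M" and N: "smooth_manifold N"
    and g: "riemannian_metric M g" and h: "riemannian_metric N h"
    and \<Psi>: "smooth_variation M N \<psi> \<epsilon> \<Psi>"
begin

lemma \<epsilon>_pos: "\<epsilon> > 0"
  using \<Psi> by (simp add: smooth_variation_def)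

lemma \<Psi>0_smooth: "smooth_map M N (\<Psi> 0)"
  by (rule smooth_variation_slice[OF M N \<Psi>]) (use \<epsilon>_pos in auto)

lemma var_dom_0_iff: "(0, x) \<in> var_dom \<epsilon> c d \<Psi> \<longleftrightarrow> x \<in> map_dom c d (\<Psi> 0)"
  using \<epsilon>_pos by (simp add: var_dom_def map_dom_def)

lemma var_field_transition:
  assumes c: "c \<in> atlas M" "c' \<in> atlas M" and d: "d \<in> atlas N" "d' \<in> atlas N"
    and p: "p \<in> chart_dom c" "p \<in> chart_dom c'" "\<Psi> 0 p \<in> chart_dom d" "\<Psi> 0 p \<in> chart_dom d'"
  shows "var_field c' d' \<Psi> (chart_map c' p)
    = jacobian (chart_map d' \<circ> chart_inv d) (at (chart_map d (\<Psi> 0 p))) *v var_field c d \<Psi> (chart_map c p)"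
    (is "?V' = ?K *v ?V")
proof -
  let ?x = "chart_map c p" and ?x' = "chart_map c' p"
  have z: "(0, ?x) \<in> var_dom \<epsilon> c d \<Psi>" "(0, ?x') \<in> var_dom \<epsilon> c' d' \<Psi>"
    unfolding var_dom_0_iff using p c by (auto intro: map_dom_memI[OF M])
  have d1: "((\<lambda>t. var_rep c d \<Psi> (t, ?x)) has_derivative (\<lambda>s. frechet_derivative (var_rep c d \<Psi>) (at (0, ?x)) (s, 0))) (at 0)"
    by (rule has_derivative_compose[OF has_derivative_Pair_left tcd_has_derivative[OF tcd_var_rep[OF M N \<Psi> c(1) d(1)] z(1)]])
  have d2: "((\<lambda>t. var_rep c' d' \<Psi> (t, ?x')) has_derivative (\<lambda>s. frechet_derivative (var_rep c' d' \<Psi>) (at (0, ?x')) (s, 0))) (at 0)"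
    by (rule has_derivative_compose[OF has_derivative_Pair_left tcd_has_derivative[OF tcd_var_rep[OF M N \<Psi> c(2) d(2)] z(2)]])
  have at0: "var_rep c d \<Psi> (0, ?x) = chart_map d (\<Psi> 0 p)"
    by (simp add: var_rep_def map_rep_def chart_inv_map[OF M c(1) p(1)])
  have d3: "((\<lambda>t. (chart_map d' \<circ> chart_inv d) (var_rep c d \<Psi> (t, ?x))) has_derivative
      (\<lambda>s. ?K *v frechet_derivative (var_rep c d \<Psi>) (at (0, ?x)) (s, 0))) (at 0)"
    by (rule has_derivative_compose[OF d1]) (unfold at0, rule transition_has_derivative[OF N d p(3,4)])
  have "((\<lambda>t. var_rep c' d' \<Psi> (t, ?x')) has_derivative
      (\<lambda>s. ?K *v frechet_derivative (var_rep c d \<Psi>) (at (0, ?x)) (s, 0))) (at 0)"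
  proof (rule has_derivative_transform_within_open[OF d3])
    show "open ((\<lambda>t. (t, ?x)) -` var_dom \<epsilon> c d \<Psi>)"
      by (intro open_vimage open_var_dom[OF M N \<Psi> c(1) d(1)] continuous_intros)
    show "0 \<in> (\<lambda>t. (t, ?x)) -` var_dom \<epsilon> c d \<Psi>" using z by simp
    show "(chart_map d' \<circ> chart_inv d) (var_rep c d \<Psi> (t, ?x)) = var_rep c' d' \<Psi> (t, ?x')"
      if "t \<in> (\<lambda>t. (t, ?x)) -` var_dom \<epsilon> c d \<Psi>" for t
      using that p
      by (simp add: var_dom_def var_rep_def map_rep_def chart_inv_map[OF M c(1)] chart_inv_map[OF M c(2)]
          chart_inv_map[OF N d(1)])
  qed
  from has_derivative_unique[OF d2 this] show ?thesis
    unfolding var_field_def by (simp add: fun_eq_iff)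
qed

text \<open>The transformation law of a vector field, stated through its pairing with an arbitrary
  covector \<omega> so that it becomes an instance of \<open>hs_inner_invariant\<close>.\<close>

lemma flux_comp_transition:
  assumes c: "c \<in> atlas M" "c' \<in> atlas M" and d: "d \<in> atlas N" "d' \<in> atlas N"
    and p: "p \<in> chart_dom c" "p \<in> chart_dom c'" "\<Psi> 0 p \<in> chart_dom d" "\<Psi> 0 p \<in> chart_dom d'"
  shows "(\<Sum>i\<in>UNIV. (transpose (jacobian (chart_map c' \<circ> chart_inv c) (at (chart_map c p))) *v \<omega>) $ i
      * flux_comp g h c d \<Psi> i (chart_map c p))
    = (\<Sum>i\<in>UNIV. \<omega> $ i * flux_comp g h c' d' \<Psi> i (chart_map c' p))"
proof -
  let ?J = "jacobian (chart_map c' \<circ> chart_inv c) (at (chart_map c p))"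
  have outer: "outer_vec (var_field c' d' \<Psi> (chart_map c' p)) \<omega> ** ?J
    = jacobian (chart_map d' \<circ> chart_inv d) (at (chart_map d (\<Psi> 0 p))) **
      outer_vec (var_field c d \<Psi> (chart_map c p)) (transpose ?J *v \<omega>)"
    unfolding var_field_transition[OF c d p]
    by (simp add: vec_eq_iff matrix_matrix_mult_def matrix_vector_mult_def outer_vec_def transpose_def
        sum_distrib_left sum_distrib_right mult.assoc mult.commute mult.left_commute)
      (intro allI, rule sum.swap)
  show ?thesis
    unfolding flux_comp_hs_inner metric_rep_chart_map[OF M c(1) p(1)] metric_rep_chart_map[OF M c(2) p(2)]
      metric_rep_map_rep[where \<phi> = "\<Psi> 0", OF M N c(1) p(1) d(1) p(3)]
      metric_rep_map_rep[where \<phi> = "\<Psi> 0", OF M N c(2) p(2) d(2) p(4)]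
    by (rule hs_inner_invariant[OF riemannian_metricD(4)[OF g c p(1,2)] riemannian_metricD(4)[OF h d p(3,4)]
          jacobian_transition_invertible[OF M c p(1,2)] metric_invertible[OF g c(2) p(2)] outer
          map_rep_jacobian_transition[OF M N \<Psi>0_smooth c d p]])
qed

text \<open>The transformation law with c' = c, where the Jacobian is the identity, tested on the
  coordinate covectors: the target chart does not matter.\<close>

lemma flux_eq_flux_comp:
  assumes c: "c \<in> atlas M" and d: "d \<in> atlas N" and x: "x \<in> map_dom c d (\<Psi> 0)"
  shows "flux g N h c \<Psi> i x = flux_comp g h c d \<Psi> i x"
proof -
  let ?p = "chart_inv c x" and ?d = "chart_at N (\<Psi> 0 (chart_inv c x))"
  have xp: "x \<in> chart_img c" "\<Psi> 0 ?p \<in> chart_dom d" using x by (auto simp: map_dom_def)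
  then have p: "?p \<in> chart_dom c" "chart_map c ?p = x" using chart_map_inv[OF xp(1)] by auto
  have "\<Psi> 0 ?p \<in> topspace (mtop N)" using xp chart_open(3)[OF N d] by blast
  note d' = chart_at[OF N this]
  have sum_axis: "(\<Sum>j\<in>UNIV. axis i 1 $ j * f j) = f i" for f :: "'m \<Rightarrow> real"
    by (simp add: axis_def if_distrib[of "\<lambda>x. x * _"] cong: if_cong)
  show ?thesis
    using flux_comp_transition[OF c c d'(1) d p(1) p(1) d'(2) xp(2), of "axis i 1"]
    unfolding p(2) jacobian_identity[OF M c p(1), unfolded p(2)] transpose_mat matrix_vector_mul_lid sum_axis
    by (simp add: flux_def)
qed

lemma map_dom_cover:
  assumes c: "c \<in> atlas M" and x: "x \<in> chart_img c"
  obtains d where "d \<in> atlas N" "x \<in> map_dom c d (\<Psi> 0)"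
proof -
  have "\<Psi> 0 (chart_inv c x) \<in> topspace (mtop N)"
    using \<Psi>0_smooth chart_map_inv(2)[OF x] chart_open(3)[OF M c]
    unfolding smooth_map_def continuous_map_def by blast
  then obtain d where "d \<in> atlas N" "\<Psi> 0 (chart_inv c x) \<in> chart_dom d"
    using smooth_manifoldD(3)[OF N] by blast
  then show thesis using that x by (auto simp: map_dom_def)
qed

lemma flux_transition:
  assumes c: "c \<in> atlas M" "c' \<in> atlas M" and p: "p \<in> chart_dom c" "p \<in> chart_dom c'"
  shows "(\<Sum>i\<in>UNIV. (transpose (jacobian (chart_map c' \<circ> chart_inv c) (at (chart_map c p))) *v \<omega>) $ i
      * flux g N h c \<Psi> i (chart_map c p))
    = (\<Sum>i\<in>UNIV. \<omega> $ i * flux g N h c' \<Psi> i (chart_map c' p))"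
proof -
  obtain d where d: "d \<in> atlas N" "chart_map c p \<in> map_dom c d (\<Psi> 0)"
    using map_dom_cover[OF c(1) chart_map_in_img[OF p(1)]] .
  then have dp: "\<Psi> 0 p \<in> chart_dom d" by (simp add: map_dom_def chart_inv_map[OF M c(1) p(1)])
  have d': "chart_map c' p \<in> map_dom c' d (\<Psi> 0)" using map_dom_memI[OF M c(2) p(2)] dp by blast
  show ?thesis
    using flux_comp_transition[OF c d(1) d(1) p dp dp]
    by (simp add: flux_eq_flux_comp[OF c(1) d] flux_eq_flux_comp[OF c(2) d(1) d'])
qed

lemma tcd_flux:
  assumes c: "c \<in> atlas M"
  shows "times_cont_diff_on k (flux g N h c \<Psi> i) (chart_img c)"
proof (rule tcd_local)
  fix x assume x: "x \<in> chart_img c"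
  obtain d where d: "d \<in> atlas N" "x \<in> map_dom c d (\<Psi> 0)" using map_dom_cover[OF c x] .
  let ?S = "map_dom c d (\<Psi> 0)"
  have S: "open ?S" by (rule open_map_dom[OF M N \<Psi>0_smooth c d(1)])
  have SI: "?S \<subseteq> chart_img c" by (auto simp: map_dom_def)
  have u: "times_cont_diff_on k (map_rep c d (\<Psi> 0)) ?S" for k
    by (rule tcd_map_rep[OF M N \<Psi>0_smooth c d(1)])
  have "times_cont_diff_on k (\<lambda>z. frechet_derivative (var_rep c d \<Psi>) (at z) (1, 0)) (var_dom \<epsilon> c d \<Psi>)"
    by (rule tcd_frechet_derivative[OF tcd_var_rep[OF M N \<Psi> c d(1)]])
  then have V: "times_cont_diff_on k (var_field c d \<Psi>) ?S"
    unfolding var_field_def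
    by (intro tcd_compose[OF S open_var_dom[OF M N \<Psi> c d(1)] _ _ tcd_Pair[OF S tcd_const tcd_ident[OF S]]])
      (auto simp: var_dom_0_iff)
  have H: "times_cont_diff_on k (\<lambda>x. metric_rep h d (map_rep c d (\<Psi> 0) x)) ?S"
    by (rule tcd_compose[OF S chart_open(2)[OF N d(1)] _ riemannian_metricD(1)[OF h d(1)] u])
      (auto simp: map_dom_def map_rep_def chart_map_in_img)
  have "times_cont_diff_on k (flux_comp g h c d \<Psi> i) ?S"
    unfolding flux_comp_def partial_deriv_def
    by (intro tcd_sum tcd_mult tcd_inner tcd_vec_nth tcd_matrix_vector_mult S V H tcd_frechet_derivative[OF u]
        tcd_subset[OF tcd_metric_inv[OF M g c] SI])
  then have "times_cont_diff_on k (flux g N h c \<Psi> i) ?S"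
    by (rule tcd_cong[OF S, rotated]) (simp add: flux_eq_flux_comp[OF c d(1)])
  then show "\<exists>T. open T \<and> x \<in> T \<and> times_cont_diff_on k (flux g N h c \<Psi> i) T"
    using S d(2) by blast
qed

lemma energy_form_has_derivative:
  fixes c d v w
  defines "U \<equiv> var_rep c d \<Psi>"
  assumes c: "c \<in> atlas M" and d: "d \<in> atlas N" and z: "z \<in> var_dom \<epsilon> c d \<Psi>"
  shows "((\<lambda>z. frechet_derivative U (at z) v \<bullet> (metric_rep h d (U z) *v frechet_derivative U (at z) w)) has_derivative
    (\<lambda>\<theta>. \<Sum>a\<in>UNIV. \<Sum>b\<in>UNIV.
      (\<Sum>e\<in>UNIV. partial_deriv e (\<lambda>y. metric_rep h d y $ a $ b) (U z) * frechet_derivative U (at z) \<theta> $ e)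
          * frechet_derivative U (at z) v $ a * frechet_derivative U (at z) w $ b
        + metric_rep h d (U z) $ a $ b * frechet_derivative (\<lambda>z. frechet_derivative U (at z) v) (at z) \<theta> $ a
          * frechet_derivative U (at z) w $ b
        + metric_rep h d (U z) $ a $ b * frechet_derivative U (at z) v $ a
          * frechet_derivative (\<lambda>z. frechet_derivative U (at z) w) (at z) \<theta> $ b)) (at z)"
proof -
  have dU: "(U has_derivative frechet_derivative U (at z)) (at z)"
    unfolding U_def by (rule tcd_has_derivative[OF tcd_var_rep[OF M N \<Psi> c d] z])
  have d2U: "((\<lambda>z. frechet_derivative U (at z) v) has_derivative frechet_derivative (\<lambda>z. frechet_derivative U (at z) v) (at z)) (at z)" for v
    unfolding U_def by (rule tcd_has_derivative[OF tcd_frechet_derivative[OF tcd_var_rep[OF M N \<Psi> c d]] z])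
  have Uz: "U z \<in> chart_img d"
    using z by (auto simp: U_def var_dom_def var_rep_def map_rep_def chart_map_in_img)
  have "(metric_rep h d has_derivative frechet_derivative (metric_rep h d) (at (U z))) (at (U z))"
    by (rule tcd_has_derivative[OF riemannian_metricD(1)[OF h d] Uz])
  then have dH: "((\<lambda>y. metric_rep h d y $ a $ b) has_derivative (\<lambda>\<theta>. frechet_derivative (metric_rep h d) (at (U z)) \<theta> $ a $ b)) (at (U z))" for a b
    by (intro has_derivative_vec_nth)
  have dHe: "frechet_derivative (metric_rep h d) (at (U z)) \<theta> $ a $ b
      = (\<Sum>e\<in>UNIV. partial_deriv e (\<lambda>y. metric_rep h d y $ a $ b) (U z) * \<theta> $ e)" for \<theta> a b
    using linear_axis_expansion[OF has_derivative_linear[OF dH], of \<theta>]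
    by (simp add: partial_deriv_eqI[OF dH] mult.commute)
  have fun_eq: "(\<lambda>z. frechet_derivative U (at z) v \<bullet> (metric_rep h d (U z) *v frechet_derivative U (at z) w))
    = (\<lambda>z. \<Sum>a\<in>UNIV. \<Sum>b\<in>UNIV. metric_rep h d (U z) $ a $ b * frechet_derivative U (at z) v $ a * frechet_derivative U (at z) w $ b)"
    by (simp add: inner_vec_def matrix_vector_mult_def sum_distrib_left mult.assoc mult.left_commute)
  have "((\<lambda>z. metric_rep h d (U z) $ a $ b * frechet_derivative U (at z) v $ a * frechet_derivative U (at z) w $ b) has_derivative
    (\<lambda>\<theta>. (\<Sum>e\<in>UNIV. partial_deriv e (\<lambda>y. metric_rep h d y $ a $ b) (U z) * frechet_derivative U (at z) \<theta> $ e)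
          * frechet_derivative U (at z) v $ a * frechet_derivative U (at z) w $ b
        + metric_rep h d (U z) $ a $ b * frechet_derivative (\<lambda>z. frechet_derivative U (at z) v) (at z) \<theta> $ a
          * frechet_derivative U (at z) w $ b
        + metric_rep h d (U z) $ a $ b * frechet_derivative U (at z) v $ a
          * frechet_derivative (\<lambda>z. frechet_derivative U (at z) w) (at z) \<theta> $ b)) (at z)" for a b
    by (rule has_derivative_eq_rhs[OF has_derivative_mult[OF has_derivative_mult[OF has_derivative_compose[OF dU dH]
            has_derivative_vec_nth[OF d2U]] has_derivative_vec_nth[OF d2U]]])
      (intro ext, simp add: dHe algebra_simps)
  then show ?thesis
    unfolding fun_eq by (intro has_derivative_sum)
qed

text \<open>The analytic part only names the derivatives at x and supplies the hypotheses of the two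
  index identities; the latter carry the argument.\<close>

lemma energy_variation_divergence:
  fixes c x
  assumes c: "c \<in> atlas M" and x: "x \<in> chart_img c" and harm: "harmonic_map M g N h (\<Psi> 0)"
  shows "2 * (\<Sum>i\<in>UNIV. partial_deriv i (\<lambda>x. sqrt (det (metric_rep g c x)) * flux g N h c \<Psi> i x) x)
    = sqrt (det (metric_rep g c x)) *
      frechet_derivative (\<lambda>(t, x). differential_norm_sq M g N h (\<Psi> t) (chart_inv c x)) (at (0, x)) (1, 0)"
proof -
  obtain d where d: "d \<in> atlas N" "x \<in> map_dom c d (\<Psi> 0)" using map_dom_cover[OF c x] .
  define U where "U = var_rep c d \<Psi>"
  define W where "W = var_dom \<epsilon> c d \<Psi>"
  let ?S = "map_dom c d (\<Psi> 0)" and ?G = "metric_rep g c" and ?H = "metric_rep h d"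
  let ?u = "map_rep c d (\<Psi> 0)"
  have S: "open ?S" by (rule open_map_dom[OF M N \<Psi>0_smooth c d(1)])
  have Wopen: "open W" unfolding W_def by (rule open_var_dom[OF M N \<Psi> c d(1)])
  have zW: "(0, x) \<in> W" unfolding W_def var_dom_0_iff by (rule d(2))
  have U0: "?u y = U (0, y)" for y by (simp add: U_def var_rep_def)
  have V: "var_field c d \<Psi> y = frechet_derivative U (at (0, y)) (1, 0)" for y
    by (simp add: U_def var_field_def)
  have u1: "partial_deriv j ?u y = frechet_derivative U (at (0, y)) (0, axis j 1)" if "y \<in> ?S" for j y
    unfolding U_def using that by (intro partial_deriv_map_rep[OF M N \<Psi> c d(1)]) (simp add: var_dom_0_iff)
  have tU: "times_cont_diff_on k U W" for k unfolding U_def W_def by (rule tcd_var_rep[OF M N \<Psi> c d(1)])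
  have d2U: "((\<lambda>z. frechet_derivative U (at z) v) has_derivative frechet_derivative (\<lambda>z. frechet_derivative U (at z) v) (at z)) (at z)"
    if "z \<in> W" for v z
    by (rule tcd_has_derivative[OF tcd_frechet_derivative[OF tU] that])
  have Uz: "U (0, x) \<in> chart_img d"
    using zW by (auto simp: U_def W_def var_dom_def var_rep_def map_rep_def chart_map_in_img)
  define \<gamma> where "\<gamma> i j = matrix_inv (?G x) $ i $ j" for i j
  define dG where "dG i k l = partial_deriv i (\<lambda>y. ?G y $ k $ l) x" for i k l
  define s where "s = sqrt (det (?G x))"
  define ds where "ds i = partial_deriv i (\<lambda>y. sqrt (det (?G y))) x" for i
  define d\<gamma> where "d\<gamma> i k l = partial_deriv i (\<lambda>y. matrix_inv (?G y) $ k $ l) x" for i k l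
  define H where "H a b = ?H (U (0, x)) $ a $ b" for a b
  define dH where "dH e a b = partial_deriv e (\<lambda>y. ?H y $ a $ b) (U (0, x))" for e a b
  define Vx where "Vx a = frechet_derivative U (at (0, x)) (1, 0) $ a" for a
  define u where "u i a = frechet_derivative U (at (0, x)) (0, axis i 1) $ a" for i a
  define uu where "uu i j a = frechet_derivative (\<lambda>z. frechet_derivative U (at z) (0, axis j 1)) (at (0, x)) (0, axis i 1) $ a" for i j a
  define Wf where "Wf i a = frechet_derivative (\<lambda>z. frechet_derivative U (at z) (1, 0)) (at (0, x)) (0, axis i 1) $ a" for i a
  define K where "K j = (\<Sum>a\<in>UNIV. \<Sum>b\<in>UNIV. H a b * Vx a * u j b)" for j
  define Z where "Z i = partial_deriv i (\<lambda>x. sqrt (det (?G x)) * flux g N h c \<Psi> i x) x" for i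
  have Gpos: "det (?G y) > 0" if "y \<in> chart_img c" for y by (rule metric_rep_det_pos[OF g c that])
  have Ginv: "invertible (?G y)" if "y \<in> chart_img c" for y
    using Gpos[OF that] by (simp add: invertible_det_nz)
  have Gsym: "transpose (?G y) = ?G y" if "y \<in> chart_img c" for y
    unfolding metric_rep_def by (rule riemannian_metricD(2)[OF g c chart_map_inv(2)[OF that]])
  have Hsym: "transpose (?H y) = ?H y" if "y \<in> chart_img d" for y
    unfolding metric_rep_def by (rule riemannian_metricD(2)[OF h d(1) chart_map_inv(2)[OF that]])
  have Gs: "?G y $ k $ l = ?G y $ l $ k" if "y \<in> chart_img c" for y k l
    using arg_cong[OF Gsym[OF that], of "\<lambda>X. X $ l $ k"] by (simp add: transpose_def)
  have Hs: "?H y $ k $ l = ?H y $ l $ k" if "y \<in> chart_img d" for y k l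
    using arg_cong[OF Hsym[OF that], of "\<lambda>X. X $ l $ k"] by (simp add: transpose_def)
  have Gdiff: "?G differentiable at x"
    using riemannian_metricD(1)[OF g c, of "Suc 0"] x by simp
  have dg: "((\<lambda>y. matrix_inv (?G y)) has_derivative frechet_derivative (\<lambda>y. matrix_inv (?G y)) (at x)) (at x)"
    by (rule tcd_has_derivative[OF tcd_metric_inv[OF M g c] x])
  have dsq: "((\<lambda>y. sqrt (det (?G y))) has_derivative frechet_derivative (\<lambda>y. sqrt (det (?G y))) (at x)) (at x)"
    by (rule tcd_has_derivative[OF tcd_sqrt_det_metric[OF M g c] x])
  have ds: "ds i = 1/2 * s * (\<Sum>k\<in>UNIV. \<Sum>l\<in>UNIV. \<gamma> k l * dG i l k)" for i
  proof -
    have ddet: "((\<lambda>y. det (?G y)) has_derivative frechet_derivative (\<lambda>y. det (?G y)) (at x)) (at x)"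
      by (rule tcd_has_derivative[OF tcd_det_metric[OF M g c] x])
    have "((\<lambda>y. sqrt (det (?G y))) has_derivative
        (\<lambda>v. frechet_derivative (\<lambda>y. det (?G y)) (at x) v / (2 * sqrt (det (?G x))))) (at x)"
      using Gpos[OF x] by (auto intro!: derivative_eq_intros ddet simp: field_simps)
    from partial_deriv_eqI[OF this] have "ds i = partial_deriv i (\<lambda>y. det (?G y)) x / (2 * s)"
      by (simp add: ds_def s_def partial_deriv_def)
    also have "\<dots> = det (?G x) / (2 * s) * (\<Sum>k\<in>UNIV. \<Sum>l\<in>UNIV. \<gamma> k l * dG i l k)"
      using partial_deriv_det[OF Gdiff, of i] Gpos[OF x] by (simp add: \<gamma>_def dG_def)
    also have "det (?G x) / (2 * s) = 1/2 * s"
      using Gpos[OF x] real_sqrt_mult_self[of "det (?G x)"] by (simp add: s_def field_simps)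
    finally show ?thesis .
  qed
  have \<gamma>_sym: "\<gamma> i j = \<gamma> j i" for i j
    unfolding \<gamma>_def by (rule matrix_inv_sym_nth[OF Ginv[OF x] Gsym[OF x]])
  have div: "(\<Sum>i\<in>UNIV. ds i * \<gamma> i j + s * d\<gamma> i i j)
      = - s * (\<Sum>k\<in>UNIV. \<Sum>l\<in>UNIV. \<gamma> k l * christoffel g c j k l x)" for j
  proof (rule divergence_christoffel_identity[where dG = dG and d\<gamma> = d\<gamma>
        and \<Gamma> = "\<lambda>k i j. christoffel g c k i j x", OF \<gamma>_sym _ ds])
    show "dG i k l = dG i l k" for i k l
      unfolding dG_def by (rule partial_deriv_cong_open[OF chart_open(2)[OF M c] x Gs])
    show "d\<gamma> i k l = - (\<Sum>p\<in>UNIV. \<Sum>q\<in>UNIV. \<gamma> k p * dG i p q * \<gamma> q l)" for i k l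
      unfolding d\<gamma>_def \<gamma>_def dG_def
      by (rule partial_deriv_matrix_inv[OF Gdiff differentiableI[OF dg] chart_open(2)[OF M c] x Ginv])
    show "christoffel g c k i j x = 1 / 2 * (\<Sum>l\<in>UNIV. \<gamma> k l * (dG i j l + dG j i l - dG l i j))" for k i j
      unfolding christoffel_def \<gamma>_def dG_def ..
  qed
  \<comment> \<open>Multiplication by H cancels the inverse metric in the target Christoffel symbol
    and leaves the symbol of the first kind.\<close>
  have \<Gamma>N: "(\<Sum>f\<in>UNIV. H a f * christoffel h d f b e (U (0, x))) = 1/2 * (dH b e a + dH e b a - dH a b e)" for a b e
  proof -
    have inv: "invertible (?H (U (0, x)))"
      using metric_rep_det_pos[OF h d(1) Uz] by (simp add: invertible_det_nz)
    have \<delta>: "(\<Sum>f\<in>UNIV. H a f * matrix_inv (?H (U (0, x))) $ f $ l) = (if a = l then 1 else 0)" for l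
      using arg_cong[OF matrix_inv_left_right(1)[OF inv], of "\<lambda>X. X $ a $ l"]
      by (simp add: H_def matrix_matrix_mult_def mat_def)
    have "(\<Sum>f\<in>UNIV. H a f * christoffel h d f b e (U (0, x)))
      = (\<Sum>f\<in>UNIV. \<Sum>l\<in>UNIV. 1/2 * (H a f * matrix_inv (?H (U (0, x))) $ f $ l * (dH b e l + dH e b l - dH l b e)))"
      unfolding christoffel_def dH_def[symmetric] sum_distrib_left
      by (intro sum.cong refl) simp
    also have "\<dots> = (\<Sum>l\<in>UNIV. 1/2 * ((\<Sum>f\<in>UNIV. H a f * matrix_inv (?H (U (0, x))) $ f $ l) * (dH b e l + dH e b l - dH l b e)))"
      by (subst sum.swap) (simp add: sum_distrib_right sum_divide_distrib)
    also have "\<dots> = 1/2 * (dH b e a + dH e b a - dH a b e)"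
      unfolding \<delta> by (simp add: if_distrib[of "\<lambda>c. c * _"] if_distrib[of "\<lambda>c. c / _"] cong: if_cong)
    finally show ?thesis .
  qed
  have uu: "partial_deriv i (\<lambda>y. partial_deriv j ?u y $ a) x = uu i j a" for i j a
  proof -
    have "partial_deriv i (\<lambda>y. partial_deriv j ?u y $ a) x
        = partial_deriv i (\<lambda>y. frechet_derivative U (at (0, y)) (0, axis j 1) $ a) x"
      by (rule partial_deriv_cong_open[OF S d(2)]) (simp add: u1)
    also have "\<dots> = uu i j a"
      unfolding uu_def
      by (rule partial_deriv_eqI[OF has_derivative_vec_nth[OF has_derivative_compose[OF has_derivative_Pair_right d2U[OF zW]]]])
    finally show ?thesis .
  qed
  have tension: "(\<Sum>i\<in>UNIV. \<Sum>j\<in>UNIV. \<gamma> i j * (uu i j a - (\<Sum>k\<in>UNIV. christoffel g c k i j x * u k a)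
        + (\<Sum>b\<in>UNIV. \<Sum>e\<in>UNIV. christoffel h d a b e (U (0, x)) * u i b * u j e))) = 0" for a
  proof -
    let ?p = "chart_inv c x"
    have "?p \<in> chart_dom c" "chart_map c ?p = x" "\<Psi> 0 ?p \<in> chart_dom d"
      using chart_map_inv[OF x] d(2) by (auto simp: map_dom_def)
    then have "tension_field g h c d (\<Psi> 0) x = 0"
      using harm c d(1) unfolding harmonic_map_def by metis
    then have "tension_field g h c d (\<Psi> 0) x $ a = 0" by simp
    then show ?thesis
      unfolding tension_field_def second_fundamental_form_def Let_def uu
      by (simp add: u1[OF d(2)] U0 \<gamma>_def u_def)
  qed
  have K_eq: "frechet_derivative U (at (0, x)) (1, 0) \<bullet> (?H (U (0, x)) *v frechet_derivative U (at (0, x)) (0, axis j 1)) = K j" for j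
    unfolding K_def H_def Vx_def u_def
    by (simp add: inner_vec_def matrix_vector_mult_def sum_distrib_left mult.assoc mult.left_commute)
  \<comment> \<open>The product rule, arranged in the shape that
    \<open>divergence_energy_identity\<close> expects.\<close>
  have Z: "Z i = (\<Sum>j\<in>UNIV. ds i * \<gamma> i j * K j + s * d\<gamma> i i j * K j
        + s * \<gamma> i j * (\<Sum>a\<in>UNIV. \<Sum>b\<in>UNIV. (\<Sum>e\<in>UNIV. dH e a b * u i e) * Vx a * u j b
            + H a b * Wf i a * u j b + H a b * Vx a * uu i j b))" for i
  proof -
    let ?f = "\<lambda>y. sqrt (det (?G y)) * (\<Sum>j\<in>UNIV. matrix_inv (?G y) $ i $ j *
      (frechet_derivative U (at (0, y)) (1, 0) \<bullet> (?H (U (0, y)) *v frechet_derivative U (at (0, y)) (0, axis j 1))))"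
    have "Z i = partial_deriv i ?f x"
      unfolding Z_def
      by (rule partial_deriv_cong_open[OF S d(2)])
        (simp add: flux_eq_flux_comp[OF c d(1)] flux_comp_def V U0[symmetric] u1)
    moreover have "(?f has_derivative (\<lambda>v. s * (\<Sum>j\<in>UNIV. \<gamma> i j *
          (\<Sum>a\<in>UNIV. \<Sum>b\<in>UNIV. (\<Sum>e\<in>UNIV. dH e a b * frechet_derivative U (at (0, x)) (0, v) $ e) * Vx a * u j b
            + H a b * frechet_derivative (\<lambda>z. frechet_derivative U (at z) (1, 0)) (at (0, x)) (0, v) $ a * u j b
            + H a b * Vx a * frechet_derivative (\<lambda>z. frechet_derivative U (at z) (0, axis j 1)) (at (0, x)) (0, v) $ b)
        + frechet_derivative (\<lambda>y. matrix_inv (?G y)) (at x) v $ i $ j * K j)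
        + frechet_derivative (\<lambda>y. sqrt (det (?G y))) (at x) v * (\<Sum>j\<in>UNIV. \<gamma> i j * K j))) (at x)"
      unfolding s_def \<gamma>_def K_eq[symmetric] dH_def H_def Vx_def u_def
      using zW unfolding U_def W_def
      by (intro has_derivative_mult dsq has_derivative_sum has_derivative_vec_nth dg
          has_derivative_compose[OF has_derivative_Pair_right energy_form_has_derivative[OF c d(1)]])
    from partial_deriv_eqI[OF this] have "partial_deriv i ?f x = s * (\<Sum>j\<in>UNIV. \<gamma> i j *
          (\<Sum>a\<in>UNIV. \<Sum>b\<in>UNIV. (\<Sum>e\<in>UNIV. dH e a b * u i e) * Vx a * u j b
            + H a b * Wf i a * u j b + H a b * Vx a * uu i j b)
        + d\<gamma> i i j * K j) + ds i * (\<Sum>j\<in>UNIV. \<gamma> i j * K j)"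
      unfolding d\<gamma>_def ds_def partial_deriv_eqI[OF has_derivative_vec_nth[OF has_derivative_vec_nth[OF dg]]]
        partial_deriv_eqI[OF dsq] Wf_def[symmetric] uu_def[symmetric] u_def[symmetric] .
    ultimately show ?thesis
      by (simp add: sum_distrib_left sum.distrib distrib_left mult.assoc add.commute add.left_commute)
  qed
  \<comment> \<open>The flux involves the x-derivative of the variation field, the energy density
    the t-derivative of d\<psi>; equality of mixed derivatives identifies them.\<close>
  have Wsym: "frechet_derivative (\<lambda>z. frechet_derivative U (at z) (0, axis i 1)) (at (0, x)) (1, 0) $ a = Wf i a" for i a
    unfolding Wf_def using symmetric_second_derivative[OF tU Wopen zW] by metis
  \<comment> \<open>The density along t -> (t, x) is differentiated both as a smooth function on the
    product and through its coordinate formula; uniqueness of the derivative equates the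
    results.\<close>
  have D: "frechet_derivative (\<lambda>(t, x). differential_norm_sq M g N h (\<Psi> t) (chart_inv c x)) (at (0, x)) (1, 0)
      = (\<Sum>i\<in>UNIV. \<Sum>j\<in>UNIV. \<gamma> i j * (\<Sum>a\<in>UNIV. \<Sum>b\<in>UNIV. (\<Sum>e\<in>UNIV. dH e a b * Vx e) * u i a * u j b
        + H a b * Wf i a * u j b + H a b * u i a * Wf j b))"
  proof -
    let ?e = "\<lambda>(t, x). differential_norm_sq M g N h (\<Psi> t) (chart_inv c x)"
    let ?q = "\<lambda>i j z. frechet_derivative U (at z) (0, axis i 1) \<bullet> (?H (U z) *v frechet_derivative U (at z) (0, axis j 1))"
    have "(?e has_derivative frechet_derivative ?e (at (0, x))) (at (0, x))"
      by (rule tcd_has_derivative[OF tcd_energy_density[OF M N g h \<Psi> c]]) (use \<epsilon>_pos x in auto)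
    from has_derivative_compose[OF has_derivative_Pair_left this]
    have e1: "((\<lambda>t. ?e (t, x)) has_derivative (\<lambda>s. frechet_derivative ?e (at (0, x)) (s, 0))) (at 0)" .
    have "((\<lambda>t. \<Sum>i\<in>UNIV. \<Sum>j\<in>UNIV. \<gamma> i j * ?q i j (t, x)) has_derivative
       (\<lambda>s. \<Sum>i\<in>UNIV. \<Sum>j\<in>UNIV. \<gamma> i j * (\<Sum>a\<in>UNIV. \<Sum>b\<in>UNIV. (\<Sum>e\<in>UNIV. dH e a b * frechet_derivative U (at (0, x)) (s, 0) $ e) * u i a * u j b
        + H a b * frechet_derivative (\<lambda>z. frechet_derivative U (at z) (0, axis i 1)) (at (0, x)) (s, 0) $ a * u j b
        + H a b * u i a * frechet_derivative (\<lambda>z. frechet_derivative U (at z) (0, axis j 1)) (at (0, x)) (s, 0) $ b))) (at 0)"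
      unfolding dH_def H_def u_def
      using zW unfolding U_def W_def
      by (intro has_derivative_mult_right has_derivative_sum
          has_derivative_compose[OF has_derivative_Pair_left energy_form_has_derivative[OF c d(1)]])
    then have e2: "((\<lambda>t. ?e (t, x)) has_derivative
       (\<lambda>s. \<Sum>i\<in>UNIV. \<Sum>j\<in>UNIV. \<gamma> i j * (\<Sum>a\<in>UNIV. \<Sum>b\<in>UNIV. (\<Sum>e\<in>UNIV. dH e a b * frechet_derivative U (at (0, x)) (s, 0) $ e) * u i a * u j b
        + H a b * frechet_derivative (\<lambda>z. frechet_derivative U (at z) (0, axis i 1)) (at (0, x)) (s, 0) $ a * u j b
        + H a b * u i a * frechet_derivative (\<lambda>z. frechet_derivative U (at z) (0, axis j 1)) (at (0, x)) (s, 0) $ b))) (at 0)"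
    proof (rule has_derivative_transform_within_open)
      show "open ((\<lambda>t. (t, x)) -` W)"
        by (intro open_vimage Wopen continuous_intros)
      show "0 \<in> (\<lambda>t. (t, x)) -` W" using zW by simp
      show "(\<Sum>i\<in>UNIV. \<Sum>j\<in>UNIV. \<gamma> i j * ?q i j (t, x)) = ?e (t, x)" if "t \<in> (\<lambda>t. (t, x)) -` W" for t
        using energy_density_eq[OF M N g h \<Psi> c d(1), of t x] that by (simp add: W_def U_def \<gamma>_def)
    qed
    from fun_cong[OF has_derivative_unique[OF e1 e2], of 1] show ?thesis
      unfolding Wsym Vx_def[symmetric] .
  qed
  have dHs: "dH e a b = dH e b a" for e a b
    unfolding dH_def by (rule partial_deriv_cong_open[OF chart_open(2)[OF N d(1)] Uz Hs])
  have "(\<Sum>i\<in>UNIV. Z i) = s / 2 * (\<Sum>i\<in>UNIV. \<Sum>j\<in>UNIV. \<gamma> i j * (\<Sum>a\<in>UNIV. \<Sum>b\<in>UNIV. (\<Sum>e\<in>UNIV. dH e a b * Vx e) * u i a * u j b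
        + H a b * Wf i a * u j b + H a b * u i a * Wf j b))"
    by (rule divergence_energy_identity[where d\<gamma> = d\<gamma> and dH = dH and uu = uu
          and \<Gamma> = "\<lambda>k i j. christoffel g c k i j x" and \<Gamma>N = "\<lambda>f b e. christoffel h d f b e (U (0, x))",
          OF \<gamma>_sym _ dHs \<Gamma>N tension div K_def Z]) (simp add: H_def Hs[OF Uz])
  then show ?thesis
    unfolding D by (simp add: Z_def s_def)
qed

end

section \<open>Partition of unity and integration of the first variation\<close>

lemma borel_measurable_manifold:
  fixes F :: "'a \<Rightarrow> real"
  assumes M: "smooth_manifold (M :: ('a, 'm::finite) manifold)"
    and cont: "\<And>c. c \<in> atlas M \<Longrightarrow> continuous_on (chart_img c) (\<lambda>x. F (chart_inv c x))"
  shows "F \<in> borel_measurable (borel_manifold M)"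
proof (rule borel_measurableI)
  fix W :: "real set" assume W: "open W"
  have "openin (mtop M) (\<Union>c\<in>atlas M. {p \<in> chart_dom c. F p \<in> W})"
  proof (rule openin_Union, safe)
    fix c assume c: "c \<in> atlas M"
    have "open {x \<in> chart_img c. F (chart_inv c x) \<in> W}"
      using continuous_open_preimage[OF cont[OF c] chart_open(2)[OF M c] W]
      by (simp add: vimage_def Int_def)
    from openin_chart_map_vimage[OF M c this]
    have "openin (mtop M) {p \<in> chart_dom c. chart_map c p \<in> {x \<in> chart_img c. F (chart_inv c x) \<in> W}}" .
    also have "{p \<in> chart_dom c. chart_map c p \<in> {x \<in> chart_img c. F (chart_inv c x) \<in> W}} = {p \<in> chart_dom c. F p \<in> W}"
      by (auto simp: chart_map_in_img chart_inv_map[OF M c])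
    finally show "openin (mtop M) {p \<in> chart_dom c. F p \<in> W}" .
  qed
  also have "(\<Union>c\<in>atlas M. {p \<in> chart_dom c. F p \<in> W}) = F -` W \<inter> space (borel_manifold M)"
    unfolding space_borel_manifold smooth_manifoldD(3)[OF M, symmetric] by auto
  finally show "F -` W \<inter> space (borel_manifold M) \<in> sets (borel_manifold M)"
    by (rule openin_borel_manifold)
qed

lemma chart_inv_image_subset: "K \<subseteq> chart_img c \<Longrightarrow> chart_inv c ` K \<subseteq> chart_dom c"
  using chart_map_inv(2)[of _ c] by (auto simp: subset_iff)

lemma compactin_chart_inv_image:
  assumes M: "smooth_manifold M" and c: "c \<in> atlas M" and K: "compact K" "K \<subseteq> chart_img c"
  shows "compactin (mtop M) (chart_inv c ` K)"
proof (rule image_compactin[OF _ continuous_map_chart_inv[OF M c]])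
  show "compactin (top_of_set (chart_img c)) K"
    using K by (simp add: compactin_subtopology)
qed

text \<open>Compact sets in a Hausdorff space are closed. A function supported in the image of K
  therefore vanishes near every point outside this image, as seen in any other chart.\<close>

lemma open_outside_compact:
  assumes M: "smooth_manifold M" and c: "c \<in> atlas M" "c' \<in> atlas M" and K: "compact K" "K \<subseteq> chart_img c"
  shows "open {x \<in> chart_img c'. chart_inv c' x \<notin> chart_inv c ` K}"
proof -
  have "closedin (mtop M) (chart_inv c ` K)"
    by (rule compactin_imp_closedin[OF smooth_manifoldD(1)[OF M] compactin_chart_inv_image[OF M c(1) K]])
  then have "openin (mtop M) (topspace (mtop M) - chart_inv c ` K)" by blast
  note open_chart_inv_vimage[OF M c(2) this]
  moreover have "chart_inv c' x \<in> topspace (mtop M)" if "x \<in> chart_img c'" for x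
    using chart_map_inv(2)[OF that] chart_open(3)[OF M c(2)] by blast
  then have "{x \<in> chart_img c'. chart_inv c' x \<in> topspace (mtop M) - chart_inv c ` K}
      = {x \<in> chart_img c'. chart_inv c' x \<notin> chart_inv c ` K}" by auto
  ultimately show ?thesis by simp
qed

text \<open>In a chart around p, take the square of the positive part of r^2 - |y - a|^2 and extend
  it by 0. Its support is a closed ball inside the chart image, so the extension is C^1 in all
  charts.\<close>

lemma bump_function_exists:
  fixes M :: "('a, 'm::finite) manifold"
  assumes M: "smooth_manifold M" and p: "p \<in> topspace (mtop M)"
  shows "\<exists>c K \<phi>. c \<in> atlas M \<and> compact K \<and> K \<subseteq> chart_img c \<and> (\<forall>q. \<not> (q \<in> chart_dom c \<and> chart_map c q \<in> K) \<longrightarrow> \<phi> q = 0)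
    \<and> (\<forall>q. \<phi> q \<ge> (0::real)) \<and> \<phi> p > 0 \<and> openin (mtop M) {q \<in> topspace (mtop M). \<phi> q > 0}
    \<and> (\<forall>c'\<in>atlas M. times_cont_diff_on 1 (\<lambda>x. \<phi> (chart_inv c' x)) (chart_img c'))"
proof -
  obtain c where c: "c \<in> atlas M" "p \<in> chart_dom c"
    using smooth_manifoldD(3)[OF M] p by blast
  define a where "a = chart_map c p"
  obtain r where r: "r > 0" "cball a r \<subseteq> chart_img c"
    using chart_open(2)[OF M c(1)] chart_map_in_img[OF c(2)] unfolding a_def open_contains_cball by blast
  define \<beta> where "\<beta> y = (max 0 (r\<^sup>2 - (y - a) \<bullet> (y - a)))\<^sup>2" for y
  define \<phi> where "\<phi> q = (if q \<in> chart_dom c then \<beta> (chart_map c q) else 0)" for q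
  have \<beta>_tcd: "times_cont_diff_on 1 \<beta> UNIV"
    unfolding \<beta>_def
    by (rule tcd_compose[OF open_UNIV open_UNIV subset_UNIV tcd_max_power2])
      (intro tcd_diff tcd_inner tcd_const tcd_ident open_UNIV)
  have \<beta>_pos: "\<beta> y > 0 \<longleftrightarrow> y \<in> ball a r" for y
  proof -
    have "\<beta> y > 0 \<longleftrightarrow> (norm (y - a))\<^sup>2 < r\<^sup>2"
      unfolding \<beta>_def dot_square_norm by (auto simp: max_def)
    also have "\<dots> \<longleftrightarrow> norm (y - a) < r"
      using r(1) by (meson less_imp_le norm_ge_zero pos2 power2_less_imp_less power_strict_mono)
    finally show ?thesis by (simp add: dist_norm norm_minus_commute)
  qed
  have \<beta>_nonneg: "\<beta> y \<ge> 0" for y by (simp add: \<beta>_def)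
  have zero: "\<phi> q = 0" if "\<not> (q \<in> chart_dom c \<and> chart_map c q \<in> cball a r)" for q
    using that \<beta>_pos[of "chart_map c q"] \<beta>_nonneg[of "chart_map c q"] by (auto simp: \<phi>_def)
  have "openin (mtop M) {q \<in> chart_dom c. chart_map c q \<in> ball a r}"
    by (rule openin_chart_map_vimage[OF M c(1) open_ball])
  moreover have "{q \<in> chart_dom c. chart_map c q \<in> ball a r} = {q \<in> topspace (mtop M). \<phi> q > 0}"
    using chart_open(3)[OF M c(1)] \<beta>_pos by (auto simp: \<phi>_def split: if_splits)
  ultimately have op: "openin (mtop M) {q \<in> topspace (mtop M). \<phi> q > 0}" by simp
  have tcd: "times_cont_diff_on 1 (\<lambda>x. \<phi> (chart_inv c' x)) (chart_img c')" if c': "c' \<in> atlas M" for c'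
  proof (rule tcd_local)
    fix x assume x: "x \<in> chart_img c'"
    show "\<exists>T. open T \<and> x \<in> T \<and> times_cont_diff_on 1 (\<lambda>x. \<phi> (chart_inv c' x)) T"
    proof (cases "chart_inv c' x \<in> chart_dom c")
      case True
      let ?T = "chart_map c' ` (chart_dom c' \<inter> chart_dom c)"
      have T: "?T = {x \<in> chart_img c'. chart_inv c' x \<in> chart_dom c}"
        using chart_image_eq[OF M c', of "chart_dom c"] by (simp add: Int_commute)
      have oT: "open ?T"
        unfolding T by (rule open_chart_inv_vimage[OF M c' chart_open(1)[OF M c(1)]])
      have "times_cont_diff_on 1 (\<lambda>x. \<beta> ((chart_map c \<circ> chart_inv c') x)) ?T"
        by (rule tcd_compose[OF oT open_UNIV subset_UNIV \<beta>_tcd smooth_manifoldD(4)[OF M c' c(1)]])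
      then have "times_cont_diff_on 1 (\<lambda>x. \<phi> (chart_inv c' x)) ?T"
        by (rule tcd_cong[OF oT, rotated]) (simp add: T \<phi>_def)
      then show ?thesis using oT True x T by blast
    next
      \<comment> \<open>A point off the domain of c lies off the compact support, whose complement
        is an open neighbourhood on which the function is 0.\<close>
      case False
      let ?T = "{x \<in> chart_img c'. chart_inv c' x \<notin> chart_inv c ` cball a r}"
      have oT: "open ?T" by (rule open_outside_compact[OF M c(1) c' compact_cball r(2)])
      have "x \<in> ?T" using x False chart_inv_image_subset[OF r(2)] by auto
      moreover have "times_cont_diff_on 1 (\<lambda>x. \<phi> (chart_inv c' x)) ?T"
      proof (rule tcd_cong[OF oT _ tcd_const[of _ 0]])
        fix y assume y: "y \<in> ?T"
        have "\<not> (chart_inv c' y \<in> chart_dom c \<and> chart_map c (chart_inv c' y) \<in> cball a r)"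
        proof
          assume *: "chart_inv c' y \<in> chart_dom c \<and> chart_map c (chart_inv c' y) \<in> cball a r"
          then have "chart_inv c' y \<in> chart_inv c ` cball a r"
            by (intro image_eqI[of _ _ "chart_map c (chart_inv c' y)"]) (simp_all add: chart_inv_map[OF M c(1)])
          then show False using y by blast
        qed
        then show "0 = \<phi> (chart_inv c' y)" using zero by simp
      qed
      ultimately show ?thesis using oT by blast
    qed
  qed
  have pos: "\<phi> p > 0" using \<beta>_pos[of a] r(1) c(2) by (simp add: \<phi>_def a_def)
  have nonneg: "\<phi> q \<ge> 0" for q by (simp add: \<phi>_def \<beta>_nonneg)
  show ?thesis
    by (intro exI[of _ c] exI[of _ "cball a r"] exI[of _ \<phi>] conjI allI impI ballI
        c(1) compact_cball r(2) zero nonneg pos op tcd)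
qed

text \<open>The supports are recorded as compact subsets of coordinate space because the integrals
  are computed there.\<close>

definition chart_partition_of_unity ::
  "('a, 'm::finite) manifold \<Rightarrow> 'a set \<Rightarrow> ('a \<Rightarrow> ('a, 'm) chart) \<Rightarrow> ('a \<Rightarrow> (real^'m) set) \<Rightarrow> ('a \<Rightarrow> 'a \<Rightarrow> real) \<Rightarrow> bool" where
  "chart_partition_of_unity M I C K \<eta> \<longleftrightarrow> finite I \<and>
     (\<forall>i\<in>I. C i \<in> atlas M \<and> compact (K i) \<and> K i \<subseteq> chart_img (C i) \<and>
       (\<forall>q. \<not> (q \<in> chart_dom (C i) \<and> chart_map (C i) q \<in> K i) \<longrightarrow> \<eta> i q = 0) \<and>
       (\<forall>c\<in>atlas M. times_cont_diff_on 1 (\<lambda>x. \<eta> i (chart_inv c x)) (chart_img c))) \<and>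
     (\<forall>q\<in>topspace (mtop M). (\<Sum>i\<in>I. \<eta> i q) = 1)"

lemma chart_partition_of_unityD:
  assumes "chart_partition_of_unity M I C K \<eta>"
  shows "finite I" "i \<in> I \<Longrightarrow> C i \<in> atlas M" "i \<in> I \<Longrightarrow> compact (K i)" "i \<in> I \<Longrightarrow> K i \<subseteq> chart_img (C i)"
    "i \<in> I \<Longrightarrow> \<not> (q \<in> chart_dom (C i) \<and> chart_map (C i) q \<in> K i) \<Longrightarrow> \<eta> i q = 0"
    "i \<in> I \<Longrightarrow> c \<in> atlas M \<Longrightarrow> times_cont_diff_on 1 (\<lambda>x. \<eta> i (chart_inv c x)) (chart_img c)"
    "q \<in> topspace (mtop M) \<Longrightarrow> (\<Sum>i\<in>I. \<eta> i q) = 1"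
  using assms unfolding chart_partition_of_unity_def by auto

text \<open>By compactness finitely many bumps have a positive sum everywhere on M; each is divided
  by this sum.\<close>

lemma partition_of_unity_exists:
  fixes M :: "('a, 'm::finite) manifold"
  assumes M: "smooth_manifold M" and compact: "compact_space (mtop M)"
  shows "\<exists>I C K \<eta>. chart_partition_of_unity M I C K \<eta>"
proof -
  define Q where "Q p c K \<phi> \<longleftrightarrow> c \<in> atlas M \<and> compact K \<and> K \<subseteq> chart_img c
    \<and> (\<forall>q. \<not> (q \<in> chart_dom c \<and> chart_map c q \<in> K) \<longrightarrow> \<phi> q = 0)
    \<and> (\<forall>q. \<phi> q \<ge> 0) \<and> \<phi> p > 0 \<and> openin (mtop M) {q \<in> topspace (mtop M). \<phi> q > 0}
    \<and> (\<forall>c'\<in>atlas M. times_cont_diff_on 1 (\<lambda>x. \<phi> (chart_inv c' x)) (chart_img c'))"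
    for p :: 'a and c :: "('a, 'm) chart" and K :: "(real^'m) set" and \<phi> :: "'a \<Rightarrow> real"
  have "\<forall>p\<in>topspace (mtop M). \<exists>c K \<phi>. Q p c K \<phi>"
    unfolding Q_def using bump_function_exists[OF M] by blast
  then obtain C K \<phi> where "\<And>p. p \<in> topspace (mtop M) \<Longrightarrow> Q p (C p) (K p) (\<phi> p)"
    by metis
  note * = this[unfolded Q_def]
  define P where "P p = {q \<in> topspace (mtop M). \<phi> p q > 0}" for p
  have "(\<forall>U\<in>P ` topspace (mtop M). openin (mtop M) U)" "topspace (mtop M) \<subseteq> \<Union> (P ` topspace (mtop M))"
    using * by (auto simp: P_def)
  then obtain F where F: "finite F" "F \<subseteq> P ` topspace (mtop M)" "topspace (mtop M) \<subseteq> \<Union> F"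
    using compact unfolding compact_space_alt by metis
  then obtain I where I: "finite I" "I \<subseteq> topspace (mtop M)" "F = P ` I"
    by (meson finite_subset_image)
  define \<Phi> where "\<Phi> q = (\<Sum>i\<in>I. \<phi> i q)" for q
  have \<Phi>_pos: "\<Phi> q > 0" if q: "q \<in> topspace (mtop M)" for q
  proof -
    obtain i where "i \<in> I" "q \<in> P i" using F(3) I(3) q by blast
    then show ?thesis
      unfolding \<Phi>_def using * I by (intro sum_pos2[of I i]) (auto simp: P_def)
  qed
  have "chart_partition_of_unity M I C K (\<lambda>i q. \<phi> i q / \<Phi> q)"
    unfolding chart_partition_of_unity_def
  proof (intro conjI ballI allI impI)
    show "finite I" by fact
    fix i assume "i \<in> I"
    then have i: "i \<in> topspace (mtop M)" using I by blast
    show "C i \<in> atlas M" "compact (K i)" "K i \<subseteq> chart_img (C i)" using *[OF i] by auto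
    show "\<phi> i q / \<Phi> q = 0" if "\<not> (q \<in> chart_dom (C i) \<and> chart_map (C i) q \<in> K i)" for q
      using *[OF i] that by auto
    fix c assume c: "c \<in> atlas M"
    show "times_cont_diff_on 1 (\<lambda>x. \<phi> i (chart_inv c x) / \<Phi> (chart_inv c x)) (chart_img c)"
    proof (rule tcd_divide[OF chart_open(2)[OF M c]])
      show "times_cont_diff_on 1 (\<lambda>x. \<phi> i (chart_inv c x)) (chart_img c)" using *[OF i] c by blast
      have "times_cont_diff_on 1 (\<lambda>x. \<phi> j (chart_inv c x)) (chart_img c)" if "j \<in> I" for j
        using *[of j] c that I by blast
      then show "times_cont_diff_on 1 (\<lambda>x. \<Phi> (chart_inv c x)) (chart_img c)"
        unfolding \<Phi>_def by (rule tcd_sum[OF chart_open(2)[OF M c]])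
      show "\<Phi> (chart_inv c x) > 0" if "x \<in> chart_img c" for x
        using \<Phi>_pos chart_map_inv(2)[OF that] chart_open(3)[OF M c] by blast
    qed
  next
    fix q assume "q \<in> topspace (mtop M)"
    then show "(\<Sum>i\<in>I. \<phi> i q / \<Phi> q) = 1"
      using \<Phi>_pos[of q] by (simp add: \<Phi>_def sum_divide_distrib[symmetric])
  qed
  then show ?thesis by blast
qed

lemma tcd_extend_zero:
  fixes F :: "'a::euclidean_space \<Rightarrow> real"
  assumes "open S" "compact K" "K \<subseteq> S" "times_cont_diff_on k F S" "\<And>x. x \<in> S \<Longrightarrow> x \<notin> K \<Longrightarrow> F x = 0"
  shows "times_cont_diff_on k (\<lambda>x. if x \<in> S then F x else 0) UNIV"
proof (rule tcd_local)
  fix x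
  show "\<exists>T. open T \<and> x \<in> T \<and> times_cont_diff_on k (\<lambda>x. if x \<in> S then F x else 0) T"
  proof (cases "x \<in> S")
    case True
    have "times_cont_diff_on k (\<lambda>x. if x \<in> S then F x else 0) S"
      by (rule tcd_cong[OF assms(1) _ assms(4)]) simp
    then show ?thesis using assms(1) True by blast
  next
    case False
    have op: "open (- K)" using compact_imp_closed[OF assms(2)] by blast
    have "times_cont_diff_on k (\<lambda>x. if x \<in> S then F x else 0) (- K)"
      by (rule tcd_cong[OF op _ tcd_const[of _ 0]]) (use assms(5) in auto)
    then show ?thesis using op False assms(3) by blast
  qed
qed

lemma integrable_indicator_compact:
  fixes f :: "'a::euclidean_space \<Rightarrow> real"
  assumes "compact K" "continuous_on K f"
  shows "integrable lborel (\<lambda>x. indicator K x * f x)"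
  using borel_integrable_compact[OF assms] by (simp add: indicator_def if_distrib cong: if_cong)

section \<open>Integration by parts and vanishing of the first variation\<close>

text \<open>The product \<eta> w X_i extends by zero to a C^1 function with compact support, so the
  integral of its i-th derivative is 0. The product rule splits this derivative into the two
  integrands.\<close>

lemma integral_divergence_compact_support:
  fixes \<eta> w :: "real^'m \<Rightarrow> real" and X :: "'m \<Rightarrow> real^'m \<Rightarrow> real"
  assumes S: "open S" and K: "compact K" "K \<subseteq> S"
    and \<eta>: "times_cont_diff_on 1 \<eta> S" "\<And>x. x \<in> S \<Longrightarrow> x \<notin> K \<Longrightarrow> \<eta> x = 0"
    and w: "times_cont_diff_on 1 w S" and X: "\<And>i. times_cont_diff_on 1 (X i) S"
  shows "(LINT x|lborel. indicator K x * (\<eta> x * (\<Sum>i\<in>UNIV. partial_deriv i (\<lambda>x. w x * X i x) x)))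
    = - (LINT x|lborel. indicator K x * (w x * (\<Sum>i\<in>UNIV. partial_deriv i \<eta> x * X i x)))"
proof -
  have wX: "times_cont_diff_on 1 (\<lambda>x. w x * X i x) S" for i
    by (intro tcd_mult S w X)
  define F where "F i x = (if x \<in> S then \<eta> x * (w x * X i x) else 0)" for i x
  have tF: "times_cont_diff_on 1 (F i) UNIV" for i
    unfolding F_def
    by (rule tcd_extend_zero[OF S K tcd_mult[OF S \<eta>(1) wX]]) (simp add: \<eta>(2))
  have F0: "F i x = 0" if "x \<notin> K" for i x
    using that \<eta>(2) by (auto simp: F_def)
  have d\<eta>: "(\<eta> has_derivative frechet_derivative \<eta> (at x)) (at x)" if "x \<in> S" for x
    using tcd_has_derivative[of 0 \<eta> S x] \<eta>(1) that by simp
  have dwX: "((\<lambda>x. w x * X i x) has_derivative frechet_derivative (\<lambda>x. w x * X i x) (at x)) (at x)" if "x \<in> S" for x i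
    using tcd_has_derivative[of 0 "\<lambda>x. w x * X i x" S x] wX[of i] that by simp
  have dF: "frechet_derivative (F i) (at x) (axis i 1) = indicator K x * (\<eta> x * partial_deriv i (\<lambda>x. w x * X i x) x)
      + indicator K x * (w x * (partial_deriv i \<eta> x * X i x))" for i x
  proof (cases "x \<in> K")
    case True
    then have x: "x \<in> S" using K(2) by blast
    have "partial_deriv i (F i) x = partial_deriv i (\<lambda>x. \<eta> x * (w x * X i x)) x"
      by (rule partial_deriv_cong_open[OF S x]) (simp add: F_def)
    also have "\<dots> = \<eta> x * partial_deriv i (\<lambda>x. w x * X i x) x + partial_deriv i \<eta> x * (w x * X i x)"
      using partial_deriv_eqI[OF has_derivative_mult[OF d\<eta>[OF x] dwX[OF x]]] by (simp add: partial_deriv_def)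
    finally show ?thesis using True by (simp add: partial_deriv_def algebra_simps)
  next
    case False
    have "partial_deriv i (F i) x = partial_deriv i (\<lambda>x. 0) x"
      by (rule partial_deriv_cong_open[of "- K"]) (use False F0 compact_imp_closed[OF K(1)] in auto)
    then show ?thesis using False by (simp add: partial_deriv_def frechet_derivative_const)
  qed
  note cont = continuous_on_subset[OF tcd_continuous_on[OF \<eta>(1)] K(2)]
    continuous_on_subset[OF tcd_continuous_on[OF w] K(2)]
    continuous_on_subset[OF tcd_continuous_on[OF X] K(2)]
    continuous_on_subset[OF tcd_continuous_on[OF tcd_frechet_derivative[OF \<eta>(1)[unfolded One_nat_def]]] K(2)]
    continuous_on_subset[OF tcd_continuous_on[OF tcd_frechet_derivative[OF wX[unfolded One_nat_def]]] K(2)]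
  have int1: "integrable lborel (\<lambda>x. indicator K x * (\<eta> x * partial_deriv i (\<lambda>x. w x * X i x) x))" for i
    unfolding partial_deriv_def by (intro integrable_indicator_compact K(1) continuous_intros cont)
  have int2: "integrable lborel (\<lambda>x. indicator K x * (w x * (partial_deriv i \<eta> x * X i x)))" for i
    unfolding partial_deriv_def by (intro integrable_indicator_compact K(1) continuous_intros cont)
  have zero: "(LINT x|lborel. indicator K x * (\<eta> x * partial_deriv i (\<lambda>x. w x * X i x) x))
      + (LINT x|lborel. indicator K x * (w x * (partial_deriv i \<eta> x * X i x))) = 0" for i
    using integral_frechet_derivative_eq_0[OF tF K(1) F0, of i "axis i 1"] int1[of i] int2[of i]
    unfolding dF by simp
  have "(LINT x|lborel. indicator K x * (\<eta> x * (\<Sum>i\<in>UNIV. partial_deriv i (\<lambda>x. w x * X i x) x)))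
      = (\<Sum>i\<in>UNIV. LINT x|lborel. indicator K x * (\<eta> x * partial_deriv i (\<lambda>x. w x * X i x) x))"
    unfolding sum_distrib_left by (rule Bochner_Integration.integral_sum) (rule int1)
  moreover have "(LINT x|lborel. indicator K x * (w x * (\<Sum>i\<in>UNIV. partial_deriv i \<eta> x * X i x)))
      = (\<Sum>i\<in>UNIV. LINT x|lborel. indicator K x * (w x * (partial_deriv i \<eta> x * X i x)))"
    unfolding sum_distrib_left by (rule Bochner_Integration.integral_sum) (rule int2)
  ultimately show ?thesis
    using zero by (simp add: sum.distrib[symmetric] eq_neg_iff_add_eq_0)
qed

context
  fixes M :: "('a, 'm::finite) manifold" and N :: "('b, 'n::finite) manifold"
    and g :: "('a, 'm) metric" and h :: "('b, 'n) metric"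
    and \<psi> :: "'a \<Rightarrow> 'b" and \<epsilon> :: real and \<Psi> :: "real \<Rightarrow> 'a \<Rightarrow> 'b"
  assumes M: "smooth_manifold M" and N: "smooth_manifold N"
    and g: "riemannian_metric M g" and h: "riemannian_metric N h"
    and \<Psi>: "smooth_variation M N \<psi> \<epsilon> \<Psi>"
begin

text \<open>The derivative of \<eta> along the flux vector field, that is, the scalar left over by
  integration by parts against \<eta>.\<close>

definition flux_derivative :: "('a, 'm) chart \<Rightarrow> ('a \<Rightarrow> real) \<Rightarrow> real^'m \<Rightarrow> real" where
  "flux_derivative c \<eta> x = (\<Sum>i\<in>UNIV. partial_deriv i (\<lambda>x. \<eta> (chart_inv c x)) x * flux g N h c \<Psi> i x)"

lemma flux_derivative_chart_independent:
  assumes c: "c \<in> atlas M" "c' \<in> atlas M" and p: "p \<in> chart_dom c" "p \<in> chart_dom c'"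
    and \<eta>: "times_cont_diff_on 1 (\<lambda>x. \<eta> (chart_inv c' x)) (chart_img c')"
  shows "flux_derivative c \<eta> (chart_map c p) = flux_derivative c' \<eta> (chart_map c' p)"
proof -
  let ?J = "jacobian (chart_map c' \<circ> chart_inv c) (at (chart_map c p))"
  define \<omega> where "\<omega> = (\<chi> i. partial_deriv i (\<lambda>x. \<eta> (chart_inv c' x)) (chart_map c' p))"
  let ?f = "\<lambda>x. \<eta> (chart_inv c' x)"
  have cp: "(chart_map c' \<circ> chart_inv c) (chart_map c p) = chart_map c' p"
    by (simp add: chart_inv_map[OF M c(1) p(1)])
  have df: "(?f has_derivative frechet_derivative ?f (at (chart_map c' p))) (at (chart_map c' p))"
    using tcd_has_derivative[of 0 ?f "chart_img c'"] \<eta> chart_map_in_img[OF p(2)] by simp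
  have "((\<lambda>x. ?f ((chart_map c' \<circ> chart_inv c) x)) has_derivative (\<lambda>v. frechet_derivative ?f (at (chart_map c' p)) (?J *v v))) (at (chart_map c p))"
    by (rule has_derivative_compose[OF transition_has_derivative[OF M c p]]) (unfold cp, rule df)
  then have "((\<lambda>x. \<eta> (chart_inv c x)) has_derivative (\<lambda>v. frechet_derivative ?f (at (chart_map c' p)) (?J *v v))) (at (chart_map c p))"
  proof (rule has_derivative_transform_within_open)
    show "open {x \<in> chart_img c. chart_inv c x \<in> chart_dom c'}"
      by (rule open_chart_inv_vimage[OF M c(1) chart_open(1)[OF M c(2)]])
  qed (use p in \<open>auto simp: chart_map_in_img chart_inv_map[OF M c(1)] chart_inv_map[OF M c(2)]\<close>)
  note d = partial_deriv_eqI[OF this]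
  have "partial_deriv i (\<lambda>x. \<eta> (chart_inv c x)) (chart_map c p) = (transpose ?J *v \<omega>) $ i" for i
  proof -
    have "partial_deriv i (\<lambda>x. \<eta> (chart_inv c x)) (chart_map c p)
        = (\<Sum>k\<in>UNIV. (?J *v axis i 1) $ k *\<^sub>R frechet_derivative ?f (at (chart_map c' p)) (axis k 1))"
      unfolding d by (rule linear_axis_expansion[OF has_derivative_linear[OF df]])
    also have "\<dots> = (\<Sum>k\<in>UNIV. ?J $ k $ i * \<omega> $ k)"
      by (simp add: \<omega>_def partial_deriv_def matrix_vector_mult_basis column_def)
    also have "\<dots> = (transpose ?J *v \<omega>) $ i"
      by (simp add: matrix_vector_mult_def transpose_def)
    finally show ?thesis .
  qed
  then show ?thesis
    using flux_transition[OF M N g h \<Psi> c p, of \<omega>] by (simp add: flux_derivative_def \<omega>_def)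
qed

lemma continuous_on_flux_derivative:
  assumes c: "c \<in> atlas M" and \<eta>: "times_cont_diff_on 1 (\<lambda>x. \<eta> (chart_inv c x)) (chart_img c)"
  shows "continuous_on (chart_img c) (flux_derivative c \<eta>)"
  unfolding flux_derivative_def partial_deriv_def using \<eta>
  by (auto intro!: continuous_intros tcd_continuous_on[OF tcd_flux[OF M N g h \<Psi> c, of 0]])

lemma flux_derivative_sum_zero:
  assumes c: "c \<in> atlas M" and x: "x \<in> chart_img c" and "finite I"
    and \<eta>: "\<And>i. i \<in> I \<Longrightarrow> times_cont_diff_on 1 (\<lambda>x. \<eta> i (chart_inv c x)) (chart_img c)"
    and one: "\<And>q. q \<in> topspace (mtop M) \<Longrightarrow> (\<Sum>i\<in>I. \<eta> i q) = 1"
  shows "(\<Sum>i\<in>I. flux_derivative c (\<eta> i) x) = 0"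
proof -
  have d: "((\<lambda>x. \<eta> i (chart_inv c x)) has_derivative frechet_derivative (\<lambda>x. \<eta> i (chart_inv c x)) (at x)) (at x)" if "i \<in> I" for i
    using tcd_has_derivative[of 0 "\<lambda>x. \<eta> i (chart_inv c x)" "chart_img c"] \<eta>[OF that] x by simp
  have "((\<lambda>x. \<Sum>i\<in>I. \<eta> i (chart_inv c x)) has_derivative (\<lambda>v. \<Sum>i\<in>I. frechet_derivative (\<lambda>x. \<eta> i (chart_inv c x)) (at x) v)) (at x)"
    by (rule has_derivative_sum) (rule d)
  then have "((\<lambda>x. 1) has_derivative (\<lambda>v. \<Sum>i\<in>I. frechet_derivative (\<lambda>x. \<eta> i (chart_inv c x)) (at x) v)) (at x)"
  proof (rule has_derivative_transform_within_open[OF _ chart_open(2)[OF M c] x])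
    fix y assume "y \<in> chart_img c"
    then show "(\<Sum>i\<in>I. \<eta> i (chart_inv c y)) = 1"
      using one chart_map_inv(2) chart_open(3)[OF M c] by blast
  qed
  then have "(\<lambda>v. \<Sum>i\<in>I. frechet_derivative (\<lambda>x. \<eta> i (chart_inv c x)) (at x) v) = (\<lambda>v. 0)"
    by (rule has_derivative_unique) simp
  then have "(\<Sum>i\<in>I. partial_deriv j (\<lambda>x. \<eta> i (chart_inv c x)) x) = 0" for j
    unfolding partial_deriv_def by (rule fun_cong)
  then show ?thesis
    unfolding flux_derivative_def by (subst sum.swap) (simp add: sum_distrib_right[symmetric])
qed

text \<open>Integration by parts in chart i leaves -2 times the integral of the derivative of
  \<eta>_i along the flux. These are integrals over M of chart independent scalars, so they can be
  added under one integral, and the sum of the \<eta>_i is constant.\<close>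

lemma integral_energy_variation_zero:
  assumes compact: "compact_space (mtop M)" and harm: "harmonic_map M g N h (\<Psi> 0)"
    and part: "chart_partition_of_unity M I C K \<eta>"
  shows "(\<Sum>i\<in>I. LINT x|lborel. indicator (K i) x * (\<eta> i (chart_inv (C i) x) * (sqrt (det (metric_rep g (C i) x)) *
    frechet_derivative (\<lambda>(t, x). differential_norm_sq M g N h (\<Psi> t) (chart_inv (C i) x)) (at (0, x)) (1, 0)))) = 0"
proof -
  note I = chart_partition_of_unityD(1)[OF part] and C = chart_partition_of_unityD(2)[OF part]
    and K = chart_partition_of_unityD(3,4)[OF part] and supp = chart_partition_of_unityD(5)[OF part]
    and \<eta> = chart_partition_of_unityD(6)[OF part] and one = chart_partition_of_unityD(7)[OF part]
  let ?w = "\<lambda>i x. sqrt (det (metric_rep g (C i) x))"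
  have supp': "\<eta> i (chart_inv (C i) x) = 0" if "i \<in> I" "x \<in> chart_img (C i)" "x \<notin> K i" for i x
    using supp[OF that(1), of "chart_inv (C i) x"] chart_map_inv[OF that(2)] that(3) by simp
  have local: "(LINT x|lborel. indicator (K i) x * (\<eta> i (chart_inv (C i) x) * (?w i x *
      frechet_derivative (\<lambda>(t, x). differential_norm_sq M g N h (\<Psi> t) (chart_inv (C i) x)) (at (0, x)) (1, 0))))
    = - 2 * (LINT x|lborel. indicator (K i) x * (?w i x * flux_derivative (C i) (\<eta> i) x))" (is "?lhs = _") if i: "i \<in> I" for i
  proof -
    have "?lhs = (LINT x|lborel. 2 * (indicator (K i) x * (\<eta> i (chart_inv (C i) x) *
        (\<Sum>j\<in>UNIV. partial_deriv j (\<lambda>x. ?w i x * flux g N h (C i) \<Psi> j x) x))))"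
    proof (intro Bochner_Integration.integral_cong refl)
      fix x
      show "indicator (K i) x * (\<eta> i (chart_inv (C i) x) * (?w i x *
          frechet_derivative (\<lambda>(t, x). differential_norm_sq M g N h (\<Psi> t) (chart_inv (C i) x)) (at (0, x)) (1, 0)))
        = 2 * (indicator (K i) x * (\<eta> i (chart_inv (C i) x) *
          (\<Sum>j\<in>UNIV. partial_deriv j (\<lambda>x. ?w i x * flux g N h (C i) \<Psi> j x) x)))"
        using energy_variation_divergence[OF M N g h \<Psi> C[OF i] _ harm, of x, symmetric] K(2)[OF i]
        by (cases "x \<in> K i") (auto simp: subset_iff)
    qed
    also have "\<dots> = 2 * (LINT x|lborel. indicator (K i) x * (\<eta> i (chart_inv (C i) x) *
        (\<Sum>j\<in>UNIV. partial_deriv j (\<lambda>x. ?w i x * flux g N h (C i) \<Psi> j x) x)))"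
      by simp
    also have "\<dots> = - 2 * (LINT x|lborel. indicator (K i) x * (?w i x * flux_derivative (C i) (\<eta> i) x))"
      unfolding flux_derivative_def
      by (subst integral_divergence_compact_support[OF chart_open(2)[OF M C[OF i]] K(1,2)[OF i] \<eta>[OF i C[OF i]]
            supp'[OF i] tcd_sqrt_det_metric[OF M g C[OF i]] tcd_flux[OF M N g h \<Psi> C[OF i]]]) simp_all
    finally show ?thesis .
  qed
  \<comment> \<open>The leftover scalar as a function on M; any chart around p gives the same value.
    The default 0 off M makes both the support condition and the vanishing of the sum hold at every
    point of the type.\<close>
  define y where "y i p = (if p \<in> topspace (mtop M) then flux_derivative (chart_at M p) (\<eta> i) (chart_map (chart_at M p) p) else 0)" for i p
  have y_chart: "y i p = flux_derivative c (\<eta> i) (chart_map c p)" if "i \<in> I" "c \<in> atlas M" "p \<in> chart_dom c" for i c p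
  proof -
    have p: "p \<in> topspace (mtop M)" using that chart_open(3)[OF M] by blast
    show ?thesis
      unfolding y_def using p flux_derivative_chart_independent[OF chart_at(1)[OF M p] that(2) chart_at(2)[OF M p] that(3) \<eta>[OF that(1,2)]]
      by simp
  qed
  have y_rep: "y i (chart_inv c x) = flux_derivative c (\<eta> i) x" if "i \<in> I" "c \<in> atlas M" "x \<in> chart_img c" for i c x
    using y_chart[OF that(1,2) chart_map_inv(2)[OF that(3)]] chart_map_inv(1)[OF that(3)] by simp
  have y_meas: "y i \<in> borel_measurable (borel_manifold M)" if "i \<in> I" for i
  proof (rule borel_measurable_manifold[OF M])
    fix c assume c: "c \<in> atlas M"
    have "continuous_on (chart_img c) (flux_derivative c (\<eta> i))"
      by (rule continuous_on_flux_derivative[OF c \<eta>[OF that c]])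
    then show "continuous_on (chart_img c) (\<lambda>x. y i (chart_inv c x))"
      by (rule continuous_on_eq) (simp add: y_rep[OF that c])
  qed
  have y_zero: "y i p = 0" if i: "i \<in> I" and p: "p \<notin> chart_inv (C i) ` K i" for i p
  proof (cases "p \<in> topspace (mtop M)")
    case True
    obtain c where c: "c \<in> atlas M" "p \<in> chart_dom c" using chart_at[OF M True] by blast
    let ?T = "{x \<in> chart_img c. chart_inv c x \<notin> chart_inv (C i) ` K i}"
    have T: "open ?T" by (rule open_outside_compact[OF M C[OF i] c(1) K(1,2)[OF i]])
    have pT: "chart_map c p \<in> ?T" using p c by (simp add: chart_map_in_img chart_inv_map[OF M c(1)])
    have "\<eta> i (chart_inv c x) = 0" if "x \<in> ?T" for x
    proof (rule supp[OF i])
      show "\<not> (chart_inv c x \<in> chart_dom (C i) \<and> chart_map (C i) (chart_inv c x) \<in> K i)"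
      proof
        assume *: "chart_inv c x \<in> chart_dom (C i) \<and> chart_map (C i) (chart_inv c x) \<in> K i"
        then have "chart_inv c x \<in> chart_inv (C i) ` K i"
          by (intro image_eqI[of _ _ "chart_map (C i) (chart_inv c x)"]) (simp_all add: chart_inv_map[OF M C[OF i]])
        then show False using that by blast
      qed
    qed
    then have "partial_deriv j (\<lambda>x. \<eta> i (chart_inv c x)) (chart_map c p) = partial_deriv j (\<lambda>x. 0) (chart_map c p)" for j
      by (intro partial_deriv_cong_open[OF T pT])
    then show ?thesis
      unfolding y_chart[OF i c] flux_derivative_def by (simp add: partial_deriv_def frechet_derivative_const)
  qed (simp add: y_def)
  have y_dom: "y i p = 0" if "i \<in> I" "p \<notin> chart_dom (C i)" for i p
    using that chart_inv_image_subset[OF K(2)[OF that(1)]] by (intro y_zero) auto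
  have y_fun: "indicator (chart_img (C i)) x * (?w i x * y i (chart_inv (C i) x))
      = indicator (K i) x * (?w i x * flux_derivative (C i) (\<eta> i) x)" if i: "i \<in> I" for i x
  proof (cases "x \<in> chart_img (C i)")
    case True
    have "y i (chart_inv (C i) x) = 0" if "x \<notin> K i"
    proof (rule y_zero[OF i], rule)
      assume "chart_inv (C i) x \<in> chart_inv (C i) ` K i"
      then obtain z where "z \<in> K i" "chart_inv (C i) x = chart_inv (C i) z" by blast
      then show False
        using chart_map_inv(1)[OF True] chart_map_inv(1)[of z "C i"] K(2)[OF i] \<open>x \<notin> K i\<close> by (metis subsetD)
    qed
    then show ?thesis using True y_rep[OF i C[OF i] True] by (auto simp: indicator_def)
  qed (use K(2)[OF i] in \<open>auto simp: indicator_def subset_iff\<close>)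
  have int: "integrable (volume_measure M g) (y i)" if i: "i \<in> I" for i
  proof (rule volume_measure_chart_integral(2)[OF M g compact C[OF i] y_meas[OF i] y_dom[OF i], THEN iffD2])
    show "integrable lborel (\<lambda>x. indicator (chart_img (C i)) x * (?w i x * y i (chart_inv (C i) x)))"
      unfolding y_fun[OF i]
      by (intro integrable_indicator_compact K(1)[OF i] continuous_on_mult
          continuous_on_subset[OF _ K(2)[OF i]] continuous_on_flux_derivative C[OF i] \<eta>[OF i C[OF i]]
          tcd_continuous_on[OF tcd_sqrt_det_metric[OF M g C[OF i], of 0]])
  qed
  have "(\<Sum>i\<in>I. LINT x|lborel. indicator (K i) x * (?w i x * flux_derivative (C i) (\<eta> i) x))
      = (\<Sum>i\<in>I. LINT p|volume_measure M g. y i p)"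
    by (intro sum.cong refl)
      (simp add: volume_measure_chart_integral(1)[OF M g compact C y_meas y_dom] y_fun)
  also have "\<dots> = (LINT p|volume_measure M g. (\<Sum>i\<in>I. y i p))"
    by (rule Bochner_Integration.integral_sum[symmetric]) (rule int)
  also have "\<dots> = 0"
  proof -
    have "(\<Sum>i\<in>I. y i p) = 0" for p
    proof (cases "p \<in> topspace (mtop M)")
      case True
      note c = chart_at[OF M True]
      have "(\<Sum>i\<in>I. y i p) = (\<Sum>i\<in>I. flux_derivative (chart_at M p) (\<eta> i) (chart_map (chart_at M p) p))"
        by (intro sum.cong refl y_chart c)
      also have "\<dots> = 0"
        by (rule flux_derivative_sum_zero[OF c(1) chart_map_in_img[OF c(2)] I \<eta>[OF _ c(1)] one])
      finally show ?thesis .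
    qed (simp add: y_def)
    then show ?thesis by simp
  qed
  finally have "(\<Sum>i\<in>I. LINT x|lborel. indicator (K i) x * (?w i x * flux_derivative (C i) (\<eta> i) x)) = 0" .
  then show ?thesis
    by (simp add: local sum_negf sum_distrib_left[symmetric])
qed

end

section \<open>Conformal change of the metric\<close>

lemma matrix_inv_scaleR:
  fixes A :: "real^'n^'n"
  assumes "k \<noteq> 0" "invertible A"
  shows "matrix_inv (k *\<^sub>R A) = (1 / k) *\<^sub>R matrix_inv A"
proof (rule matrix_inv_eqI)
  have "(k *\<^sub>R A) ** ((1 / k) *\<^sub>R matrix_inv A) = A ** matrix_inv A"
    using assms(1) by (simp add: matrix_matrix_mult_def vec_eq_iff)
  then show "(k *\<^sub>R A) ** ((1 / k) *\<^sub>R matrix_inv A) = mat 1"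
    using matrix_inv_left_right(1)[OF assms(2)] by simp
qed

lemma det_scaleR: "det (k *\<^sub>R A) = k ^ CARD('n) * det A" for A :: "real^'n^'n"
  by (simp add: det_def prod.distrib sum_distrib_left mult.assoc mult.left_commute)

lemma sqrt_power_powr: "f > 0 \<Longrightarrow> sqrt (f ^ n) = f powr (real n / 2)" for f :: real
  by (simp add: powr_half_sqrt[symmetric] powr_realpow[symmetric] powr_powr)

section \<open>The conformal metric and its \<alpha>-energy\<close>

lemma riemannian_metric_conformal:
  assumes M: "smooth_manifold M" and g: "riemannian_metric M g" and f: "smooth_function M f"
    and pos: "\<And>p. p \<in> topspace (mtop M) \<Longrightarrow> f p > 0"
  shows "riemannian_metric M (\<lambda>c p. f p *\<^sub>R g c p)"
  unfolding riemannian_metric_def Let_def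
proof (intro conjI ballI allI impI)
  fix c assume c: "c \<in> atlas M"
  show "smooth_on (metric_rep (\<lambda>c p. f p *\<^sub>R g c p) c) (chart_img c)"
    unfolding smooth_on_def
  proof
    fix k
    have "times_cont_diff_on k (\<lambda>x. (f \<circ> chart_inv c) x *\<^sub>R metric_rep g c x) (chart_img c)"
      using f c unfolding smooth_function_def smooth_on_def
      by (intro tcd_scaleR chart_open(2)[OF M c] riemannian_metricD(1)[OF g c]) blast
    then show "times_cont_diff_on k (metric_rep (\<lambda>c p. f p *\<^sub>R g c p) c) (chart_img c)"
      by (simp add: metric_rep_def[abs_def])
  qed
  fix p assume p: "p \<in> chart_dom c"
  then have fp: "f p > 0" using pos chart_open(3)[OF M c] by blast
  show "transpose (f p *\<^sub>R g c p) = f p *\<^sub>R g c p"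
    using riemannian_metricD(2)[OF g c p] by (simp add: transpose_def vec_eq_iff)
  show "v \<bullet> ((f p *\<^sub>R g c p) *v v) > 0" if "v \<noteq> 0" for v
    using riemannian_metricD(3)[OF g c p that] fp by (simp add: scaleR_matrix_vector_assoc[symmetric])
next
  fix c d p assume c: "c \<in> atlas M" "d \<in> atlas M" and p: "p \<in> chart_dom c \<inter> chart_dom d"
  let ?J = "jacobian (chart_map d \<circ> chart_inv c) (at (chart_map c p))"
  have "g c p = transpose ?J ** g d p ** ?J"
    using p by (intro riemannian_metricD(4)[OF g c]) auto
  moreover have "transpose ?J ** (f p *\<^sub>R g d p) ** ?J = f p *\<^sub>R (transpose ?J ** g d p ** ?J)"
    by (simp add: matrix_matrix_mult_def vec_eq_iff sum_distrib_left sum_distrib_right mult.assoc mult.left_commute)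
  ultimately show "f p *\<^sub>R g c p = transpose ?J ** (f p *\<^sub>R g d p) ** ?J"
    by simp
qed

lemma differential_norm_sq_conformal:
  assumes M: "smooth_manifold M" and g: "riemannian_metric M g" and p: "p \<in> topspace (mtop M)" and "f p \<noteq> 0"
  shows "differential_norm_sq M (\<lambda>c p. f p *\<^sub>R g c p) N h \<phi> p = differential_norm_sq M g N h \<phi> p / f p"
proof -
  note c = chart_at[OF M p]
  show ?thesis
    unfolding differential_norm_sq_def differential_norm_sq_rep_hs_inner hs_inner_def
      metric_rep_chart_map[OF M c] matrix_inv_scaleR[OF assms(4) metric_invertible[OF g c]]
    by (simp add: sum_divide_distrib)
qed

lemma differential_norm_sq_cong:
  assumes M: "smooth_manifold M" and p: "p \<in> topspace (mtop M)"
    and eq: "\<And>p. p \<in> topspace (mtop M) \<Longrightarrow> \<phi> p = \<psi> p"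
  shows "differential_norm_sq M g N h \<phi> p = differential_norm_sq M g N h \<psi> p"
proof -
  note c = chart_at[OF M p]
  let ?c = "chart_at M p"
  have x: "chart_map ?c p \<in> chart_img ?c" by (rule chart_map_in_img[OF c(2)])
  have rep: "map_rep ?c d \<phi> y = map_rep ?c d \<psi> y" if "y \<in> chart_img ?c" for y d
    unfolding map_rep_def using eq chart_map_inv(2)[OF that] chart_open(3)[OF M c(1)] by auto
  have pd: "partial_deriv j (map_rep ?c d \<phi>) (chart_map ?c p) = partial_deriv j (map_rep ?c d \<psi>) (chart_map ?c p)" for j d
    by (rule partial_deriv_cong_open[OF chart_open(2)[OF M c(1)] x rep])
  show ?thesis
    unfolding differential_norm_sq_def differential_norm_sq_rep_def Let_def pd rep[OF x] eq[OF p] ..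
qed

text \<open>\<open>weight\<close> is the condition under which the first variation of the
  \<alpha>-energy for f g is \<alpha> times an integral that vanishes by harmonicity for g.\<close>

lemma alpha_harmonic_conformal:
  fixes M :: "('a, 'm::finite) manifold" and N :: "('b, 'n::finite) manifold"
  assumes M: "smooth_manifold M" and g: "riemannian_metric M g" and compact: "compact_space (mtop M)"
    and N: "smooth_manifold N" and h: "riemannian_metric N h"
    and harm: "harmonic_map M g N h \<psi>" and f: "smooth_function M f"
    and pos: "\<And>p. p \<in> topspace (mtop M) \<Longrightarrow> f p > 0"
    and weight: "\<And>p. p \<in> topspace (mtop M) \<Longrightarrow>
      (1 + differential_norm_sq M g N h \<psi> p / f p) powr (\<alpha> - 1) * f p powr (real CARD('m) / 2 - 1) = 1"
  shows "alpha_harmonic_map \<alpha> M (\<lambda>c p. f p *\<^sub>R g c p) N h \<psi>"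
  unfolding alpha_harmonic_map_def
proof (intro conjI allI impI)
  show \<psi>: "smooth_map M N \<psi>" using harm by (simp add: harmonic_map_def)
  fix \<epsilon> \<Psi> assume \<Psi>: "smooth_variation M N \<psi> \<epsilon> \<Psi>"
  define g' where "g' = (\<lambda>c p. f p *\<^sub>R g c p)"
  have g': "riemannian_metric M g'"
    unfolding g'_def by (rule riemannian_metric_conformal[OF M g f pos])
  have \<epsilon>: "\<epsilon> > 0" using \<Psi> by (simp add: smooth_variation_def)
  have \<Psi>t: "smooth_map M N (\<Psi> t)" if "t \<in> {-\<epsilon><..<\<epsilon>}" for t
    by (rule smooth_variation_slice[OF M N \<Psi> that])
  have \<Psi>0: "\<Psi> 0 p = \<psi> p" if "p \<in> topspace (mtop M)" for p
    using \<Psi> that by (simp add: smooth_variation_def)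
  have harm0: "harmonic_map M g N h (\<Psi> 0)"
    by (rule harmonic_map_cong[OF M harm \<Psi>t \<Psi>0]) (use \<epsilon> in auto)
  obtain I C K \<eta> where part: "chart_partition_of_unity M I C K \<eta>"
    using partition_of_unity_exists[OF M compact] by blast
  note I = chart_partition_of_unityD(1)[OF part] and C = chart_partition_of_unityD(2)[OF part]
    and K = chart_partition_of_unityD(3,4)[OF part] and supp = chart_partition_of_unityD(5)[OF part]
    and \<eta> = chart_partition_of_unityD(6)[OF part] and one = chart_partition_of_unityD(7)[OF part]
  define E where "E c = (\<lambda>(t, x). differential_norm_sq M g' N h (\<Psi> t) (chart_inv c x))" for c :: "('a, 'm) chart"
  define w where "w c x = sqrt (det (metric_rep g' c x))" for c x
  define L where "L i t x = \<eta> i (chart_inv (C i) x) * ((1 + E (C i) (t, x)) powr \<alpha> * w (C i) x)" for i t x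
  define L' where "L' i t x = \<eta> i (chart_inv (C i) x) *
    (\<alpha> * (1 + E (C i) (t, x)) powr (\<alpha> - 1) * frechet_derivative (E (C i)) (at (t, x)) (1, 0) * w (C i) x)" for i t x
  have inM: "chart_inv c x \<in> topspace (mtop M)" if "c \<in> atlas M" "x \<in> chart_img c" for c x
    using chart_map_inv(2)[OF that(2)] chart_open(3)[OF M that(1)] by blast
  have E_nonneg: "E c (t, x) \<ge> 0" if "c \<in> atlas M" "x \<in> chart_img c" "t \<in> {-\<epsilon><..<\<epsilon>}" for c t x
    unfolding E_def using differential_norm_sq_nonneg[OF M N g' h \<Psi>t[OF that(3)] inM[OF that(1,2)]] by simp
  have tE: "times_cont_diff_on k (E c) ({-\<epsilon><..<\<epsilon>} \<times> chart_img c)" if "c \<in> atlas M" for k c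
    unfolding E_def by (rule tcd_energy_density[OF M N g' h \<Psi> that])
  have cw: "continuous_on (chart_img c) (w c)" if "c \<in> atlas M" for c
    unfolding w_def by (rule tcd_continuous_on[OF tcd_sqrt_det_metric[OF M g' that, of 0]])
  have cslice: "continuous_on (chart_img c) (\<lambda>x. (1 + E c (t, x)) powr \<alpha>)" if "c \<in> atlas M" "t \<in> {-\<epsilon><..<\<epsilon>}" for c t
  proof -
    have "continuous_on (chart_img c) (\<lambda>x. E c (t, x))"
      using that(2) by (intro continuous_on_compose2[OF tcd_continuous_on[OF tE[OF that(1), of 0]]] continuous_intros) auto
    moreover have "1 + E c (t, x) \<noteq> 0" if "x \<in> chart_img c" for x
      using E_nonneg[OF \<open>c \<in> atlas M\<close> that \<open>t \<in> {-\<epsilon><..<\<epsilon>}\<close>] by simp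
    ultimately show ?thesis
      by (intro continuous_intros) auto
  qed
  \<comment> \<open>The partition of unity turns the energy into finitely many integrals over fixed
    compact sets, which can be differentiated under the integral sign.\<close>
  have energy: "alpha_energy \<alpha> M g' N h (\<Psi> t) = (\<Sum>i\<in>I. LINT x|lborel. indicator (K i) x * L i t x)"
    if t: "t \<in> {-\<epsilon><..<\<epsilon>}" for t
  proof -
    define F where "F i p = \<eta> i p * (1 + differential_norm_sq M g' N h (\<Psi> t) p) powr \<alpha>" for i p
    have cF: "continuous_on (chart_img c) (\<lambda>x. F i (chart_inv c x))" if "i \<in> I" "c \<in> atlas M" for i c
      using cslice[OF that(2) t] unfolding F_def E_def
      by (auto intro!: continuous_on_mult tcd_continuous_on[OF \<eta>[OF that]])
    have F_meas: "F i \<in> borel_measurable (borel_manifold M)" if "i \<in> I" for i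
      by (rule borel_measurable_manifold[OF M cF[OF that]])
    have F_dom: "F i p = 0" if "i \<in> I" "p \<notin> chart_dom (C i)" for i p
      using supp[OF that(1)] that(2) by (simp add: F_def)
    have F_fun: "indicator (chart_img (C i)) x * (sqrt (det (metric_rep g' (C i) x)) * F i (chart_inv (C i) x))
      = indicator (K i) x * L i t x" if i: "i \<in> I" for i x
    proof (cases "x \<in> chart_img (C i)")
      case True
      have "\<eta> i (chart_inv (C i) x) = 0" if "x \<notin> K i"
        using supp[OF i, of "chart_inv (C i) x"] chart_map_inv[OF True] that by simp
      then show ?thesis
        using True by (auto simp: indicator_def F_def L_def E_def w_def)
    qed (use K(2)[OF i] in \<open>auto simp: indicator_def subset_iff\<close>)
    have cL: "continuous_on (K i) (L i t)" if i: "i \<in> I" for i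
      unfolding L_def
      by (intro continuous_on_mult continuous_on_subset[OF tcd_continuous_on[OF \<eta>[OF i C[OF i]]] K(2)[OF i]]
          continuous_on_subset[OF cslice[OF C[OF i] t] K(2)[OF i]] continuous_on_subset[OF cw[OF C[OF i]] K(2)[OF i]])
    have F_int: "integrable (volume_measure M g') (F i)" if i: "i \<in> I" for i
    proof (rule volume_measure_chart_integral(2)[OF M g' compact C[OF i] F_meas[OF i] F_dom[OF i], THEN iffD2])
      show "integrable lborel (\<lambda>x. indicator (chart_img (C i)) x * (sqrt (det (metric_rep g' (C i) x)) * F i (chart_inv (C i) x)))"
        unfolding F_fun[OF i] by (rule integrable_indicator_compact[OF K(1)[OF i] cL[OF i]])
    qed
    \<comment> \<open>The functions \<eta>_i are known to sum to 1 only on the topspace, so the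
      space of the measure has to be identified with it.\<close>
    have "space (volume_measure M g') = topspace (mtop M)"
      using volume_measure_spec[OF M g' compact] sets_eq_imp_space_eq space_borel_manifold
      unfolding volume_spec_def[OF M g'] by metis
    then have "alpha_energy \<alpha> M g' N h (\<Psi> t) = (LINT p|volume_measure M g'. (\<Sum>i\<in>I. F i p))"
      unfolding alpha_energy_def F_def sum_distrib_right[symmetric]
      by (intro Bochner_Integration.integral_cong refl) (simp add: one)
    also have "\<dots> = (\<Sum>i\<in>I. LINT p|volume_measure M g'. F i p)"
      by (rule Bochner_Integration.integral_sum) (rule F_int)
    also have "\<dots> = (\<Sum>i\<in>I. LINT x|lborel. indicator (K i) x * L i t x)"
      by (intro sum.cong refl) (simp add: volume_measure_chart_integral(1)[OF M g' compact C F_meas F_dom] F_fun)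
    finally show ?thesis .
  qed
  have deriv: "((\<lambda>t. LINT x|lborel. indicator (K i) x * L i t x) has_real_derivative
      (LINT x|lborel. indicator (K i) x * L' i 0 x)) (at 0)" if i: "i \<in> I" for i
  proof (rule has_real_derivative_integral_compact[of "\<epsilon> / 2"])
    let ?D = "{-\<epsilon><..<\<epsilon>} \<times> chart_img (C i)"
    \<comment> \<open>Halving \<epsilon> puts a compact time interval inside the open one on which
      the variation is defined.\<close>
    have sub: "{- (\<epsilon> / 2)..\<epsilon> / 2} \<times> K i \<subseteq> ?D" using \<epsilon> K(2)[OF i] by auto
    show "((\<lambda>s. L i s x) has_real_derivative L' i t x) (at t)" if "t \<in> {- (\<epsilon> / 2)..\<epsilon> / 2}" "x \<in> K i" for t x
    proof -
      have z: "(t, x) \<in> ?D" using that sub by blast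
      have dE: "(E (C i) has_derivative frechet_derivative (E (C i)) (at (t, x))) (at (t, x))"
        by (rule tcd_has_derivative[OF tE[OF C[OF i]] z])
      have eq: "(\<lambda>s. frechet_derivative (E (C i)) (at (t, x)) (s, 0)) = (*) (frechet_derivative (E (C i)) (at (t, x)) (1, 0))"
      proof
        fix s :: real
        have "(s, 0) = s *\<^sub>R (1 :: real, 0 :: real^'m)" by simp
        then show "frechet_derivative (E (C i)) (at (t, x)) (s, 0) = frechet_derivative (E (C i)) (at (t, x)) (1, 0) * s"
          by (simp only: linear_scale[OF has_derivative_linear[OF dE]] real_scaleR_def mult.commute)
      qed
      have "((\<lambda>s. E (C i) (s, x)) has_real_derivative frechet_derivative (E (C i)) (at (t, x)) (1, 0)) (at t)"
        using has_derivative_compose[OF has_derivative_Pair_left dE] unfolding has_field_derivative_def eq .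
      then have "((\<lambda>s. 1 + E (C i) (s, x)) has_real_derivative frechet_derivative (E (C i)) (at (t, x)) (1, 0)) (at t)"
        by (auto intro!: derivative_eq_intros)
      from DERIV_fun_powr[OF this, of \<alpha>] have "((\<lambda>s. (1 + E (C i) (s, x)) powr \<alpha>) has_real_derivative
          \<alpha> * (1 + E (C i) (t, x)) powr (\<alpha> - 1) * frechet_derivative (E (C i)) (at (t, x)) (1, 0)) (at t)"
        using E_nonneg[OF C[OF i], of x t] z by simp
      then show ?thesis
        unfolding L_def L'_def by (intro DERIV_cmult DERIV_cmult_right)
    qed
    have "continuous_on ?D (E (C i))"
      by (rule tcd_continuous_on[OF tE[OF C[OF i], of 0]])
    moreover have "continuous_on ?D (\<lambda>z. frechet_derivative (E (C i)) (at z) (1, 0))"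
      by (rule tcd_continuous_on[OF tcd_frechet_derivative[OF tE[OF C[OF i], of "Suc 0"]]])
    moreover have "continuous_on ?D (\<lambda>z. \<eta> i (chart_inv (C i) (snd z)))"
      by (intro continuous_on_compose2[OF tcd_continuous_on[OF \<eta>[OF i C[OF i]]]] continuous_intros) auto
    moreover have "continuous_on ?D (\<lambda>z. w (C i) (snd z))"
      by (intro continuous_on_compose2[OF cw[OF C[OF i]]] continuous_intros) auto
    moreover have "1 + E (C i) z \<noteq> 0" if "z \<in> ?D" for z
      using E_nonneg[OF C[OF i], of "snd z" "fst z"] that by (auto simp: add_nonneg_eq_0_iff)
    ultimately have "continuous_on ?D (\<lambda>z. \<eta> i (chart_inv (C i) (snd z)) *
      (\<alpha> * (1 + E (C i) z) powr (\<alpha> - 1) * frechet_derivative (E (C i)) (at z) (1, 0) * w (C i) (snd z)))"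
      by (intro continuous_intros) auto
    then show "continuous_on ({- (\<epsilon> / 2)..\<epsilon> / 2} \<times> K i) (\<lambda>(t, x). L' i t x)"
      unfolding L'_def case_prod_beta prod.collapse by (rule continuous_on_subset[OF _ sub])
    show "continuous_on (K i) (L i t)" if "t \<in> {- (\<epsilon> / 2)..\<epsilon> / 2}" for t
    proof -
      have t: "t \<in> {-\<epsilon><..<\<epsilon>}" using that \<epsilon> by auto
      show ?thesis
        unfolding L_def
        by (intro continuous_on_mult continuous_on_subset[OF tcd_continuous_on[OF \<eta>[OF i C[OF i]]] K(2)[OF i]]
            continuous_on_subset[OF cslice[OF C[OF i] t] K(2)[OF i]] continuous_on_subset[OF cw[OF C[OF i]] K(2)[OF i]])
    qed
  qed (use \<epsilon> K(1)[OF i] in auto)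
  have L'0: "L' i 0 x = \<alpha> * (\<eta> i (chart_inv (C i) x) * (sqrt (det (metric_rep g (C i) x)) *
      frechet_derivative (\<lambda>(t, x). differential_norm_sq M g N h (\<Psi> t) (chart_inv (C i) x)) (at (0, x)) (1, 0)))"
    if i: "i \<in> I" and "x \<in> K i" for i x
  proof -
    have x: "x \<in> chart_img (C i)" using K(2)[OF i] \<open>x \<in> K i\<close> by blast
    let ?p = "chart_inv (C i) x"
    let ?E0 = "\<lambda>(t, x). differential_norm_sq M g N h (\<Psi> t) (chart_inv (C i) x)"
    have p: "?p \<in> topspace (mtop M)" by (rule inM[OF C[OF i] x])
    have fp: "f ?p > 0" by (rule pos[OF p])
    have z: "(0, x) \<in> {-\<epsilon><..<\<epsilon>} \<times> chart_img (C i)" using x \<epsilon> by auto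
    have EE: "E (C i) (t, x) = ?E0 (t, x) / f ?p" for t
      using differential_norm_sq_conformal[OF M g p, of f N h "\<Psi> t"] fp by (simp add: E_def g'_def)
    have eq0: "differential_norm_sq M g N h (\<Psi> 0) ?p = differential_norm_sq M g N h \<psi> ?p"
      by (rule differential_norm_sq_cong[OF M p \<Psi>0])
    have E00: "E (C i) (0, x) = differential_norm_sq M g N h \<psi> ?p / f ?p"
      unfolding EE by (simp add: eq0)
    have dE0: "(?E0 has_derivative frechet_derivative ?E0 (at (0, x))) (at (0, x))"
      by (rule tcd_has_derivative[OF tcd_energy_density[OF M N g h \<Psi> C[OF i]] z])
    have dE: "(E (C i) has_derivative frechet_derivative (E (C i)) (at (0, x))) (at (0, x))"
      by (rule tcd_has_derivative[OF tE[OF C[OF i]] z])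
    have "((\<lambda>t. E (C i) (t, x)) has_derivative (\<lambda>s. frechet_derivative ?E0 (at (0, x)) (s, 0) / f ?p)) (at 0)"
      unfolding EE
      by (rule bounded_linear.has_derivative[OF bounded_linear_divide has_derivative_compose[OF has_derivative_Pair_left dE0]])
    from fun_cong[OF has_derivative_unique[OF has_derivative_compose[OF has_derivative_Pair_left dE] this], of 1]
    have DE: "frechet_derivative (E (C i)) (at (0, x)) (1, 0) = frechet_derivative ?E0 (at (0, x)) (1, 0) / f ?p" .
    have w: "w (C i) x = f ?p powr (real CARD('m) / 2) * sqrt (det (metric_rep g (C i) x))"
      unfolding w_def by (simp add: g'_def metric_rep_def det_scaleR real_sqrt_mult sqrt_power_powr[OF fp])
    \<comment> \<open>The volume density contributes f to the power m/2 and the squared norm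
      contributes 1/f; together they give the exponent m/2 - 1 of \<open>weight\<close>.\<close>
    have "f ?p powr (real CARD('m) / 2) = f ?p * f ?p powr (real CARD('m) / 2 - 1)"
      using fp powr_add[of "f ?p" 1 "real CARD('m) / 2 - 1"] by simp
    then have "(1 + E (C i) (0, x)) powr (\<alpha> - 1) * (frechet_derivative ?E0 (at (0, x)) (1, 0) / f ?p) * w (C i) x
        = ((1 + E (C i) (0, x)) powr (\<alpha> - 1) * f ?p powr (real CARD('m) / 2 - 1)) *
          (sqrt (det (metric_rep g (C i) x)) * frechet_derivative ?E0 (at (0, x)) (1, 0))"
      unfolding w using fp by simp
    then have cancel: "(1 + E (C i) (0, x)) powr (\<alpha> - 1) * (frechet_derivative ?E0 (at (0, x)) (1, 0) / f ?p) * w (C i) x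
        = sqrt (det (metric_rep g (C i) x)) * frechet_derivative ?E0 (at (0, x)) (1, 0)"
      unfolding E00 weight[OF p] by simp
    have "L' i 0 x = \<alpha> * (\<eta> i ?p * ((1 + E (C i) (0, x)) powr (\<alpha> - 1) *
        (frechet_derivative ?E0 (at (0, x)) (1, 0) / f ?p) * w (C i) x))"
      unfolding L'_def DE by (simp only: mult_ac)
    then show ?thesis
      unfolding cancel .
  qed
  have "(\<Sum>i\<in>I. LINT x|lborel. indicator (K i) x * L' i 0 x) = \<alpha> * (\<Sum>i\<in>I. LINT x|lborel. indicator (K i) x *
      (\<eta> i (chart_inv (C i) x) * (sqrt (det (metric_rep g (C i) x)) *
      frechet_derivative (\<lambda>(t, x). differential_norm_sq M g N h (\<Psi> t) (chart_inv (C i) x)) (at (0, x)) (1, 0))))"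
    unfolding sum_distrib_left
  proof (intro sum.cong refl)
    fix i assume i: "i \<in> I"
    have "indicator (K i) x * L' i 0 x = \<alpha> * (indicator (K i) x * (\<eta> i (chart_inv (C i) x) * (sqrt (det (metric_rep g (C i) x)) *
      frechet_derivative (\<lambda>(t, x). differential_norm_sq M g N h (\<Psi> t) (chart_inv (C i) x)) (at (0, x)) (1, 0))))" for x
      using L'0[OF i, of x] by (cases "x \<in> K i") simp_all
    then show "(LINT x|lborel. indicator (K i) x * L' i 0 x) = \<alpha> * (LINT x|lborel. indicator (K i) x *
      (\<eta> i (chart_inv (C i) x) * (sqrt (det (metric_rep g (C i) x)) *
      frechet_derivative (\<lambda>(t, x). differential_norm_sq M g N h (\<Psi> t) (chart_inv (C i) x)) (at (0, x)) (1, 0))))"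
      by (simp only: integral_mult_right_zero)
  qed
  also have "\<dots> = 0"
    using integral_energy_variation_zero[OF M N g h \<Psi> compact harm0 part] by simp
  finally have zero: "(\<Sum>i\<in>I. LINT x|lborel. indicator (K i) x * L' i 0 x) = 0" .
  have "((\<lambda>t. \<Sum>i\<in>I. LINT x|lborel. indicator (K i) x * L i t x) has_real_derivative
      (\<Sum>i\<in>I. LINT x|lborel. indicator (K i) x * L' i 0 x)) (at 0)"
    by (rule DERIV_sum) (rule deriv)
  then have "((\<lambda>t. \<Sum>i\<in>I. LINT x|lborel. indicator (K i) x * L i t x) has_real_derivative 0) (at 0)"
    unfolding zero .
  \<comment> \<open>The chart formula for the energy is available for |t| < \<epsilon>, a
    neighbourhood of 0.\<close>
  then have "((\<lambda>t. alpha_energy \<alpha> M g' N h (\<Psi> t)) has_real_derivative 0) (at 0)"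
    by (rule has_field_derivative_transform_within_open[of _ _ _ "{-\<epsilon><..<\<epsilon>}"]) (use \<epsilon> energy in auto)
  then show "((\<lambda>t. alpha_energy \<alpha> M (\<lambda>c p. f p *\<^sub>R g c p) N h (\<Psi> t)) has_real_derivative 0) (at 0)"
    unfolding g'_def .
qed

theorem theorem5:
  fixes \<alpha> :: real
    and M :: "('a, 'm::finite) manifold" and g :: "('a, 'm) metric"
    and N :: "('b, 'n::finite) manifold" and h :: "('b, 'n) metric"
    and \<psi> :: "'a \<Rightarrow> 'b"
  assumes "\<alpha> > 1"
    and "riemannian_manifold M g" and "compact_space (mtop M)"
    and "riemannian_manifold N h" and "compact_space (mtop N)"
    and "harmonic_map M g N h \<psi>"
    and "real CARD('m) > 2 * \<alpha>"
  shows "\<exists>gbar. riemannian_metric M gbar \<and> conformally_equivalent M g gbar \<and>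
           alpha_harmonic_map \<alpha> M gbar N h \<psi>"
proof -
  have M: "smooth_manifold M" and g: "riemannian_metric M g" and N: "smooth_manifold N" and h: "riemannian_metric N h"
    using assms by (auto simp: riemannian_manifold_def)
  have \<psi>: "smooth_map M N \<psi>" using assms(6) by (simp add: harmonic_map_def)
  define m where "m = real CARD('m)"
  have m: "m > 2 * \<alpha>" "m > 2" using assms(1,7) by (auto simp: m_def)
  \<comment> \<open>Chosen such that \<beta> (m/2 - 1) = \<alpha> - 1; this makes the two powers of
    1 + S e in \<open>weight\<close> cancel.\<close>
  define \<beta> where "\<beta> = 2 * (\<alpha> - 1) / (m - 2)"
  have \<beta>: "0 < \<beta>" "\<beta> < 1" using m assms(1) by (auto simp: \<beta>_def field_simps)
  obtain S J where J: "open J" "{0..} \<subseteq> J" and S: "\<And>k. times_cont_diff_on k S J" "\<And>e. e \<in> J \<Longrightarrow> S e > -1/2"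
    "\<And>e. e \<ge> 0 \<Longrightarrow> S e \<ge> 0 \<and> S e * (1 + S e) powr (- \<beta>) = e"
    using conformal_profile_exists[OF \<beta>] by metis
  let ?e = "differential_norm_sq M g N h \<psi>"
  have e: "?e p \<ge> 0" if "p \<in> topspace (mtop M)" for p
    by (rule differential_norm_sq_nonneg[OF M N g h \<psi> that])
  define f where "f p = (1 + S (?e p)) powr (- \<beta>)" for p
  have Se: "S (?e p) \<ge> 0" "S (?e p) * f p = ?e p" if "p \<in> topspace (mtop M)" for p
    using S(3)[OF e[OF that]] by (auto simp: f_def)
  have pos: "f p > 0" if "p \<in> topspace (mtop M)" for p
    using Se(1)[OF that] by (simp add: f_def)
  have inM: "chart_inv c x \<in> topspace (mtop M)" if "c \<in> atlas M" "x \<in> chart_img c" for c x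
    using chart_map_inv(2)[OF that(2)] chart_open(3)[OF M that(1)] by blast
  have f: "smooth_function M f"
    unfolding smooth_function_def smooth_on_def
  proof (intro ballI allI)
    fix c k assume c: "c \<in> atlas M"
    \<comment> \<open>The composition is legitimate because e takes values in {0..}, which lies
      inside the open domain J of S.\<close>
    have "times_cont_diff_on k (\<lambda>x. S (?e (chart_inv c x))) (chart_img c)"
      by (rule tcd_compose[OF chart_open(2)[OF M c] J(1) _ S(1) tcd_differential_norm_sq[OF M N g h \<psi> c]])
        (use J(2) e inM[OF c] in auto)
    then have "times_cont_diff_on k (\<lambda>x. (1 + S (?e (chart_inv c x))) powr (- \<beta>)) (chart_img c)"
      by (intro tcd_powr_compose tcd_add tcd_const chart_open(2)[OF M c])
        (use Se(1)[OF inM[OF c]] in \<open>auto simp: add_pos_nonneg\<close>)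
    then show "times_cont_diff_on k (f \<circ> chart_inv c) (chart_img c)"
      by (simp add: f_def o_def)
  qed
  have weight: "(1 + ?e p / f p) powr (\<alpha> - 1) * f p powr (real CARD('m) / 2 - 1) = 1" if p: "p \<in> topspace (mtop M)" for p
  proof -
    have "?e p / f p = S (?e p)"
      using Se(2)[OF p] pos[OF p] by (simp add: field_simps)
    moreover have "f p powr (m / 2 - 1) = (1 + S (?e p)) powr (- \<beta> * (m / 2 - 1))"
      unfolding f_def by (rule powr_powr)
    moreover have "- \<beta> * (m / 2 - 1) = - (\<alpha> - 1)"
      using m(2) by (simp add: \<beta>_def field_simps)
    ultimately have "(1 + ?e p / f p) powr (\<alpha> - 1) * f p powr (m / 2 - 1)
        = (1 + S (?e p)) powr (\<alpha> - 1) * (1 + S (?e p)) powr (- (\<alpha> - 1))"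
      by simp
    also have "\<dots> = 1"
      using Se(1)[OF p] by (simp add: powr_add[symmetric])
    finally show ?thesis by (simp add: m_def)
  qed
  show ?thesis
  proof (intro exI conjI)
    show "riemannian_metric M (\<lambda>c p. f p *\<^sub>R g c p)"
      by (rule riemannian_metric_conformal[OF M g f pos])
    show "conformally_equivalent M g (\<lambda>c p. f p *\<^sub>R g c p)"
      unfolding conformally_equivalent_def using f pos by blast
    show "alpha_harmonic_map \<alpha> M (\<lambda>c p. f p *\<^sub>R g c p) N h \<psi>"
      by (rule alpha_harmonic_conformal[OF M g assms(3) N h assms(6) f pos weight])
  qed
qed

end
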